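(* On the connected non-compact oriented $C^\infty$ Riemannian manifolds $(M^3_\Gamma,h_t)$ there exists, for every $t\neq0$ and every curve $\Gamma$, a proper continuous function $\varphi:M^3_\Gamma\to\mathbb R$ and a compact set $K_\varphi\subset M^3_\Gamma$ such that (a) $\varphi$ is $C^\infty$; (b) $\varphi$ is uniformly Lipschitz; (c) $\varphi|_{M^3_\Gamma\setminus K_\varphi}$ is subharmonic. In particular, writing $M=M^3_\Gamma$: if $f$ is a nonnegative function in $\Sigma(M)$ such that $\{m\in M: f(m)>0,\ \varphi(m)>\max_{K_\varphi}\varphi,\ \mathrm{grad}\,\varphi(m)\neq0\}\neq\emptyset$, then there exist constants $A_f>0$ and $\tau_0$ such that $\int_{\{m\in M:\ \varphi(m)\le\tau\}}f\,dM\ge A_f(\tau-\tau_0)$ for all $\tau\ge\tau_0$; in particular $\int_Mf\,dM=+\infty$.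
   Context: Eguchi--Hanson space: $T^*\mathbb P^1(\mathbb C)$ is realized as $H^2=\{(\alpha,\beta,\gamma)\in(\mathbb C^2\setminus\{0\})\times\mathbb C\}/\sim$, where $(\alpha,\beta,\gamma)\sim(A\alpha,A\beta,\gamma/A^2)$ for $A\in\mathbb C^*$; the projection is $p([\alpha,\beta,\gamma])=\alpha/\beta\in\mathbb C\cup\{\infty\}=\mathbb P^1(\mathbb C)$. The complement of the zero section $\{\gamma=0\}$ is identified with $(\mathbb C^2\setminus\{0\})/\{\pm1\}$ by $[\alpha,\beta,\gamma]\mapsto \pm(z_1,z_2)=\pm(\alpha\sqrt\gamma,\beta\sqrt\gamma)$. Put $u_1=|z_1|^2+|z_2|^2$ and $f_t=\sqrt{u_1^2+t^4}+t^2\log\frac{u_1}{\sqrt{u_1^2+t^4}+t^2}$. The form $\omega_t=i\partial\bar\partial f_t$ extends to a Kähler form on $H^2$, and $g_t(X,Y)=\omega_t(X,JY)$ is the Eguchi--Hanson metric ($J$ the complex structure). For a smooth curve $\Gamma$ in $\mathbb C$ parametrized by Euclidean arc length, $M^3_\Gamma=p^{-1}(\Gamma)\subset H^2$ with the metric $h_t$ induced by $g_t$. Convention: $\Delta f=-\mathrm{div}(\mathrm{grad}f)$, and a $C^2$ function is subharmonic if $\Delta f\le0$. $\Sigma(M)$ denotes the closure of the set of all $C^\infty$ subharmonic functions in $C^0(M)$ (uniform convergence on compact sets).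
   Formalization: Γ is a simple closed curve or an embedded open arc; for open arcs (M_Γ,h_t) is assumed complete, which a proper uniformly Lipschitz φ forces. The claim fails e.g. for Γ the real line, where points of the zero section over the integers n→∞ are Cauchy but leave every compact set. *)

theory Defs
  imports "HOL-Analysis.Analysis"
begin

section \<open>Functions of class $C^k$ on open subsets of Euclidean space\<close>

primrec Ck_on ::
  "nat \<Rightarrow> 'a::euclidean_space set \<Rightarrow> ('a \<Rightarrow> 'b::real_normed_vector) \<Rightarrow> bool" where
  "Ck_on 0 U f \<longleftrightarrow> continuous_on U f"
| "Ck_on (Suc k) U f \<longleftrightarrow> (\<forall>x\<in>U. f differentiable (at x)) \<and>
     (\<forall>b\<in>Basis. Ck_on k U (\<lambda>x. frechet_derivative f (at x) b))"

definition smooth_on :: "'a::euclidean_space set \<Rightarrow> ('a \<Rightarrow> 'b::real_normed_vector) \<Rightarrow> bool" where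
  "smooth_on U f \<longleftrightarrow> (\<forall>k. Ck_on k U f)"

section \<open>Riemannian geometry in local coordinates\<close>

text \<open>A metric on an open set \<open>U\<close> of \<open>real ^ 'n\<close> is a map \<open>g\<close>, where \<open>g x v w\<close> is the
  inner product of the tangent vectors \<open>v, w\<close> at \<open>x \<in> U\<close>.\<close>

definition gram :: "(real^'n \<Rightarrow> real^'n \<Rightarrow> real) \<Rightarrow> real^'n^'n" where
  "gram b = (\<chi> i j. b (axis i 1) (axis j 1))"

definition vol_density :: "(real^'n \<Rightarrow> real^'n \<Rightarrow> real^'n \<Rightarrow> real) \<Rightarrow> real^'n \<Rightarrow> real" where
  "vol_density g x = sqrt (det (gram (g x)))"

definition grad_coord ::
  "(real^'n \<Rightarrow> real^'n \<Rightarrow> real^'n \<Rightarrow> real) \<Rightarrow> (real^'n \<Rightarrow> real) \<Rightarrow> real^'n \<Rightarrow> real^'n" where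
  "grad_coord g f x = (THE v. \<forall>w. g x v w = frechet_derivative f (at x) w)"

definition div_coord ::
  "(real^'n \<Rightarrow> real^'n \<Rightarrow> real^'n \<Rightarrow> real) \<Rightarrow> (real^'n \<Rightarrow> real^'n) \<Rightarrow> real^'n \<Rightarrow> real" where
  "div_coord g X x =
     (\<Sum>i\<in>UNIV. frechet_derivative (\<lambda>y. vol_density g y * X y $ i) (at x) (axis i 1))
       / vol_density g x"

text \<open>Sign convention: the Laplacian is minus the divergence of the gradient.\<close>

definition laplace_coord ::
  "(real^'n \<Rightarrow> real^'n \<Rightarrow> real^'n \<Rightarrow> real) \<Rightarrow> (real^'n \<Rightarrow> real) \<Rightarrow> real^'n \<Rightarrow> real" where
  "laplace_coord g f x = - div_coord g (grad_coord g f) x"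

section \<open>Riemannian manifolds presented by an atlas\<close>

text \<open>An element \<open>(U, \<sigma>)\<close> of the atlas is an inverse chart, that is a parametrization
  \<open>\<sigma>\<close> defined on the open set \<open>U\<close>; \<open>gmetric M \<sigma>\<close> is the metric in the
  coordinates given by \<open>\<sigma>\<close>.\<close>

record ('p, 'n) riem_mfd =
  mtop :: "'p topology"
  atlas :: "((real^'n) set \<times> (real^'n \<Rightarrow> 'p)) set"
  gmetric :: "(real^'n \<Rightarrow> 'p) \<Rightarrow> real^'n \<Rightarrow> real^'n \<Rightarrow> real^'n \<Rightarrow> real"

abbreviation carr :: "('p, 'n::finite) riem_mfd \<Rightarrow> 'p set" where
  "carr M \<equiv> topspace (mtop M)"

abbreviation transition_map ::
  "(real^'n) set \<Rightarrow> (real^'n \<Rightarrow> 'p) \<Rightarrow> (real^'n \<Rightarrow> 'p) \<Rightarrow> real^'n \<Rightarrow> real^'n" where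
  "transition_map V \<tau> \<sigma> \<equiv> \<lambda>x. inv_into V \<tau> (\<sigma> x)"

definition oriented_riemannian_manifold :: "('p, 'n::finite) riem_mfd \<Rightarrow> bool" where
  "oriented_riemannian_manifold M \<longleftrightarrow>
     Hausdorff_space (mtop M) \<and>
     (\<exists>\<B>. countable \<B> \<and> (\<forall>B\<in>\<B>. openin (mtop M) B) \<and>
          (\<forall>W x. openin (mtop M) W \<and> x \<in> W \<longrightarrow> (\<exists>B\<in>\<B>. x \<in> B \<and> B \<subseteq> W))) \<and>
     (\<Union>(U, \<sigma>)\<in>atlas M. \<sigma> ` U) = carr M \<and>
     (\<forall>(U, \<sigma>)\<in>atlas M.
        open U \<and> openin (mtop M) (\<sigma> ` U) \<and>
        homeomorphic_map (top_of_set U) (subtopology (mtop M) (\<sigma> ` U)) \<sigma> \<and>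
        (\<forall>x\<in>U. bilinear (gmetric M \<sigma> x) \<and>
           (\<forall>v w. gmetric M \<sigma> x v w = gmetric M \<sigma> x w v) \<and>
           (\<forall>v. v \<noteq> 0 \<longrightarrow> 0 < gmetric M \<sigma> x v v)) \<and>
        (\<forall>v w. smooth_on U (\<lambda>x. gmetric M \<sigma> x v w))) \<and>
     (\<forall>(U, \<sigma>)\<in>atlas M. \<forall>(V, \<tau>)\<in>atlas M.
        smooth_on {x \<in> U. \<sigma> x \<in> \<tau> ` V} (transition_map V \<tau> \<sigma>) \<and>
        (\<forall>x\<in>U. \<sigma> x \<in> \<tau> ` V \<longrightarrow>
           (let D = frechet_derivative (transition_map V \<tau> \<sigma>) (at x) in
              0 < det (matrix D) \<and>
              (\<forall>v w. gmetric M \<sigma> x v w =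
                 gmetric M \<tau> (transition_map V \<tau> \<sigma> x) (D v) (D w)))))"

definition Cinf :: "('p, 'n::finite) riem_mfd \<Rightarrow> ('p \<Rightarrow> real) \<Rightarrow> bool" where
  "Cinf M f \<longleftrightarrow> (\<forall>(U, \<sigma>)\<in>atlas M. smooth_on U (f \<circ> \<sigma>))"

text \<open>\<open>S\<close> is meant to be an open subset of \<open>M\<close>; the restriction of \<open>f\<close> to \<open>S\<close> is of class
  $C^2$ with nonpositive Laplacian.\<close>

definition subharmonic_on ::
  "('p, 'n::finite) riem_mfd \<Rightarrow> 'p set \<Rightarrow> ('p \<Rightarrow> real) \<Rightarrow> bool" where
  "subharmonic_on M S f \<longleftrightarrow> (\<forall>(U, \<sigma>)\<in>atlas M.
     Ck_on 2 {x \<in> U. \<sigma> x \<in> S} (f \<circ> \<sigma>) \<and>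
     (\<forall>x\<in>U. \<sigma> x \<in> S \<longrightarrow> laplace_coord (gmetric M \<sigma>) (f \<circ> \<sigma>) x \<le> 0))"

text \<open>The closure of the smooth subharmonic functions among the continuous functions, for
  uniform convergence on compact sets.\<close>

definition Sigma_closure :: "('p, 'n::finite) riem_mfd \<Rightarrow> ('p \<Rightarrow> real) set" where
  "Sigma_closure M = {f. continuous_map (mtop M) euclideanreal f \<and>
     (\<forall>K \<epsilon>. compactin (mtop M) K \<and> 0 < \<epsilon> \<longrightarrow>
        (\<exists>h. Cinf M h \<and> subharmonic_on M (carr M) h \<and> (\<forall>m\<in>K. \<bar>f m - h m\<bar> < \<epsilon>)))}"

definition nonzero_grad_at :: "('p, 'n::finite) riem_mfd \<Rightarrow> ('p \<Rightarrow> real) \<Rightarrow> 'p \<Rightarrow> bool" where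
  "nonzero_grad_at M f m \<longleftrightarrow> (\<exists>(U, \<sigma>)\<in>atlas M. \<exists>x\<in>U.
     \<sigma> x = m \<and> grad_coord (gmetric M \<sigma>) (f \<circ> \<sigma>) x \<noteq> 0)"

definition riem_volume :: "('p, 'n::finite) riem_mfd \<Rightarrow> 'p measure" where
  "riem_volume M = (THE \<mu>. sets \<mu> = sets (sigma (carr M) {W. openin (mtop M) W}) \<and>
     (\<forall>(U, \<sigma>)\<in>atlas M. \<forall>B\<in>sets borel. B \<subseteq> U \<longrightarrow>
        emeasure \<mu> (\<sigma> ` B) = (\<integral>\<^sup>+x\<in>B. ennreal (vol_density (gmetric M \<sigma>) x) \<partial>lborel)))"

definition pw_C1_path :: "('p, 'n::finite) riem_mfd \<Rightarrow> (real \<Rightarrow> 'p) \<Rightarrow> bool" where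
  "pw_C1_path M c \<longleftrightarrow> pathin (mtop M) c \<and>
     (\<exists>F. finite F \<and> (\<forall>(U, \<sigma>)\<in>atlas M.
        (inv_into U \<sigma> \<circ> c) C1_differentiable_on {s \<in> {0<..<1} - F. c s \<in> \<sigma> ` U}))"

definition speed :: "('p, 'n::finite) riem_mfd \<Rightarrow> (real \<Rightarrow> 'p) \<Rightarrow> real \<Rightarrow> real" where
  "speed M c s = (let (U, \<sigma>) = (SOME (U, \<sigma>). (U, \<sigma>) \<in> atlas M \<and> c s \<in> \<sigma> ` U);
                      v = vector_derivative (inv_into U \<sigma> \<circ> c) (at s)
                  in sqrt (gmetric M \<sigma> (inv_into U \<sigma> (c s)) v v))"

definition path_len :: "('p, 'n::finite) riem_mfd \<Rightarrow> (real \<Rightarrow> 'p) \<Rightarrow> ennreal" where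
  "path_len M c = (\<integral>\<^sup>+s\<in>{0<..<1}. ennreal (speed M c s) \<partial>lborel)"

definition riem_dist :: "('p, 'n::finite) riem_mfd \<Rightarrow> 'p \<Rightarrow> 'p \<Rightarrow> ennreal" where
  "riem_dist M x y = (INF c\<in>{c. pw_C1_path M c \<and> c 0 = x \<and> c 1 = y}. path_len M c)"

definition uniformly_lipschitz :: "('p, 'n::finite) riem_mfd \<Rightarrow> ('p \<Rightarrow> real) \<Rightarrow> bool" where
  "uniformly_lipschitz M f \<longleftrightarrow> (\<exists>L::real. 0 \<le> L \<and> (\<forall>x\<in>carr M. \<forall>y\<in>carr M.
     ennreal \<bar>f x - f y\<bar> \<le> ennreal L * riem_dist M x y))"

definition riem_complete :: "('p, 'n::finite) riem_mfd \<Rightarrow> bool" where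
  "riem_complete M \<longleftrightarrow> (\<forall>x. (\<forall>n::nat. x n \<in> carr M) \<and>
     (\<forall>\<epsilon>>0. \<exists>N. \<forall>m\<ge>N. \<forall>n\<ge>N. riem_dist M (x m) (x n) < \<epsilon>) \<longrightarrow>
     (\<exists>l\<in>carr M. (\<lambda>n. riem_dist M (x n) l) \<longlonglongrightarrow> 0))"

section \<open>Eguchi--Hanson space\<close>

definition eh_dom :: "(complex \<times> complex \<times> complex) set" where
  "eh_dom = {(\<alpha>, \<beta>, \<gamma>). (\<alpha>, \<beta>) \<noteq> (0, 0)}"

definition eh_rel :: "((complex \<times> complex \<times> complex) \<times> (complex \<times> complex \<times> complex)) set" where
  "eh_rel = {((\<alpha>, \<beta>, \<gamma>), (\<alpha>', \<beta>', \<gamma>')). (\<alpha>, \<beta>) \<noteq> (0, 0) \<and>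
     (\<exists>A. A \<noteq> 0 \<and> \<alpha>' = A * \<alpha> \<and> \<beta>' = A * \<beta> \<and> \<gamma>' = \<gamma> / A\<^sup>2)}"

type_synonym eh_point = "(complex \<times> complex \<times> complex) set"

definition eh_class :: "complex \<times> complex \<times> complex \<Rightarrow> eh_point" where
  "eh_class x = eh_rel `` {x}"

definition EH :: "eh_point set" where
  "EH = eh_dom // eh_rel"

definition EH_top :: "eh_point topology" where
  "EH_top = topology (\<lambda>W. W \<subseteq> EH \<and> openin (top_of_set eh_dom) {x \<in> eh_dom. eh_class x \<in> W})"

text \<open>The following functions of a point are computed from an arbitrary representative.
  The Riemann sphere is modelled as \<open>complex option\<close>, with \<open>None\<close> the point at infinity.\<close>

definition eh_proj :: "eh_point \<Rightarrow> complex option" where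
  "eh_proj q = (let (\<alpha>, \<beta>, \<gamma>) = (SOME x. x \<in> q) in if \<beta> = 0 then None else Some (\<alpha> / \<beta>))"

definition eh_zero_section :: "eh_point set" where
  "eh_zero_section = {q \<in> EH. \<exists>\<alpha> \<beta>. q = eh_class (\<alpha>, \<beta>, 0)}"

definition eh_u1 :: "eh_point \<Rightarrow> real" where
  "eh_u1 q = (let (\<alpha>, \<beta>, \<gamma>) = (SOME x. x \<in> q)
              in (cmod (\<alpha> * csqrt \<gamma>))\<^sup>2 + (cmod (\<beta> * csqrt \<gamma>))\<^sup>2)"

definition eh_potential :: "real \<Rightarrow> eh_point \<Rightarrow> real" where
  "eh_potential t q = (let u = eh_u1 q in
     sqrt (u\<^sup>2 + t^4) + t\<^sup>2 * ln (u / (sqrt (u\<^sup>2 + t^4) + t\<^sup>2)))"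

text \<open>The holomorphic parametrization of the open set of the points over finite elements of
  the Riemann sphere; it contains the preimage of every curve in the complex plane.\<close>

definition eh_param :: "complex^2 \<Rightarrow> eh_point" where
  "eh_param x = eh_class (x $ 1, 1, x $ 2)"

definition eh_coords :: "eh_point \<Rightarrow> complex^2" where
  "eh_coords = inv_into UNIV eh_param"

text \<open>Wirtinger derivatives with respect to the \<open>j\<close>-th complex coordinate.\<close>

definition d_z :: "'m \<Rightarrow> (complex^'m \<Rightarrow> complex) \<Rightarrow> complex^'m \<Rightarrow> complex" where
  "d_z j f x = (frechet_derivative f (at x) (axis j 1)
                  - \<i> * frechet_derivative f (at x) (axis j \<i>)) / 2"

definition d_zbar :: "'m \<Rightarrow> (complex^'m \<Rightarrow> complex) \<Rightarrow> complex^'m \<Rightarrow> complex" where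
  "d_zbar j f x = (frechet_derivative f (at x) (axis j 1)
                     + \<i> * frechet_derivative f (at x) (axis j \<i>)) / 2"

text \<open>The two-form $i\partial\bar\partial f = i \sum_{j,k} (\partial_j \bar\partial_k f)\,
  dz_j \wedge d\bar z_k$, evaluated at the point \<open>x\<close> on the real tangent vectors \<open>X, Y\<close>.\<close>

definition i_ddbar ::
  "(complex^'m \<Rightarrow> complex) \<Rightarrow> complex^'m \<Rightarrow> complex^'m \<Rightarrow> complex^'m \<Rightarrow> complex" where
  "i_ddbar f x X Y = \<i> * (\<Sum>j\<in>UNIV. \<Sum>k\<in>UNIV.
     d_z j (d_zbar k f) x * (X $ j * cnj (Y $ k) - Y $ j * cnj (X $ k)))"

text \<open>The Kaehler form in the coordinates \<open>eh_param\<close>. The potential is singular along the zero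
  section; the limit is the extension of the form across it by continuity (and at the other
  points just the value there).\<close>

definition eh_form :: "real \<Rightarrow> complex^2 \<Rightarrow> complex^2 \<Rightarrow> complex^2 \<Rightarrow> complex" where
  "eh_form t x X Y = Lim (at x within {y. eh_param y \<notin> eh_zero_section})
     (\<lambda>y. i_ddbar (\<lambda>z. complex_of_real (eh_potential t (eh_param z))) y X Y)"

text \<open>The form is real valued on real tangent vectors, so taking the real part only changes the
  type; the complex structure is multiplication by \<open>\<i>\<close>.\<close>

definition eh_metric :: "real \<Rightarrow> complex^2 \<Rightarrow> complex^2 \<Rightarrow> complex^2 \<Rightarrow> real" where
  "eh_metric t x X Y = Re (eh_form t x X (\<i> *s Y))"

section \<open>Curves and the three-manifolds over them\<close>

definition unit_speed_curve :: "(real \<Rightarrow> complex) \<Rightarrow> real set \<Rightarrow> bool" where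
  "unit_speed_curve \<Gamma> J \<longleftrightarrow> open J \<and> connected J \<and> J \<noteq> {} \<and> smooth_on J \<Gamma> \<and>
     (\<forall>s\<in>J. cmod (vector_derivative \<Gamma> (at s)) = 1)"

text \<open>The two kinds of connected one-dimensional embedded submanifolds of the plane.\<close>

definition closed_curve :: "(real \<Rightarrow> complex) \<Rightarrow> real set \<Rightarrow> bool" where
  "closed_curve \<Gamma> J \<longleftrightarrow> unit_speed_curve \<Gamma> J \<and> J = UNIV \<and>
     (\<exists>L>0. \<forall>s s'. \<Gamma> s = \<Gamma> s' \<longleftrightarrow> (\<exists>k::int. s' = s + of_int k * L))"

definition open_curve :: "(real \<Rightarrow> complex) \<Rightarrow> real set \<Rightarrow> bool" where
  "open_curve \<Gamma> J \<longleftrightarrow> unit_speed_curve \<Gamma> J \<and> (\<exists>\<Gamma>'. homeomorphism J (\<Gamma> ` J) \<Gamma> \<Gamma>')"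

definition eh_preimage :: "complex set \<Rightarrow> eh_point set" where
  "eh_preimage C = {q \<in> EH. eh_proj q \<in> Some ` C}"

definition curve_param :: "(real \<Rightarrow> complex) \<Rightarrow> real^3 \<Rightarrow> eh_point" where
  "curve_param \<Gamma> x = eh_class (\<Gamma> (x $ 1), 1, Complex (x $ 2) (x $ 3))"

text \<open>The manifold over the curve: the subspace topology, the local parametrizations obtained from
  the arc length parameter and the complex fibre coordinate, and the metric induced by the
  Eguchi--Hanson metric (pulled back under the parametrizations).\<close>

definition eh_three_manifold ::
  "real \<Rightarrow> (real \<Rightarrow> complex) \<Rightarrow> real set \<Rightarrow> (eh_point, 3) riem_mfd" where
  "eh_three_manifold t \<Gamma> J =
     \<lparr> mtop = subtopology EH_top (eh_preimage (\<Gamma> ` J)),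
       atlas = {({x. x $ 1 \<in> I}, curve_param \<Gamma>) | I. open I \<and> I \<subseteq> J \<and> inj_on \<Gamma> I},
       gmetric = (\<lambda>\<sigma> x v w.
         let D = frechet_derivative (eh_coords \<circ> \<sigma>) (at x)
         in eh_metric t (eh_coords (\<sigma> x)) (D v) (D w)) \<rparr>"

end

theory Submission
  imports Defs
begin

text \<open>
  Let \<open>l\<close> be the arc length of the curve in the spherical metric. After a rotation of the fibres
  the manifold over the curve carries the metric \<open>2 S dl^2 + |d\<zeta>|^2 / (2 S)\<close> with
  \<open>S = sqrt (|\<zeta>|^2 + t^4)\<close>, where \<open>|\<zeta>| = u1\<close>. Hence \<open>sqrt S + c(l)\<close> is subharmonic and Lipschitz as
  soon as \<open>c\<close> is convex and Lipschitz. For a closed curve \<open>c = 0\<close> makes it proper; for a complete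
  open curve \<open>l\<close> runs through the whole line, and \<open>c = sqrt (1 + l^2)\<close> does.

  For the growth of integrals, let \<open>f >= 0\<close> be a limit of subharmonic functions. Then the integral of
  \<open>f div grad \<psi>\<close> is nonnegative for every nonnegative compactly supported test function \<open>\<psi>\<close> of
  class $C^2$. Take \<open>\<psi> = \<eta>(\<phi>)\<close> with \<open>\<eta>\<close> nonincreasing: since \<open>div grad \<phi> >= 0\<close>, the integral of
  \<open>f \<eta>''(\<phi>) |grad \<phi>|^2\<close> is nonnegative. Let \<open>\<eta>\<close> bend down near a level where \<open>f\<close> and \<open>grad \<phi>\<close> do
  not vanish, and bend back to zero over a much longer interval of length \<open>2 T\<close>, where
  \<open>\<eta>'' <= 1 / T\<close>. The first part contributes a fixed negative amount, so the integral of \<open>f\<close> over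
  the sublevel set is at least a constant times \<open>T\<close>.
\<close>

section \<open>Calculus of functions of class $C^k$\<close>

text \<open>Why the root of \<open>S\<close>: in the coordinates l and \<zeta> the volume density is
  1 / sqrt (2 S), so the fibre part of density times gradient of \<open>sqrt S\<close> is, up to a
  constant, the flat gradient of \<open>S\<close>. Since S = sqrt (|\<zeta>|^2 + t^4) is convex in
  the flat fibre, subharmonicity follows. The gradient of \<open>sqrt S\<close> is bounded, that of
  \<open>S\<close> is not. In the base |dl|^2 = 1 / (2 S) is at most 1 / (2 t^2), which needs t
  \<noteq> 0. The angle of the fibre rotation generally does not close up along a closed curve. The
  calculation therefore stays in the unrotated chart and carries the rotation as a twist of the
  frame. For an open curve completeness cannot be avoided: a proper Lipschitz function keeps Cauchy
  sequences inside compact sets and so forces the manifold to be complete.\<close>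

lemma Ck_on_subset: "Ck_on k U f \<Longrightarrow> V \<subseteq> U \<Longrightarrow> Ck_on k V f"
proof (induction k arbitrary: f)
  case 0 then show ?case using continuous_on_subset by auto
next
  case (Suc k) then show ?case by (auto simp: subset_iff)
qed

lemma Ck_on_Suc_imp: "Ck_on (Suc k) U f \<Longrightarrow> Ck_on k U f"
proof (induction k arbitrary: f)
  case 0
  then have "f differentiable_on U"
    by (simp add: differentiable_at_imp_differentiable_on)
  then show ?case by (simp add: differentiable_imp_continuous_on)
next
  case (Suc k)
  from Suc.prems have "\<forall>b\<in>Basis. Ck_on (Suc k) U (\<lambda>x. frechet_derivative f (at x) b)"
    by simp
  with Suc.IH have "\<forall>b\<in>Basis. Ck_on k U (\<lambda>x. frechet_derivative f (at x) b)" by blast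
  then show ?case using Suc.prems by simp
qed

lemma Ck_on_imp_continuous_on: "Ck_on k U f \<Longrightarrow> continuous_on U f"
  by (induction k) (use Ck_on_Suc_imp in auto)

lemma frechet_derivative_cong_open:
  assumes "open U" "x \<in> U" "\<And>y. y \<in> U \<Longrightarrow> f y = g y"
  shows "frechet_derivative f (at x) = frechet_derivative g (at x)"
proof -
  have "(f has_derivative D) (at x) \<longleftrightarrow> (g has_derivative D) (at x)" for D
    using assms has_derivative_transform_within_open by metis
  then show ?thesis by (simp add: frechet_derivative_def)
qed

lemma differentiable_cong_open:
  assumes "open U" "x \<in> U" "\<And>y. y \<in> U \<Longrightarrow> f y = g y" "f differentiable (at x)"
  shows "g differentiable (at x)"
  using assms has_derivative_transform_within_open unfolding differentiable_def by metis

lemma Ck_on_cong: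
  assumes "open U" "\<And>x. x \<in> U \<Longrightarrow> f x = g x" "Ck_on k U f"
  shows "Ck_on k U g"
  using assms(2,3)
proof (induction k arbitrary: f g)
  case 0 then show ?case using continuous_on_cong by (metis Ck_on.simps(1))
next
  case (Suc k)
  have "g differentiable (at x)" if "x \<in> U" for x
    using differentiable_cong_open[OF assms(1) that Suc.prems(1)] Suc.prems(2) that by simp
  moreover have "Ck_on k U (\<lambda>x. frechet_derivative g (at x) b)" if "b \<in> Basis" for b
  proof (rule Suc.IH)
    show "Ck_on k U (\<lambda>x. frechet_derivative f (at x) b)" using Suc.prems(2) that by simp
    show "frechet_derivative f (at x) b = frechet_derivative g (at x) b" if "x \<in> U" for x
      using frechet_derivative_cong_open[OF assms(1) that Suc.prems(1)] by simp
  qed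
  ultimately show ?case by simp
qed

text \<open>\<open>frechet_derivative\<close> is a choice operator. On an open set the derivative is
  unique, so any explicitly known one may take its place.\<close>

lemma Ck_on_SucI:
  assumes "open U" "\<And>x. x \<in> U \<Longrightarrow> (f has_derivative D x) (at x)"
    "\<And>b. b \<in> Basis \<Longrightarrow> Ck_on k U (\<lambda>x. D x b)"
  shows "Ck_on (Suc k) U f"
proof -
  have "frechet_derivative f (at x) = D x" if "x \<in> U" for x
    using frechet_derivative_at[OF assms(2)[OF that]] by (rule sym)
  note D = this
  have "Ck_on k U (\<lambda>x. frechet_derivative f (at x) b)" if "b \<in> Basis" for b
    by (rule Ck_on_cong[OF assms(1) _ assms(3)[OF that]]) (simp add: D)
  then show ?thesis using assms(2) by (auto simp: differentiable_def)
qed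

lemma Ck_on_has_derivative:
  "Ck_on (Suc k) U f \<Longrightarrow> x \<in> U \<Longrightarrow> (f has_derivative frechet_derivative f (at x)) (at x)"
  by (simp add: frechet_derivative_works[symmetric])

text \<open>\<open>Ck_on\<close> speaks of derivatives at single points, so it can be checked near
  each point. This serves transition maps, extensions by zero and functions known chart by
  chart.\<close>

lemma Ck_on_local:
  assumes "\<And>x. x \<in> U \<Longrightarrow> \<exists>V. open V \<and> x \<in> V \<and> Ck_on k V f"
  shows "Ck_on k U f"
  using assms
proof (induction k arbitrary: f)
  case 0
  then show ?case
    by (metis Ck_on.simps(1) continuous_at_imp_continuous_on continuous_on_eq_continuous_at)
next
  case (Suc k)
  have "Ck_on k U (\<lambda>x. frechet_derivative f (at x) b)" if "b \<in> Basis" for b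
    by (rule Suc.IH) (use Suc.prems that in fastforce)
  with Suc.prems show ?case by fastforce
qed

lemma Ck_on_const [simp]: "Ck_on k U (\<lambda>x. c)"
proof (induction k arbitrary: c)
  case (Suc k)
  have "frechet_derivative (\<lambda>x. c) (at x) = (\<lambda>_. 0)" for x :: 'a
    by (metis frechet_derivative_at has_derivative_const)
  then show ?case using Suc[of 0] by simp
qed simp

lemma Ck_on_bounded_linear:
  assumes "bounded_linear L" shows "Ck_on k U L"
proof (cases k)
  case 0 then show ?thesis using assms by (simp add: linear_continuous_on)
next
  case (Suc j)
  have "frechet_derivative L (at x) = L" for x
    using bounded_linear_imp_has_derivative[OF assms] frechet_derivative_at by metis
  then show ?thesis using Suc assms by (auto simp: bounded_linear_imp_differentiable)
qed

lemma Ck_on_linear_image: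
  assumes "bounded_linear L" "open U" "Ck_on k U f"
  shows "Ck_on k U (\<lambda>x. L (f x))"
  using assms(3)
proof (induction k arbitrary: f)
  case 0 then show ?case using assms(1)
    by (auto intro: bounded_linear.continuous_on)
next
  case (Suc k)
  show ?case
  proof (rule Ck_on_SucI[OF assms(2)])
    show "((\<lambda>x. L (f x)) has_derivative (\<lambda>h. L (frechet_derivative f (at x) h))) (at x)" if "x \<in> U" for x
      using bounded_linear.has_derivative[OF assms(1) Ck_on_has_derivative[OF Suc.prems that]] .
    show "Ck_on k U (\<lambda>x. L (frechet_derivative f (at x) b))" if "b \<in> Basis" for b
      using Suc that by simp
  qed
qed

lemma Ck_on_add:
  assumes "open U" "Ck_on k U f" "Ck_on k U g"
  shows "Ck_on k U (\<lambda>x. f x + g x)"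
  using assms(2,3)
proof (induction k arbitrary: f g)
  case 0 then show ?case by (auto intro: continuous_intros)
next
  case (Suc k)
  show ?case
  proof (rule Ck_on_SucI[OF assms(1)])
    show "((\<lambda>x. f x + g x) has_derivative
        (\<lambda>h. frechet_derivative f (at x) h + frechet_derivative g (at x) h)) (at x)" if "x \<in> U" for x
      using Suc.prems that by (intro has_derivative_add Ck_on_has_derivative)
    show "Ck_on k U (\<lambda>x. frechet_derivative f (at x) b + frechet_derivative g (at x) b)"
      if "b \<in> Basis" for b
      using Suc that by simp
  qed
qed

text \<open>Both terms of the product rule have the form \<open>p (f x) (g x)\<close> again, with
  one factor differentiated, so the induction closes once \<open>f\<close> and \<open>g\<close> are
  generalized.\<close>

lemma Ck_on_bilinear:
  fixes f :: "'a::euclidean_space \<Rightarrow> 'b::real_normed_vector" and g :: "'a \<Rightarrow> 'c::real_normed_vector"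
  assumes "bounded_bilinear p" "open U" "Ck_on k U f" "Ck_on k U g"
  shows "Ck_on k U (\<lambda>x. p (f x) (g x))"
  using assms(3,4)
proof (induction k arbitrary: f g)
  case 0 then show ?case using assms(1)
    by (auto intro: bounded_bilinear.continuous_on)
next
  case (Suc k)
  show ?case
  proof (rule Ck_on_SucI[OF assms(2)])
    show "((\<lambda>x. p (f x) (g x)) has_derivative
        (\<lambda>h. p (f x) (frechet_derivative g (at x) h) + p (frechet_derivative f (at x) h) (g x))) (at x)"
      if "x \<in> U" for x
      using Suc.prems that by (intro bounded_bilinear.FDERIV[OF assms(1)] Ck_on_has_derivative)
  next
    fix b :: 'a assume b: "b \<in> Basis"
    have d: "Ck_on k U (\<lambda>x. frechet_derivative g (at x) b)" "Ck_on k U (\<lambda>x. frechet_derivative f (at x) b)"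
      using Suc.prems b by auto
    show "Ck_on k U (\<lambda>x. p (f x) (frechet_derivative g (at x) b) + p (frechet_derivative f (at x) b) (g x))"
      by (intro Ck_on_add[OF assms(2)] Suc.IH d Suc.prems[THEN Ck_on_Suc_imp])
  qed
qed

lemmas Ck_on_mult = Ck_on_bilinear[OF bounded_bilinear_mult]
lemmas Ck_on_scaleR = Ck_on_bilinear[OF bounded_bilinear_scaleR]

lemma Ck_on_minus: "open U \<Longrightarrow> Ck_on k U f \<Longrightarrow> Ck_on k U (\<lambda>x. - f x)"
  by (rule Ck_on_linear_image[OF bounded_linear_minus[OF bounded_linear_ident]])

lemma Ck_on_diff: "open U \<Longrightarrow> Ck_on k U f \<Longrightarrow> Ck_on k U g \<Longrightarrow> Ck_on k U (\<lambda>x. f x - g x)"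
  using Ck_on_add[of U k f "\<lambda>x. - g x"] Ck_on_minus[of U k g] by simp

lemma Ck_on_power:
  fixes f :: "'a::euclidean_space \<Rightarrow> 'b::real_normed_algebra_1"
  shows "open U \<Longrightarrow> Ck_on k U f \<Longrightarrow> Ck_on k U (\<lambda>x. f x ^ n)"
  by (induction n) (auto intro: Ck_on_mult)

text \<open>The inner function is real, so the derivative of the outer one is multiplication by its
  value at 1. The chain rule becomes a \<open>scaleR\<close> product, to which
  \<open>Ck_on_scaleR\<close> and the induction hypothesis apply.\<close>

lemma Ck_on_compose_real:
  fixes g :: "real \<Rightarrow> 'b::real_normed_vector"
  assumes "open U" "open V" "f ` U \<subseteq> V" "Ck_on k V g" "Ck_on k U f"
  shows "Ck_on k U (\<lambda>x. g (f x))"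
  using assms(4,5)
proof (induction k arbitrary: g)
  case 0 then show ?case using assms(3) by (auto intro: continuous_on_compose2)
next
  case (Suc k)
  show ?case
  proof (rule Ck_on_SucI[OF assms(1)])
    fix x assume x: "x \<in> U"
    have "(g has_derivative frechet_derivative g (at (f x))) (at (f x))"
      using Suc.prems(1) x assms(3) by (intro Ck_on_has_derivative[of k V]) auto
    moreover have "frechet_derivative g (at (f x)) = (\<lambda>h. h *\<^sub>R frechet_derivative g (at (f x)) 1)"
    proof
      show "frechet_derivative g (at (f x)) h = h *\<^sub>R frechet_derivative g (at (f x)) 1" for h
        using linear_scale[OF has_derivative_linear[OF calculation], of h 1] by simp
    qed
    ultimately have "(g has_derivative (\<lambda>h. h *\<^sub>R frechet_derivative g (at (f x)) 1)) (at (f x))"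
      by simp
    from has_derivative_compose[OF Ck_on_has_derivative[OF Suc.prems(2) x] this]
    show "((\<lambda>x. g (f x)) has_derivative
       (\<lambda>h. frechet_derivative f (at x) h *\<^sub>R frechet_derivative g (at (f x)) 1)) (at x)" .
  next
    show "Ck_on k U (\<lambda>x. frechet_derivative f (at x) b *\<^sub>R frechet_derivative g (at (f x)) 1)"
      if "b \<in> Basis" for b
    proof (rule Ck_on_scaleR[OF assms(1)])
      show "Ck_on k U (\<lambda>x. frechet_derivative f (at x) b)" using Suc.prems(2) that by simp
      show "Ck_on k U (\<lambda>x. frechet_derivative g (at (f x)) 1)"
      proof (rule Suc.IH)
        show "Ck_on k V (\<lambda>y. frechet_derivative g (at y) 1)" using Suc.prems(1) by simp
        show "Ck_on k U f" using Suc.prems(2) by (rule Ck_on_Suc_imp)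
      qed
    qed
  qed
qed

lemma Ck_on_SucI_real:
  fixes f :: "real \<Rightarrow> 'b::real_normed_vector"
  assumes "open U" "\<And>x. x \<in> U \<Longrightarrow> (f has_vector_derivative D x) (at x)" "Ck_on k U D"
  shows "Ck_on (Suc k) U f"
  by (rule Ck_on_SucI[OF assms(1), of f "\<lambda>x h. h *\<^sub>R D x"])
     (use assms in \<open>auto simp: has_vector_derivative_def\<close>)

lemma Ck_on_real_vector_derivative:
  fixes f :: "real \<Rightarrow> 'b::real_normed_vector"
  assumes "open U" "Ck_on (Suc k) U f"
  shows "Ck_on k U (\<lambda>x. vector_derivative f (at x))"
proof (rule Ck_on_cong[OF assms(1)])
  show "Ck_on k U (\<lambda>x. frechet_derivative f (at x) 1)" using assms by simp
  show "frechet_derivative f (at x) 1 = vector_derivative f (at x)" if "x \<in> U" for x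
  proof -
    have "f differentiable (at x)" using assms that by simp
    then have "(f has_derivative (\<lambda>h. h *\<^sub>R vector_derivative f (at x))) (at x)"
      using vector_derivative_works has_vector_derivative_def by metis
    then have "frechet_derivative f (at x) = (\<lambda>h. h *\<^sub>R vector_derivative f (at x))"
      by (simp add: frechet_derivative_at[symmetric])
    then show ?thesis by simp
  qed
qed

lemma Ck_on_inverse_real: "Ck_on k (- {0::real}) inverse"
proof (induction k)
  case 0 show ?case by (auto intro!: continuous_intros)
next
  case (Suc k)
  show ?case
  proof (rule Ck_on_SucI_real)
    show "(inverse has_vector_derivative - (inverse x * inverse x)) (at x)" if "x \<in> - {0}" for x :: real
      using DERIV_inverse[of x UNIV] that
      by (simp add: has_real_derivative_iff_has_vector_derivative[symmetric] power2_eq_square)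
    show "Ck_on k (- {0}) (\<lambda>x::real. - (inverse x * inverse x))"
      using Suc by (intro Ck_on_minus Ck_on_mult) auto
  qed auto
qed

lemma Ck_on_inverse:
  fixes f :: "'a::euclidean_space \<Rightarrow> real"
  assumes "open U" "Ck_on k U f" "\<And>x. x \<in> U \<Longrightarrow> f x \<noteq> 0"
  shows "Ck_on k U (\<lambda>x. inverse (f x))"
  using assms by (intro Ck_on_compose_real[OF _ _ _ Ck_on_inverse_real]) auto

lemma Ck_on_divide:
  fixes f g :: "'a::euclidean_space \<Rightarrow> real"
  assumes "open U" "Ck_on k U f" "Ck_on k U g" "\<And>x. x \<in> U \<Longrightarrow> g x \<noteq> 0"
  shows "Ck_on k U (\<lambda>x. f x / g x)"
  using Ck_on_mult[OF assms(1,2) Ck_on_inverse[OF assms(1,3,4)]] by (simp add: divide_inverse)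

lemma Ck_on_sqrt_real: "Ck_on k {0<..} sqrt"
proof (induction k)
  case 0 show ?case by (auto intro!: continuous_intros)
next
  case (Suc k)
  show ?case
  proof (rule Ck_on_SucI_real)
    show "(sqrt has_vector_derivative inverse (sqrt x) / 2) (at x)" if "x \<in> {0<..}" for x :: real
      using DERIV_real_sqrt[of x] that
      by (simp add: has_real_derivative_iff_has_vector_derivative[symmetric])
    have "Ck_on k {0<..} (\<lambda>x. inverse (sqrt x))"
      by (rule Ck_on_inverse) (use Suc in auto)
    then show "Ck_on k {0<..} (\<lambda>x. inverse (sqrt x) / 2)"
      by (intro Ck_on_divide) auto
  qed auto
qed

lemma Ck_on_sqrt:
  fixes f :: "'a::euclidean_space \<Rightarrow> real"
  assumes "open U" "Ck_on k U f" "\<And>x. x \<in> U \<Longrightarrow> f x > 0"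
  shows "Ck_on k U (\<lambda>x. sqrt (f x))"
  using assms by (intro Ck_on_compose_real[OF _ _ _ Ck_on_sqrt_real]) auto

lemma Ck_on_vec_nth [simp]: "Ck_on k U (\<lambda>x::real^'n. x $ i)"
  by (rule Ck_on_bounded_linear) (rule bounded_linear_vec_nth)

lemma open_vec_nth_vimage: "open I \<Longrightarrow> open {x::real^'n. x $ i \<in> I}"
  using continuous_open_vimage[of I "\<lambda>x::real^'n. x $ i"] by (simp add: vimage_def continuous_on_component isCont_def tendsto_vec_nth)

lemma Ck_on_of_vec_nth:
  fixes f :: "real \<Rightarrow> 'b::real_normed_vector"
  assumes "open I" "Ck_on k I f"
  shows "Ck_on k {x::real^'n. x $ i \<in> I} (\<lambda>x. f (x $ i))"
  by (rule Ck_on_compose_real[of _ I]) (use assms open_vec_nth_vimage in auto)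

lemma Ck_on_Re: "open U \<Longrightarrow> Ck_on k U f \<Longrightarrow> Ck_on k U (\<lambda>x. Re (f x))"
  by (rule Ck_on_linear_image[OF bounded_linear_Re])
lemma Ck_on_Im: "open U \<Longrightarrow> Ck_on k U f \<Longrightarrow> Ck_on k U (\<lambda>x. Im (f x))"
  by (rule Ck_on_linear_image[OF bounded_linear_Im])

lemmas Ck_intros = Ck_on_const Ck_on_add Ck_on_diff Ck_on_minus Ck_on_mult Ck_on_power Ck_on_divide
  Ck_on_sqrt Ck_on_Re Ck_on_Im Ck_on_vec_nth

section \<open>The Eguchi--Hanson metric in coordinates\<close>

lemma equiv_eh_rel: "equiv eh_dom eh_rel"
proof (rule equivI)
  show "eh_rel \<subseteq> eh_dom \<times> eh_dom" by (auto simp: eh_rel_def eh_dom_def)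
  show "refl_on eh_dom eh_rel"
    by (rule refl_onI) (auto simp: eh_rel_def eh_dom_def intro!: exI[of _ 1])
  show "sym eh_rel"
  proof (rule symI)
    fix x y assume "(x, y) \<in> eh_rel"
    then obtain \<alpha> \<beta> \<gamma> A where *: "x = (\<alpha>, \<beta>, \<gamma>)" "y = (A * \<alpha>, A * \<beta>, \<gamma> / A\<^sup>2)" "(\<alpha>, \<beta>) \<noteq> (0,0)" "A \<noteq> 0"
      by (auto simp: eh_rel_def)
    show "(y, x) \<in> eh_rel"
      unfolding eh_rel_def using * by (auto intro!: exI[of _ "1 / A"] simp: field_simps)
  qed
  show "trans eh_rel"
  proof (rule transI)
    fix x y z assume xy: "(x, y) \<in> eh_rel" and yz: "(y, z) \<in> eh_rel"
    from xy obtain \<alpha> \<beta> \<gamma> A where x: "x = (\<alpha>, \<beta>, \<gamma>)" "y = (A * \<alpha>, A * \<beta>, \<gamma> / A\<^sup>2)"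
       "(\<alpha>, \<beta>) \<noteq> (0,0)" "A \<noteq> 0"
      by (auto simp: eh_rel_def)
    from yz x(2) obtain B where z: "z = (B * (A * \<alpha>), B * (A * \<beta>), \<gamma> / A\<^sup>2 / B\<^sup>2)" "B \<noteq> 0"
      by (auto simp: eh_rel_def)
    note * = x z
    show "(x, z) \<in> eh_rel"
      unfolding eh_rel_def using * by (auto intro!: exI[of _ "B * A"] simp: field_simps)
  qed
qed

lemma eh_class_eqI:
  "A \<noteq> 0 \<Longrightarrow> (\<alpha>, \<beta>) \<noteq> (0, 0) \<Longrightarrow> eh_class (A * \<alpha>, A * \<beta>, \<gamma> / A\<^sup>2) = eh_class (\<alpha>, \<beta>, \<gamma>)"
  unfolding eh_class_def
  by (rule equiv_class_eq[OF equiv_eh_rel, symmetric]) (auto simp: eh_rel_def)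

lemma eh_class_eq_iff: "x \<in> eh_dom \<Longrightarrow> y \<in> eh_dom \<Longrightarrow> eh_class x = eh_class y \<longleftrightarrow> (x, y) \<in> eh_rel"
  unfolding eh_class_def using eq_equiv_class_iff[OF equiv_eh_rel] .

lemma eh_class_in_EH: "x \<in> eh_dom \<Longrightarrow> eh_class x \<in> EH"
  by (simp add: EH_def eh_class_def quotientI)

lemma EH_cases:
  assumes "p \<in> EH" obtains x where "x \<in> eh_dom" "p = eh_class x"
  using assms unfolding EH_def eh_class_def by (auto elim: quotientE)

lemma eh_class_eh_param:
  assumes "\<beta> \<noteq> 0" shows "eh_class (\<alpha>, \<beta>, \<gamma>) = eh_param (vector [\<alpha> / \<beta>, \<gamma> * \<beta>\<^sup>2])"
  using eh_class_eqI[of "1 / \<beta>" \<alpha> \<beta> \<gamma>] assms by (simp add: eh_param_def power_one_over divide_simps)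

lemma eh_param_eq_iff: "eh_param x = eh_param y \<longleftrightarrow> x = y"
proof
  assume "eh_param x = eh_param y"
  then have "((x$1, 1, x$2), (y$1, 1, y$2)) \<in> eh_rel"
    unfolding eh_param_def by (subst (asm) eh_class_eq_iff) (auto simp: eh_dom_def)
  then show "x = y" by (auto simp: eh_rel_def vec_eq_iff forall_2)
qed simp

lemma inj_eh_param: "inj eh_param"
  by (simp add: inj_def eh_param_eq_iff)

lemma eh_coords_eh_param [simp]: "eh_coords (eh_param x) = x"
  by (simp add: eh_coords_def inj_eh_param)

text \<open>\<open>eh_proj\<close> and \<open>eh_u1\<close> evaluate an arbitrary representative.
  Every candidate is the normalized one scaled by some nonzero \<open>A\<close>, so it remains to
  see \<open>A\<close> cancel.\<close>

lemma eh_param_representative: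
  obtains A where "A \<noteq> 0" "(SOME y. y \<in> eh_param x) = (A * x$1, A, x$2 / A\<^sup>2)"
proof -
  have "(x$1, 1, x$2) \<in> eh_param x"
    unfolding eh_param_def eh_class_def
    by (rule equiv_class_self[OF equiv_eh_rel]) (simp add: eh_dom_def)
  then have "(SOME y. y \<in> eh_param x) \<in> eh_param x" by (rule someI)
  moreover have "\<exists>A. A \<noteq> 0 \<and> y = (A * x$1, A, x$2 / A\<^sup>2)" if "y \<in> eh_param x" for y
    using that by (auto simp: eh_param_def eh_class_def eh_rel_def)
  ultimately show ?thesis using that by blast
qed

lemma eh_proj_eh_param [simp]: "eh_proj (eh_param x) = Some (x $ 1)"
  by (rule eh_param_representative[of x]) (simp add: eh_proj_def)

lemma eh_proj_Some_imp:
  assumes "p \<in> EH" "eh_proj p = Some w" shows "\<exists>\<gamma>. p = eh_class (w, 1, \<gamma>)"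
proof -
  obtain \<alpha> \<beta> \<gamma> where p: "(\<alpha>, \<beta>, \<gamma>) \<in> eh_dom" "p = eh_class (\<alpha>, \<beta>, \<gamma>)"
    using EH_cases[OF assms(1)] by (metis prod_cases3)
  have "\<beta> \<noteq> 0"
  proof
    assume \<beta>: "\<beta> = 0"
    have "(SOME y. y \<in> p) \<in> p"
      using equiv_class_self[OF equiv_eh_rel p(1)] p(2) unfolding eh_class_def by (metis someI)
    then have "eh_proj p = None"
      using \<beta> p(2) by (auto simp: eh_proj_def eh_class_def eh_rel_def split: prod.splits)
    then show False using assms by simp
  qed
  then have "p = eh_param (vector [\<alpha> / \<beta>, \<gamma> * \<beta>\<^sup>2])" using eh_class_eh_param p(2) by simp
  with assms(2) have "w = \<alpha> / \<beta>" by simp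
  with \<open>p = eh_param _\<close> show ?thesis by (auto simp: eh_param_def)
qed

lemma eh_zero_section_eh_param: "eh_param x \<in> eh_zero_section \<longleftrightarrow> x $ 2 = 0"
proof
  assume "eh_param x \<in> eh_zero_section"
  then obtain \<alpha> \<beta> where "eh_param x = eh_class (\<alpha>, \<beta>, 0)" by (auto simp: eh_zero_section_def)
  moreover have "(x$1, 1, x$2) \<in> eh_param x"
    unfolding eh_param_def eh_class_def
    by (rule equiv_class_self[OF equiv_eh_rel]) (simp add: eh_dom_def)
  ultimately show "x $ 2 = 0" by (auto simp: eh_class_def eh_rel_def)
next
  assume "x $ 2 = 0"
  then show "eh_param x \<in> eh_zero_section"
    by (auto simp: eh_zero_section_def eh_param_def eh_dom_def intro!: eh_class_in_EH)
qed

text \<open>The Hermitian norm of the fibre coordinate z2 over z1 is \<open>base_weight z\<close>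
  times |z2|. This product is u1, so \<open>eh_S\<close> is sqrt (u1^2 + t^4).\<close>

definition base_weight :: "complex^2 \<Rightarrow> real" where
  "base_weight z = 1 + (cmod (z $ 1))\<^sup>2"

definition eh_S :: "real \<Rightarrow> complex^2 \<Rightarrow> real" where
  "eh_S t z = sqrt ((base_weight z)\<^sup>2 * (cmod (z $ 2))\<^sup>2 + t ^ 4)"

lemma base_weight_ge_1: "base_weight z \<ge> 1"
  by (simp add: base_weight_def)

lemma eh_S_pos: "t \<noteq> 0 \<Longrightarrow> eh_S t z > 0"
  by (simp add: eh_S_def add_nonneg_pos)

text \<open>\<open>csqrt\<close> enters only through |csqrt z|^2 = |z|, so its branch cut is
  harmless, and the factor |A|^2 of the representative cancels against the denominator
  |A^2|.\<close>

lemma eh_u1_eh_param: "eh_u1 (eh_param x) = base_weight x * cmod (x $ 2)"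
proof -
  obtain A where A: "A \<noteq> 0" "(SOME y. y \<in> eh_param x) = (A * x$1, A, x$2 / A\<^sup>2)"
    by (rule eh_param_representative)
  have "(cmod (csqrt z))\<^sup>2 = cmod z" for z
    by (metis norm_power power2_csqrt)
  then show ?thesis
    using A by (simp add: eh_u1_def norm_mult power_mult_distrib norm_divide norm_power base_weight_def field_simps)
qed

section \<open>Calculus of Wirtinger derivatives on C^2\<close>

definition has_wirtinger :: "(complex^2 \<Rightarrow> complex) \<Rightarrow> complex \<Rightarrow> complex \<Rightarrow> complex \<Rightarrow> complex \<Rightarrow> complex^2 \<Rightarrow> bool" where
  "has_wirtinger f a1 a2 b1 b2 x \<longleftrightarrow>
     (f has_derivative (\<lambda>h. a1 * h$1 + a2 * h$2 + b1 * cnj (h$1) + b2 * cnj (h$2))) (at x)"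

text \<open>A real linear map from C^2 to C splits uniquely into a complex linear and an antilinear
  part. \<open>has_wirtinger\<close> records the four coefficients, so that differentiation rules
  become algebra.\<close>

lemma wirtinger_derivatives:
  assumes "has_wirtinger f a1 a2 b1 b2 x"
  shows "d_z 1 f x = a1" "d_z 2 f x = a2" "d_zbar 1 f x = b1" "d_zbar 2 f x = b2"
proof -
  have "frechet_derivative f (at x) = (\<lambda>h. a1 * h$1 + a2 * h$2 + b1 * cnj (h$1) + b2 * cnj (h$2))"
    using assms unfolding has_wirtinger_def by (rule frechet_derivative_at[symmetric])
  then show "d_z 1 f x = a1" "d_z 2 f x = a2" "d_zbar 1 f x = b1" "d_zbar 2 f x = b2"
    by (auto simp: d_z_def d_zbar_def axis_def field_simps)
qed

lemma wirtinger_cong: "has_wirtinger f a1 a2 b1 b2 x \<Longrightarrow> a1 = a1' \<Longrightarrow> a2 = a2' \<Longrightarrow> b1 = b1' \<Longrightarrow> b2 = b2' \<Longrightarrow> has_wirtinger f a1' a2' b1' b2' x"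
  by simp

lemma wirtinger_const: "has_wirtinger (\<lambda>z. c) 0 0 0 0 x"
  by (simp add: has_wirtinger_def)

lemma wirtinger_nth: "has_wirtinger (\<lambda>z. z $ 1) 1 0 0 0 x" "has_wirtinger (\<lambda>z. z $ 2) 0 1 0 0 x"
  "has_wirtinger (\<lambda>z. cnj (z $ 1)) 0 0 1 0 x" "has_wirtinger (\<lambda>z. cnj (z $ 2)) 0 0 0 1 x"
  unfolding has_wirtinger_def
  by (auto intro!: bounded_linear_imp_has_derivative bounded_linear_vec_nth
      bounded_linear_compose[OF bounded_linear_cnj])

lemma wirtinger_add: "has_wirtinger f a1 a2 b1 b2 x \<Longrightarrow> has_wirtinger g c1 c2 d1 d2 x \<Longrightarrow>
  has_wirtinger (\<lambda>z. f z + g z) (a1 + c1) (a2 + c2) (b1 + d1) (b2 + d2) x"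
  unfolding has_wirtinger_def by (erule (1) has_derivative_eq_rhs[OF has_derivative_add]) (simp add: algebra_simps)

lemma wirtinger_mult: "has_wirtinger f a1 a2 b1 b2 x \<Longrightarrow> has_wirtinger g c1 c2 d1 d2 x \<Longrightarrow>
  has_wirtinger (\<lambda>z. f z * g z) (f x * c1 + a1 * g x) (f x * c2 + a2 * g x) (f x * d1 + b1 * g x) (f x * d2 + b2 * g x) x"
  unfolding has_wirtinger_def by (erule (1) has_derivative_eq_rhs[OF has_derivative_mult]) (simp add: algebra_simps)

lemma wirtinger_inverse: "has_wirtinger f a1 a2 b1 b2 x \<Longrightarrow> f x \<noteq> 0 \<Longrightarrow>
  has_wirtinger (\<lambda>z. inverse (f z)) (- a1 / (f x)\<^sup>2) (- a2 / (f x)\<^sup>2) (- b1 / (f x)\<^sup>2) (- b2 / (f x)\<^sup>2) x"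
  unfolding has_wirtinger_def
  by (rule has_derivative_eq_rhs, erule Deriv.has_derivative_inverse[rotated])
    (auto simp: fun_eq_iff field_simps power2_eq_square)

lemma wirtinger_of_real:
  assumes "has_wirtinger (\<lambda>z. of_real (v z)) a1 a2 b1 b2 x" "(G has_real_derivative D) (at (v x))"
  shows "has_wirtinger (\<lambda>z. of_real (G (v z))) (D * a1) (D * a2) (D * b1) (D * b2) x"
proof -
  let ?L = "\<lambda>h::complex^2. a1 * h$1 + a2 * h$2 + b1 * cnj (h$1) + b2 * cnj (h$2)"
  have L: "((\<lambda>z. complex_of_real (v z)) has_derivative ?L) (at x)" using assms(1) by (simp add: has_wirtinger_def)
  have v: "(v has_derivative (\<lambda>h. Re (?L h))) (at x)"
    using bounded_linear.has_derivative[OF bounded_linear_Re L] by simp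
  \<comment> \<open>A real-valued map has a real-valued derivative; uniqueness of the derivative
    turns this into an identity for \<open>?L\<close>, although its coefficients are
    complex.\<close>
  have "?L = (\<lambda>h. of_real (Re (?L h)))"
    using has_derivative_unique[OF L bounded_linear.has_derivative[OF bounded_linear_of_real v]] .
  then have eq: "of_real (Re (?L h)) = ?L h" for h by metis
  have "((\<lambda>z. G (v z)) has_derivative (\<lambda>h. Re (?L h) * D)) (at x)"
    using has_derivative_compose[OF v assms(2)[unfolded has_field_derivative_def]]
    by (simp add: mult.commute)
  from bounded_linear.has_derivative[OF bounded_linear_of_real this]
  have "((\<lambda>z. complex_of_real (G (v z))) has_derivative (\<lambda>h. of_real (Re (?L h)) * of_real D)) (at x)"
    by simp
  then have "((\<lambda>z. complex_of_real (G (v z))) has_derivative (\<lambda>h. ?L h * of_real D)) (at x)"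
    by (simp only: eq)
  then show ?thesis unfolding has_wirtinger_def by (rule has_derivative_eq_rhs) (simp add: algebra_simps)
qed

section \<open>First and second derivatives of the potential\<close>

lemma of_real_cmod_sq: "(complex_of_real (cmod z))\<^sup>2 = z * cnj z"
  using complex_norm_square[of z] by simp

text \<open>The square of u1. Unlike u1 it is polynomial in the coordinates and their conjugates,
  hence smooth on the zero section too.\<close>

definition eh_v :: "complex^2 \<Rightarrow> real" where
  "eh_v z = (base_weight z)\<^sup>2 * (cmod (z $ 2))\<^sup>2"

lemma of_real_base_weight: "complex_of_real (base_weight z) = 1 + z$1 * cnj (z$1)"
  by (simp add: base_weight_def of_real_cmod_sq)

lemma wirtinger_base_weight: "has_wirtinger (\<lambda>z. of_real (base_weight z)) (cnj (x$1)) 0 (x$1) 0 x"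
  unfolding of_real_base_weight
  by (rule wirtinger_cong[OF wirtinger_add[OF wirtinger_const wirtinger_mult[OF wirtinger_nth(1,3)]]]) auto

lemma wirtinger_v:
  "has_wirtinger (\<lambda>z. of_real (eh_v z))
     (2 * of_real (base_weight x) * cnj (x$1) * (x$2 * cnj (x$2)))
     ((of_real (base_weight x))\<^sup>2 * cnj (x$2))
     (2 * of_real (base_weight x) * x$1 * (x$2 * cnj (x$2)))
     ((of_real (base_weight x))\<^sup>2 * x$2) x"
proof -
  have "(\<lambda>z. complex_of_real (eh_v z)) =
     (\<lambda>z. (of_real (base_weight z) * of_real (base_weight z)) * (z$2 * cnj (z$2)))"
    by (simp add: eh_v_def of_real_cmod_sq power2_eq_square[of "complex_of_real (base_weight _)"] fun_eq_iff)
  then show ?thesis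
    apply (simp only:)
    apply (rule wirtinger_cong[OF wirtinger_mult[OF wirtinger_mult[OF wirtinger_base_weight wirtinger_base_weight] wirtinger_mult[OF wirtinger_nth(2,4)]]])
    by (auto simp: algebra_simps power2_eq_square)
qed

lemma eh_S_eh_v: "eh_S t z = sqrt (eh_v z + t ^ 4)"
  by (simp add: eh_S_def eh_v_def)

lemma eh_v_nonneg: "eh_v z \<ge> 0" by (simp add: eh_v_def)

text \<open>The root and the logarithm combine into a single fraction because S (S + t^2) - s^2 =
  t^2 (S + t^2) whenever S^2 = s^2 + t^4.\<close>

lemma DERIV_potential:
  fixes t v :: real assumes "v > 0" "t \<noteq> 0"
  shows "((\<lambda>v. sqrt (v + t^4) + t\<^sup>2 * ln (sqrt v / (sqrt (v + t^4) + t\<^sup>2)))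
     has_real_derivative sqrt (v + t^4) / (2 * v)) (at v)"
proof -
  define s where "s = sqrt v"
  define S where "S = sqrt (v + t^4)"
  have s: "s > 0" "s^2 = v" using assms by (auto simp: s_def)
  have S: "S > 0" "S^2 = v + t^4" using assms by (auto simp: S_def add_pos_nonneg)
  have v: "v + t^4 > 0" using assms by (auto intro: add_pos_nonneg)
  have St: "S + t\<^sup>2 > 0" using S by (simp add: add_pos_nonneg)
  have "1 / (2 * S) + t\<^sup>2 * ((1/(2 * s) * (S + t\<^sup>2) - s * (1 / (2 * S))) / (S + t\<^sup>2)\<^sup>2 / (s / (S + t\<^sup>2))) = S / (2 * v)"
  proof -
    have *: "1/(2 * s) * W - s * (1 / (2 * S)) = (S * W - s^2) / (2 * s * S)" for W
      using s S by (simp add: field_simps power2_eq_square)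
    have **: "X / (2 * s * S) / W\<^sup>2 / (s / W) = X / (2 * s^2 * S * W)" if "W > 0" for X W
      using s S that by (simp add: field_simps power2_eq_square)
    have "(1/(2 * s) * (S + t\<^sup>2) - s * (1 / (2 * S))) / (S + t\<^sup>2)\<^sup>2 / (s / (S + t\<^sup>2))
        = (S * (S + t\<^sup>2) - s^2) / (2 * s^2 * S * (S + t\<^sup>2))"
      unfolding * **[OF St] ..
    also have "S * (S + t\<^sup>2) - s^2 = t\<^sup>2 * (S + t\<^sup>2)"
      using s S by (simp add: algebra_simps power2_eq_square power4_eq_xxxx)
    finally have e: "(1/(2 * s) * (S + t\<^sup>2) - s * (1 / (2 * S))) / (S + t\<^sup>2)\<^sup>2 / (s / (S + t\<^sup>2)) = t\<^sup>2 / (2 * v * S)"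
      using St s S by simp
    have "1 / (2 * S) + t\<^sup>2 * (t\<^sup>2 / (2 * v * S)) = (v + t^4) / (2 * v * S)"
      using assms S by (simp add: field_simps power2_eq_square power4_eq_xxxx)
    also have "\<dots> = S / (2 * v)" using S by (metis (no_types, lifting) power2_eq_square mult_divide_mult_cancel_right less_irrefl)
    finally show ?thesis using e by simp
  qed
  note identity = this
  have d1: "((\<lambda>v. sqrt (v + t^4)) has_real_derivative 1 / (2 * S)) (at v)"
    using v unfolding S_def by (auto intro!: derivative_eq_intros simp: field_simps)
  have d2: "(sqrt has_real_derivative 1 / (2 * s)) (at v)"
    using DERIV_real_sqrt[OF assms(1)] by (simp add: s_def field_simps)
  have d3: "((\<lambda>v. sqrt v / (sqrt (v + t^4) + t\<^sup>2)) has_real_derivative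
      (1/(2 * s) * (S + t\<^sup>2) - s * (1 / (2 * S))) / (S + t\<^sup>2)\<^sup>2) (at v)"
    using DERIV_divide[OF d2 DERIV_add[OF d1 DERIV_const[of "t\<^sup>2"]]] St
    by (simp add: s_def S_def power2_eq_square)
  have "s / (S + t\<^sup>2) > 0" using s St by simp
  from DERIV_chain'[OF d3 DERIV_ln_divide] this
  have d4: "((\<lambda>v. ln (sqrt v / (sqrt (v + t^4) + t\<^sup>2))) has_real_derivative
      1 / (s / (S + t\<^sup>2)) * ((1/(2 * s) * (S + t\<^sup>2) - s * (1 / (2 * S))) / (S + t\<^sup>2)\<^sup>2)) (at v)"
    by (simp only: s_def[symmetric] S_def[symmetric])
  have r: "1 / (s / (S + t\<^sup>2)) * x = x / (s / (S + t\<^sup>2))" for x :: real by simp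
  from DERIV_add[OF d1 DERIV_cmult[OF d4, of "t\<^sup>2"]] show ?thesis
    unfolding r identity unfolding S_def .
qed

text \<open>The differential of the potential is \<open>eh_S / 2\<close> times that of the logarithm
  of \<open>eh_v\<close>, which is 2 ln \<open>base_weight\<close> + ln |z2|^2. The last summand
  causes the simple poles in z2 and its conjugate.\<close>

lemma wirtinger_potential:
  assumes "t \<noteq> 0" "x $ 2 \<noteq> 0"
  shows "has_wirtinger (\<lambda>z. of_real (eh_potential t (eh_param z)))
     (of_real (eh_S t x / base_weight x) * cnj (x$1)) (of_real (eh_S t x) * inverse (x$2) / 2)
     (of_real (eh_S t x / base_weight x) * x$1) (of_real (eh_S t x) * inverse (cnj (x$2)) / 2) x"
proof -
  have q: "base_weight x > 0" using base_weight_ge_1[of x] by linarith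
  have v: "eh_v x > 0" using assms q by (simp add: eh_v_def)
  have eq: "eh_potential t (eh_param z) = (\<lambda>v. sqrt (v + t^4) + t\<^sup>2 * ln (sqrt v / (sqrt (v + t^4) + t\<^sup>2))) (eh_v z)" for z
    using base_weight_ge_1[of z]
    by (simp add: eh_potential_def Let_def eh_u1_eh_param eh_v_def power_mult_distrib real_sqrt_mult)
  have x2: "complex_of_real (eh_v x) = (of_real (base_weight x))\<^sup>2 * (x$2 * cnj (x$2))"
    by (simp add: eh_v_def of_real_cmod_sq)
  show ?thesis
    unfolding eq
    apply (rule wirtinger_cong[OF wirtinger_of_real[OF wirtinger_v DERIV_potential[OF v assms(1)]]])
    using assms q unfolding eh_S_eh_v[symmetric] of_real_divide of_real_mult x2
    by (auto simp: field_simps power2_eq_square)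
qed

lemma wirtinger_S:
  assumes "t \<noteq> 0"
  shows "has_wirtinger (\<lambda>z. of_real (eh_S t z))
     (of_real (base_weight x / eh_S t x) * cnj (x$1) * (x$2 * cnj (x$2)))
     ((of_real (base_weight x))\<^sup>2 * cnj (x$2) / (2 * of_real (eh_S t x)))
     (of_real (base_weight x / eh_S t x) * x$1 * (x$2 * cnj (x$2)))
     ((of_real (base_weight x))\<^sup>2 * x$2 / (2 * of_real (eh_S t x))) x"
proof -
  have "eh_v x + t^4 > 0" using eh_v_nonneg[of x] assms by (simp add: add_nonneg_pos)
  then have "((\<lambda>v. sqrt (v + t^4)) has_real_derivative 1 / (2 * sqrt (eh_v x + t^4))) (at (eh_v x))"
    by (auto intro!: derivative_eq_intros simp: field_simps)
  from wirtinger_of_real[OF wirtinger_v this] show ?thesis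
    unfolding eh_S_eh_v[symmetric]
    by (rule wirtinger_cong) (use eh_S_pos[OF assms, of x] in \<open>auto simp: field_simps\<close>)
qed

text \<open>This is \<open>base_weight z / 2\<close> times the connection form of the Hermitian line
  bundle. Completing the square in the complex Hessian with it leaves only a multiple of
  |dz1|^2.\<close>

definition eh_theta :: "complex^2 \<Rightarrow> complex^2 \<Rightarrow> complex" where
  "eh_theta z X = of_real (base_weight z / 2) * X $ 2 + z $ 2 * cnj (z $ 1) * X $ 1"

definition eh_herm :: "real \<Rightarrow> complex^2 \<Rightarrow> complex^2 \<Rightarrow> complex^2 \<Rightarrow> complex" where
  "eh_herm t z X Y = of_real (eh_S t z / (base_weight z)\<^sup>2) * (X $ 1 * cnj (Y $ 1))
     + eh_theta z X * cnj (eh_theta z Y) / of_real (eh_S t z)"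

text \<open>The pole 1 / cnj z2 of the first derivative is antiholomorphic, so \<open>d_z\<close>
  acts on \<open>eh_S\<close> alone and brings out a factor that cancels it. Thus the Hessian is
  given by an expression without singularity on the zero section.\<close>

lemma i_ddbar_potential:
  assumes "t \<noteq> 0" "x $ 2 \<noteq> 0"
  shows "i_ddbar (\<lambda>z. complex_of_real (eh_potential t (eh_param z))) x X Y =
    \<i> * (eh_herm t x X Y - eh_herm t x Y X)"
proof -
  let ?f = "\<lambda>z. complex_of_real (eh_potential t (eh_param z))"
  let ?q = "complex_of_real (base_weight x)" and ?S = "complex_of_real (eh_S t x)"
  have op: "open {y::complex^2. y $ 2 \<noteq> 0}"
    by (intro open_Collect_neq continuous_intros)
  have q: "base_weight x > 0" using base_weight_ge_1[of x] by linarith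
  have S: "eh_S t x > 0" using eh_S_pos[OF assms(1)] .
  have qx: "?q = 1 + x$1 * cnj (x$1)" by (rule of_real_base_weight)
  have fd1: "frechet_derivative (d_zbar 1 ?f) (at x) =
      frechet_derivative (\<lambda>z. (of_real (eh_S t z) * inverse (of_real (base_weight z))) * z$1) (at x)"
    by (rule frechet_derivative_cong_open[OF op])
       (use assms wirtinger_derivatives(3)[OF wirtinger_potential[OF assms(1)]] in \<open>auto simp: field_simps\<close>)
  have fd2: "frechet_derivative (d_zbar 2 ?f) (at x) =
      frechet_derivative (\<lambda>z. (of_real (eh_S t z) * inverse (cnj (z$2))) * (1/2)) (at x)"
    by (rule frechet_derivative_cong_open[OF op])
       (use assms wirtinger_derivatives(4)[OF wirtinger_potential[OF assms(1)]] in \<open>auto simp: field_simps\<close>)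
  note w1 = wirtinger_derivatives[OF wirtinger_mult[OF wirtinger_mult[OF wirtinger_S[OF assms(1), of x] wirtinger_inverse[OF wirtinger_base_weight]] wirtinger_nth(1)]]
  note w2 = wirtinger_derivatives[OF wirtinger_mult[OF wirtinger_mult[OF wirtinger_S[OF assms(1), of x] wirtinger_inverse[OF wirtinger_nth(4)]] wirtinger_const]]
  have h11: "d_z 1 (d_zbar 1 ?f) x = ?S / ?q\<^sup>2 + (x$1 * cnj (x$1)) * (x$2 * cnj (x$2)) / ?S"
  proof -
    have "d_z 1 (d_zbar 1 ?f) x = d_z 1 (\<lambda>z. (of_real (eh_S t z) * inverse (of_real (base_weight z))) * z$1) x"
      unfolding d_z_def fd1 ..
    also have "\<dots> = ?S * inverse ?q + (?S * (- cnj (x$1) / ?q\<^sup>2) + ?q / ?S * cnj (x$1) * (x$2 * cnj (x$2)) * inverse ?q) * x$1"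
      by (subst w1(1)) (use q in auto)
    \<comment> \<open>The difference \<open>?q - x$1 * cnj (x$1)\<close> is 1; this is what leaves
      \<open>?S / ?q\<^sup>2\<close>.\<close>
    also have "\<dots> = ?S * (?q - x$1 * cnj (x$1)) / ?q\<^sup>2 + (x$1 * cnj (x$1)) * (x$2 * cnj (x$2)) / ?S"
      using q S by (simp add: field_simps power2_eq_square)
    finally show ?thesis using qx by simp
  qed
  have h21: "d_z 2 (d_zbar 1 ?f) x = ?q * cnj (x$2) * x$1 / (2 * ?S)"
  proof -
    have "d_z 2 (d_zbar 1 ?f) x = d_z 2 (\<lambda>z. (of_real (eh_S t z) * inverse (of_real (base_weight z))) * z$1) x"
      unfolding d_z_def fd1 ..
    also have "\<dots> = ?q\<^sup>2 * cnj (x$2) / (2 * ?S) * inverse ?q * x$1"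
      by (subst w1(2)) (use q in auto)
    finally show ?thesis using q S by (simp add: field_simps power2_eq_square)
  qed
  have h12: "d_z 1 (d_zbar 2 ?f) x = ?q * cnj (x$1) * x$2 / (2 * ?S)"
  proof -
    have "d_z 1 (d_zbar 2 ?f) x = d_z 1 (\<lambda>z. (of_real (eh_S t z) * inverse (cnj (z$2))) * (1/2)) x"
      unfolding d_z_def fd2 ..
    also have "\<dots> = ?q / ?S * cnj (x$1) * (x$2 * cnj (x$2)) * inverse (cnj (x$2)) * (1/2)"
      by (subst w2(1)) (use assms in auto)
    finally show ?thesis using assms S by (simp add: field_simps)
  qed
  have h22: "d_z 2 (d_zbar 2 ?f) x = ?q\<^sup>2 / (4 * ?S)"
  proof -
    have "d_z 2 (d_zbar 2 ?f) x = d_z 2 (\<lambda>z. (of_real (eh_S t z) * inverse (cnj (z$2))) * (1/2)) x"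
      unfolding d_z_def fd2 ..
    also have "\<dots> = ?q\<^sup>2 * cnj (x$2) / (2 * ?S) * inverse (cnj (x$2)) * (1/2)"
      by (subst w2(2)) (use assms in auto)
    finally show ?thesis using assms S by (simp add: field_simps)
  qed
  show ?thesis
    unfolding i_ddbar_def eh_herm_def eh_theta_def sum_2 h11 h12 h21 h22
    using q S by (simp add: field_simps power2_eq_square)
qed

section \<open>Extension of the form across the zero section, and the metric\<close>

lemma continuous_eh_S: "continuous_on UNIV (eh_S t)"
  unfolding eh_S_def base_weight_def by (intro continuous_intros)

text \<open>The explicit form is continuous everywhere and agrees with the Hessian off the zero
  section. For \<open>Lim\<close> to be determined, every point must also be a limit point of that
  complement.\<close>

lemma eh_form_eq:
  assumes "t \<noteq> 0"
  shows "eh_form t x X Y = \<i> * (eh_herm t x X Y - eh_herm t x Y X)"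
proof -
  let ?N = "{y::complex^2. y $ 2 \<noteq> 0}"
  have N: "{y. eh_param y \<notin> eh_zero_section} = ?N" by (simp add: eh_zero_section_eh_param)
  have lp: "x islimpt ?N"
    unfolding islimpt_approachable
  proof (intro allI impI)
    fix e :: real assume e: "e > 0"
    \<comment> \<open>At most one of the shifts e/2 and e/3 can bring the second coordinate to
      zero.\<close>
    define r where "r = (if x$2 + complex_of_real (e/2) = 0 then e/3 else e/2)"
    have "complex_of_real (e/3) \<noteq> complex_of_real (e/2)" using e by (simp only: of_real_eq_iff)
    then have "x$2 + complex_of_real (e/2) = 0 \<Longrightarrow> x$2 + complex_of_real (e/3) \<noteq> 0"
      by (metis add_left_imp_eq)
    then have "x$2 + complex_of_real r \<noteq> 0"
      unfolding r_def by (split if_split) blast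
    then have r: "0 < r" "r < e" "x$2 + complex_of_real r \<noteq> 0" using e by (auto simp: r_def)
    let ?y = "x + axis 2 (complex_of_real r)"
    have "dist ?y x = r" using r by (simp add: dist_norm norm_vec_def L2_set_def sum_2 axis_def)
    moreover have "?y $ 2 \<noteq> 0" using r by (simp add: axis_def)
    ultimately show "\<exists>y\<in>?N. y \<noteq> x \<and> dist y x < e" using r by (intro bexI[of _ ?y]) auto
  qed
  have nz: "complex_of_real (eh_S t y) \<noteq> 0" "complex_of_real (base_weight y) \<noteq> 0" for y
    using eh_S_pos[OF assms, of y] base_weight_ge_1[of y] by auto
  have cq: "continuous_on UNIV base_weight" unfolding base_weight_def by (intro continuous_intros)
  have "continuous_on UNIV (\<lambda>y. eh_herm t y X Y)" for X Y
    unfolding eh_herm_def eh_theta_def using nz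
    by (intro continuous_intros continuous_eh_S cq) auto
  then have "continuous_on UNIV (\<lambda>y. \<i> * (eh_herm t y X Y - eh_herm t y Y X))"
    by (intro continuous_intros)
  then have "((\<lambda>y. \<i> * (eh_herm t y X Y - eh_herm t y Y X)) \<longlongrightarrow> \<i> * (eh_herm t x X Y - eh_herm t x Y X)) (at x within ?N)"
    unfolding continuous_on_def by (rule_tac tendsto_mono[OF at_le[OF subset_UNIV]]) auto
  then have "((\<lambda>y. i_ddbar (\<lambda>z. complex_of_real (eh_potential t (eh_param z))) y X Y) \<longlongrightarrow> \<i> * (eh_herm t x X Y - eh_herm t x Y X)) (at x within ?N)"
    by (rule Lim_transform_eventually) (auto simp: eventually_at_filter i_ddbar_potential[OF assms])
  then show ?thesis unfolding eh_form_def N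
    using lp by (intro tendsto_Lim) (auto simp: trivial_limit_within)
qed

text \<open>Multiplying \<open>Y\<close> by \<i> turns \<i> times the difference of the two
  Hermitian values into their sum, which is twice a real part.\<close>

lemma eh_metric_eq:
  assumes "t \<noteq> 0"
  shows "eh_metric t x X Y = 2 * (eh_S t x / (base_weight x)\<^sup>2 * Re (X$1 * cnj (Y$1))
     + Re (eh_theta x X * cnj (eh_theta x Y)) / eh_S t x)"
proof -
  have th: "eh_theta x (\<i> *s Y) = \<i> * eh_theta x Y" by (simp add: eh_theta_def algebra_simps)
  have "\<i> * (eh_herm t x X (\<i> *s Y) - eh_herm t x (\<i> *s Y) X) = eh_herm t x X Y + eh_herm t x Y X"
    unfolding eh_herm_def th by (simp add: field_simps)
  then show ?thesis
    unfolding eh_metric_def eh_form_eq[OF assms]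
    by (simp add: eh_herm_def Re_divide_of_real algebra_simps add_divide_distrib)
qed

section \<open>Metrics with a horizontal and a conformal fibre direction\<close>

definition partial :: "3 \<Rightarrow> (real^3 \<Rightarrow> real) \<Rightarrow> real^3 \<Rightarrow> real" where
  "partial i f x = frechet_derivative f (at x) (axis i 1)"

definition divergence :: "(real^3 \<Rightarrow> real^3) \<Rightarrow> real^3 \<Rightarrow> real" where
  "divergence X x = (\<Sum>i\<in>UNIV. partial i (\<lambda>y. X y $ i) x)"

lemma partial_cong_open:
  "open U \<Longrightarrow> x \<in> U \<Longrightarrow> (\<And>y. y \<in> U \<Longrightarrow> f y = g y) \<Longrightarrow> partial i f x = partial i g x"
  unfolding partial_def by (subst frechet_derivative_cong_open[of U x f g]) auto

lemma partial_eqI: "(f has_derivative D) (at x) \<Longrightarrow> partial i f x = D (axis i 1)"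
  unfolding partial_def by (metis frechet_derivative_at)

lemma Ck_on_partial: "Ck_on (Suc k) U f \<Longrightarrow> Ck_on k U (partial i f)"
  unfolding partial_def[abs_def] by (simp add: axis_in_Basis_iff)

lemma frechet_derivative_partial:
  fixes f :: "real^3 \<Rightarrow> real"
  assumes "f differentiable (at x)"
  shows "frechet_derivative f (at x) v = partial 1 f x * v$1 + partial 2 f x * v$2 + partial 3 f x * v$3"
proof -
  have lin: "linear (frechet_derivative f (at x))"
    using assms by (rule linear_frechet_derivative)
  have "v = (\<Sum>i\<in>UNIV. v $ i *\<^sub>R axis i 1)" using basis_expansion[of v] by (simp add: scalar_mult_eq_scaleR)
  then have "frechet_derivative f (at x) v = frechet_derivative f (at x) (\<Sum>i\<in>UNIV. v $ i *\<^sub>R axis i 1)"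
    by (rule arg_cong)
  also have "\<dots> = (\<Sum>i\<in>UNIV. v $ i * partial i f x)"
    by (simp add: linear_sum[OF lin] linear_scale[OF lin] partial_def)
  finally show ?thesis by (simp add: sum_3 algebra_simps)
qed

lemma partial_mult:
  assumes "f differentiable (at x)" "g differentiable (at x)"
  shows "partial i (\<lambda>y. f y * g y) x = f x * partial i g x + partial i f x * g x"
  using partial_eqI[OF has_derivative_mult[OF assms(1)[unfolded frechet_derivative_works] assms(2)[unfolded frechet_derivative_works]]]
  by (simp add: partial_def)

lemma partial_add:
  assumes "f differentiable (at x)" "g differentiable (at x)"
  shows "partial i (\<lambda>y. f y + g y) x = partial i f x + partial i g x"
  using partial_eqI[OF has_derivative_add[OF assms(1)[unfolded frechet_derivative_works] assms(2)[unfolded frechet_derivative_works]]]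
  by (simp add: partial_def)

lemma partial_diff:
  assumes "f differentiable (at x)" "g differentiable (at x)"
  shows "partial i (\<lambda>y. f y - g y) x = partial i f x - partial i g x"
  using partial_eqI[OF has_derivative_diff[OF assms(1)[unfolded frechet_derivative_works] assms(2)[unfolded frechet_derivative_works]]]
  by (simp add: partial_def)

lemma partial_chain:
  assumes "f differentiable (at x)" "(\<eta> has_real_derivative d) (at (f x))"
  shows "partial i (\<lambda>y. \<eta> (f y)) x = d * partial i f x"
  using partial_eqI[OF has_derivative_compose[OF assms(1)[unfolded frechet_derivative_works] assms(2)[unfolded has_field_derivative_def]]]
  by (simp add: partial_def)

text \<open>An orthonormal coframe is dx1 / sqrt Q, sqrt Q (dx2 + m1 dx1), sqrt Q (dx3 + m2 dx1):
  base and fibre are scaled inversely by one function, and \<open>m1\<close>, \<open>m2\<close>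
  determine the horizontal direction.\<close>

definition frame_metric ::
  "(real^3 \<Rightarrow> real) \<Rightarrow> (real^3 \<Rightarrow> real) \<Rightarrow> (real^3 \<Rightarrow> real) \<Rightarrow> real^3 \<Rightarrow> real^3 \<Rightarrow> real^3 \<Rightarrow> real" where
  "frame_metric Q m1 m2 x v w = v$1 * w$1 / Q x
     + Q x * ((v$2 + m1 x * v$1) * (w$2 + m1 x * w$1) + (v$3 + m2 x * v$1) * (w$3 + m2 x * w$1))"

lemma frame_metric_pos:
  assumes "Q x > 0" "v \<noteq> 0" shows "frame_metric Q m1 m2 x v v > 0"
proof (cases "v$1 = 0")
  case True
  then have "v$2 \<noteq> 0 \<or> v$3 \<noteq> 0" using assms(2) by (auto simp: vec_eq_iff forall_3)
  then have "v$2 * v$2 + v$3 * v$3 > 0"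
    using sum_squares_gt_zero_iff by blast
  then show ?thesis using True assms by (simp add: frame_metric_def)
next
  case False
  then have "v$1 * v$1 / Q x > 0" using assms(1) not_real_square_gt_zero by (intro divide_pos_pos) blast+
  then show ?thesis using assms(1) unfolding frame_metric_def
    by (intro add_pos_nonneg) auto
qed

lemma bilinear_frame_metric: "bilinear (frame_metric Q m1 m2 x)"
  unfolding bilinear_def frame_metric_def
  by (auto intro!: linearI simp: algebra_simps add_divide_distrib)

text \<open>The coframe differs from a diagonal one by a shear of determinant 1, so the Gram
  determinant is (1 / Q) Q Q.\<close>

lemma vol_density_frame_metric:
  assumes "Q x > 0" "g x = frame_metric Q m1 m2 x"
  shows "vol_density g x = sqrt (Q x)"
  using assms
  by (simp add: vol_density_def gram_def det_3 frame_metric_def axis_def field_simps)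

text \<open>The derivative along (1, - m1, - m2), the vector on which both fibre covectors of the
  frame vanish.\<close>

definition horizontal :: "(real^3 \<Rightarrow> real) \<Rightarrow> (real^3 \<Rightarrow> real) \<Rightarrow> (real^3 \<Rightarrow> real) \<Rightarrow> real^3 \<Rightarrow> real" where
  "horizontal m1 m2 f x = partial 1 f x - m1 x * partial 2 f x - m2 x * partial 3 f x"

text \<open>The volume density sqrt Q times the gradient. With it the metric divergence of a
  gradient is a Euclidean divergence divided by sqrt Q.\<close>

definition flux :: "(real^3 \<Rightarrow> real) \<Rightarrow> (real^3 \<Rightarrow> real) \<Rightarrow> (real^3 \<Rightarrow> real) \<Rightarrow> (real^3 \<Rightarrow> real) \<Rightarrow> real^3 \<Rightarrow> real^3" where
  "flux Q m1 m2 f x = (let F = Q x * sqrt (Q x) * horizontal m1 m2 f x in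
     vector [F, partial 2 f x / sqrt (Q x) - m1 x * F, partial 3 f x / sqrt (Q x) - m2 x * F])"

lemma flux_component:
  "flux Q m1 m2 f x $ 1 = Q x * sqrt (Q x) * horizontal m1 m2 f x"
  "flux Q m1 m2 f x $ 2 = partial 2 f x / sqrt (Q x) - m1 x * (Q x * sqrt (Q x) * horizontal m1 m2 f x)"
  "flux Q m1 m2 f x $ 3 = partial 3 f x / sqrt (Q x) - m2 x * (Q x * sqrt (Q x) * horizontal m1 m2 f x)"
  by (simp_all add: flux_def Let_def)

text \<open>Uniqueness for \<open>THE\<close>: the difference of two candidates is orthogonal to
  every vector, in particular to itself, and the metric is positive definite.\<close>

lemma grad_coord_frame_metric:
  assumes Q: "Q x > 0" and g: "g x = frame_metric Q m1 m2 x" and f: "f differentiable (at x)"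
  shows "grad_coord g f x = (1 / sqrt (Q x)) *\<^sub>R flux Q m1 m2 f x"
proof -
  have sq: "sqrt (Q x) * sqrt (Q x) = Q x" "sqrt (Q x) > 0" using Q by auto
  let ?v = "(1 / sqrt (Q x)) *\<^sub>R flux Q m1 m2 f x"
  have v: "?v $ 1 = Q x * horizontal m1 m2 f x"
     "?v $ 2 = partial 2 f x / Q x - m1 x * (Q x * horizontal m1 m2 f x)"
     "?v $ 3 = partial 3 f x / Q x - m2 x * (Q x * horizontal m1 m2 f x)"
    using sq Q by (auto simp: flux_component field_simps)
  have eq: "frame_metric Q m1 m2 x ?v w = frechet_derivative f (at x) w" for w
    unfolding frame_metric_def v frechet_derivative_partial[OF f]
    using Q by (simp add: horizontal_def field_simps)
  show ?thesis unfolding grad_coord_def g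
  proof (rule the_equality)
    show "\<forall>w. frame_metric Q m1 m2 x ?v w = frechet_derivative f (at x) w" using eq by simp
    fix u assume u: "\<forall>w. frame_metric Q m1 m2 x u w = frechet_derivative f (at x) w"
    have "frame_metric Q m1 m2 x (u - ?v) (u - ?v) = 0"
      using u eq by (simp add: bilinear_lsub[OF bilinear_frame_metric])
    then show "u = ?v" using frame_metric_pos[of Q x "u - ?v" m1 m2] Q by force
  qed
qed

definition grad_norm_sq :: "(real^3 \<Rightarrow> real) \<Rightarrow> (real^3 \<Rightarrow> real) \<Rightarrow> (real^3 \<Rightarrow> real) \<Rightarrow> (real^3 \<Rightarrow> real) \<Rightarrow> real^3 \<Rightarrow> real" where
  "grad_norm_sq Q m1 m2 f x = Q x * (horizontal m1 m2 f x)\<^sup>2 + ((partial 2 f x)\<^sup>2 + (partial 3 f x)\<^sup>2) / Q x"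

text \<open>The right-hand side is sqrt Q times the inner product of the two gradients. Its symmetry
  gives Green's identity, its diagonal gives \<open>grad_norm_sq\<close>.\<close>

lemma sum_partial_flux:
  assumes "Q x > 0"
  shows "(\<Sum>i\<in>UNIV. partial i h x * flux Q m1 m2 f x $ i) =
    sqrt (Q x) * (Q x * (horizontal m1 m2 h x * horizontal m1 m2 f x)
      + (partial 2 h x * partial 2 f x + partial 3 h x * partial 3 f x) / Q x)"
proof -
  have sq: "sqrt (Q x) * sqrt (Q x) = Q x" "sqrt (Q x) > 0" using assms by auto
  have r: "a / sqrt (Q x) = sqrt (Q x) * a / Q x" for a
    using sq assms by (metis real_div_sqrt less_imp_le mult.commute nonzero_divide_mult_cancel_right nonzero_eq_divide_eq times_divide_eq_left less_irrefl mult_divide_mult_cancel_left)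
  show ?thesis unfolding sum_3 flux_component r
    using assms by (simp add: horizontal_def field_simps)
qed

lemma Ck_on_horizontal:
  assumes "open U" "Ck_on k U m1" "Ck_on k U m2" "Ck_on (Suc k) U f"
  shows "Ck_on k U (horizontal m1 m2 f)"
  unfolding horizontal_def[abs_def] using assms
  by (intro Ck_intros Ck_on_partial) auto

lemma Ck_on_flux:
  assumes U: "open U" and Q: "Ck_on k U Q" "\<And>x. x \<in> U \<Longrightarrow> Q x > 0"
    and m: "Ck_on k U m1" "Ck_on k U m2" and f: "Ck_on (Suc k) U f"
  shows "Ck_on k U (\<lambda>x. flux Q m1 m2 f x $ i)"
proof -
  have nz: "\<And>x. x \<in> U \<Longrightarrow> sqrt (Q x) \<noteq> 0" using Q(2) by fastforce
  have s: "Ck_on k U (\<lambda>x. sqrt (Q x))" using assms by (intro Ck_on_sqrt) auto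
  note p = Ck_on_partial[OF f] Ck_on_horizontal[OF U m f]
  note q = Ck_on_divide[OF U Ck_on_partial[OF f] s nz]
  have "Ck_on k U (\<lambda>x. flux Q m1 m2 f x $ 1)" "Ck_on k U (\<lambda>x. flux Q m1 m2 f x $ 2)"
    "Ck_on k U (\<lambda>x. flux Q m1 m2 f x $ 3)"
    unfolding flux_component by (intro Ck_on_mult Ck_on_diff Ck_on_divide[OF U Ck_on_partial[OF f] s nz] U Q(1) s p m; assumption)+
  then show ?thesis using exhaust_3[of i] by auto
qed

lemma laplace_coord_frame_metric:
  assumes U: "open U" "x \<in> U" and g: "\<And>y. y \<in> U \<Longrightarrow> g y = frame_metric Q m1 m2 y"
    and Q: "\<And>y. y \<in> U \<Longrightarrow> Q y > 0" and f: "\<And>y. y \<in> U \<Longrightarrow> f differentiable (at y)"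
  shows "laplace_coord g f x = - divergence (flux Q m1 m2 f) x / sqrt (Q x)"
proof -
  have "vol_density g y * grad_coord g f y $ i = flux Q m1 m2 f y $ i" if "y \<in> U" for y i
    using Q[OF that] g[OF that] f[OF that]
    by (simp add: vol_density_frame_metric grad_coord_frame_metric)
  then have "partial i (\<lambda>y. vol_density g y * grad_coord g f y $ i) x = partial i (\<lambda>y. flux Q m1 m2 f y $ i) x" for i
    by (intro partial_cong_open[OF U]) auto
  then show ?thesis
    unfolding laplace_coord_def div_coord_def divergence_def partial_def
    using Q[OF U(2)] g[OF U(2)] by (simp add: vol_density_frame_metric)
qed

text \<open>The symmetry of the matrix that maps the differential of a function to its flux makes the
  first-order terms cancel in Green's identity.\<close>

lemma divergence_Green:
  assumes U: "open U" "x \<in> U" and Q: "Ck_on 1 U Q" "\<And>x. x \<in> U \<Longrightarrow> Q x > 0"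
    and m: "Ck_on 1 U m1" "Ck_on 1 U m2" and f: "Ck_on 2 U f" and h: "Ck_on 2 U h"
  shows "divergence (\<lambda>y. h y *\<^sub>R flux Q m1 m2 f y - f y *\<^sub>R flux Q m1 m2 h y) x =
    h x * divergence (flux Q m1 m2 f) x - f x * divergence (flux Q m1 m2 h) x"
proof -
  have d: "f differentiable (at x)" "h differentiable (at x)" using f h U by (auto simp: numeral_2_eq_2)
  have fx: "(\<lambda>y. flux Q m1 m2 f y $ i) differentiable (at x)"
    "(\<lambda>y. flux Q m1 m2 h y $ i) differentiable (at x)" for i
    using Ck_on_flux[OF U(1) Q m, of f i] Ck_on_flux[OF U(1) Q m, of h i] f h U(2)
    by (auto simp: numeral_2_eq_2)
  have "partial i (\<lambda>y. (h y *\<^sub>R flux Q m1 m2 f y - f y *\<^sub>R flux Q m1 m2 h y) $ i) x =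
     (h x * partial i (\<lambda>y. flux Q m1 m2 f y $ i) x + partial i h x * flux Q m1 m2 f x $ i)
     - (f x * partial i (\<lambda>y. flux Q m1 m2 h y $ i) x + partial i f x * flux Q m1 m2 h x $ i)" for i
    by (simp add: partial_diff partial_mult d fx differentiable_mult)
  then have "divergence (\<lambda>y. h y *\<^sub>R flux Q m1 m2 f y - f y *\<^sub>R flux Q m1 m2 h y) x =
     h x * divergence (flux Q m1 m2 f) x - f x * divergence (flux Q m1 m2 h) x
     + ((\<Sum>i\<in>UNIV. partial i h x * flux Q m1 m2 f x $ i) - (\<Sum>i\<in>UNIV. partial i f x * flux Q m1 m2 h x $ i))"
    unfolding divergence_def sum_3 by (simp only:) (simp add: algebra_simps)
  then show ?thesis unfolding sum_partial_flux[of Q, OF Q(2)[OF U(2)]] by (simp add: mult.commute)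
qed

text \<open>\<open>flux\<close> is linear in the differential, so composing with
  \<open>\<eta>\<close> multiplies it by \<open>\<eta>' (f y)\<close>. Differentiating this factor
  contributes \<open>\<eta>''\<close> times the squared gradient.\<close>

lemma divergence_flux_compose:
  assumes U: "open U" "x \<in> U" and Q: "Ck_on 1 U Q" "\<And>x. x \<in> U \<Longrightarrow> Q x > 0"
    and m: "Ck_on 1 U m1" "Ck_on 1 U m2" and f: "Ck_on 2 U f"
    and \<eta>: "\<And>r. (\<eta> has_real_derivative \<eta>' r) (at r)" "\<And>r. (\<eta>' has_real_derivative \<eta>'' r) (at r)"
  shows "divergence (flux Q m1 m2 (\<lambda>y. \<eta> (f y))) x =
    \<eta>' (f x) * divergence (flux Q m1 m2 f) x + \<eta>'' (f x) * (sqrt (Q x) * grad_norm_sq Q m1 m2 f x)"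
proof -
  have d: "f differentiable (at y)" if "y \<in> U" for y using f that by (auto simp: numeral_2_eq_2)
  have fx: "(\<lambda>y. flux Q m1 m2 f y $ i) differentiable (at x)" for i
    using Ck_on_flux[OF U(1) Q m, of f i] f U(2) by (auto simp: numeral_2_eq_2)
  have ed: "(\<lambda>y. \<eta>' (f y)) differentiable (at x)"
    using has_derivative_compose[OF d[OF U(2), unfolded frechet_derivative_works] \<eta>(2)[unfolded has_field_derivative_def]]
    by (auto simp: differentiable_def)
  have fl: "flux Q m1 m2 (\<lambda>y. \<eta> (f y)) y = \<eta>' (f y) *\<^sub>R flux Q m1 m2 f y" if "y \<in> U" for y
    using partial_chain[OF d[OF that] \<eta>(1)]
    by (simp add: vec_eq_iff forall_3 flux_component horizontal_def algebra_simps add_divide_distrib diff_divide_distrib)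
  have "partial i (\<lambda>y. flux Q m1 m2 (\<lambda>y. \<eta> (f y)) y $ i) x =
      \<eta>' (f x) * partial i (\<lambda>y. flux Q m1 m2 f y $ i) x + \<eta>'' (f x) * (partial i f x * flux Q m1 m2 f x $ i)" for i
  proof -
    have "partial i (\<lambda>y. flux Q m1 m2 (\<lambda>y. \<eta> (f y)) y $ i) x = partial i (\<lambda>y. \<eta>' (f y) * flux Q m1 m2 f y $ i) x"
      by (rule partial_cong_open[OF U]) (simp add: fl)
    then show ?thesis
      by (simp add: partial_mult[OF ed fx] partial_chain[OF d[OF U(2)] \<eta>(2)])
  qed
  then have "divergence (flux Q m1 m2 (\<lambda>y. \<eta> (f y))) x =
    \<eta>' (f x) * divergence (flux Q m1 m2 f) x + \<eta>'' (f x) * (\<Sum>i\<in>UNIV. partial i f x * flux Q m1 m2 f x $ i)"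
    unfolding divergence_def by (simp add: sum.distrib sum_distrib_left)
  then show ?thesis unfolding sum_partial_flux[of Q, OF Q(2)[OF U(2)]] grad_norm_sq_def
    by (simp add: power2_eq_square)
qed

lemma grad_norm_sq_nonneg: "Q x > 0 \<Longrightarrow> grad_norm_sq Q m1 m2 f x \<ge> 0"
  by (simp add: grad_norm_sq_def)

section \<open>Integrals of partial derivatives\<close>

text \<open>For a Borel function this is the invariance of Lebesgue measure. Otherwise neither side
  is integrable, and both integrals are 0 by convention.\<close>

lemma integral_translation:
  fixes g :: "'a::euclidean_space \<Rightarrow> real"
  shows "(\<integral>x. g (x + c) \<partial>lborel) = (\<integral>x. g x \<partial>lborel)"
proof (cases "g \<in> borel_measurable borel")
  case True
  have "(\<integral>x. g x \<partial>lborel) = (\<integral>x. g x \<partial>distr lborel borel ((+) c))"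
    by (simp add: lborel_distr_plus)
  also have "\<dots> = (\<integral>x. g (c + x) \<partial>lborel)"
    using True by (intro integral_distr) auto
  finally show ?thesis by (simp add: add.commute)
next
  case False
  have "(\<lambda>x. g (x + c)) \<notin> borel_measurable borel"
  proof
    assume "(\<lambda>x. g (x + c)) \<in> borel_measurable borel"
    moreover have "(\<lambda>x. x - c) \<in> borel_measurable borel" by simp
    ultimately have "(\<lambda>x. g ((x - c) + c)) \<in> borel_measurable borel"
      by (rule measurable_compose[rotated])
    with False show False by simp
  qed
  with False have "\<not> integrable lborel (\<lambda>x. g (x + c))" "\<not> integrable lborel g"
    using borel_measurable_integrable by (metis measurable_lborel2)+
  then show ?thesis by (simp add: not_integrable_integral_eq)
qed

lemma integrable_indicator_bounded_support:
  fixes g :: "'a::euclidean_space \<Rightarrow> real"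
  assumes "A \<in> sets borel" "compact C" "continuous_on C g" "\<And>x. x \<in> A \<Longrightarrow> x \<notin> C \<Longrightarrow> g x = 0"
  shows "integrable lborel (\<lambda>x. indicator A x * g x)"
proof -
  have "integrable lborel (\<lambda>x. indicator C x *\<^sub>R g x)"
    by (rule borel_integrable_compact[OF assms(2,3)])
  then have "integrable lborel (\<lambda>x. indicator A x *\<^sub>R (indicator C x *\<^sub>R g x))"
    using assms(1) by (rule_tac integrable_mult_indicator) auto
  moreover have "(\<lambda>x. indicator A x *\<^sub>R (indicator C x *\<^sub>R g x)) = (\<lambda>x. indicator A x * g x)"
    using assms(4) by (auto simp: indicator_def fun_eq_iff)
  ultimately show ?thesis by simp
qed

text \<open>No integration by parts is needed: the partial derivative is a limit of difference quotients,
  whose integrals vanish because of the invariance of the integral under translations.\<close>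

lemma integral_partial_eq_0:
  fixes g :: "real^3 \<Rightarrow> real"
  assumes D: "D \<in> sets borel" and C: "compact C" "\<And>x h. x \<in> D \<Longrightarrow> x \<notin> C \<Longrightarrow> 0 \<le> h \<Longrightarrow> h \<le> 1 \<Longrightarrow> g (x + h *\<^sub>R axis i 1) = 0"
    and g: "Ck_on 1 UNIV g"
    and inv: "\<And>h. 0 < h \<Longrightarrow> h \<le> 1 \<Longrightarrow>
      (\<integral>x. indicator D x * g (x + h *\<^sub>R axis i 1) \<partial>lborel) = (\<integral>x. indicator D x * g x \<partial>lborel)"
  shows "(\<integral>x. indicator D x * partial i g x \<partial>lborel) = 0"
proof -
  let ?e = "axis i 1 :: real^3"
  \<comment> \<open>Difference quotients with steps 1 / Suc n, which never exceed 1 and so stay in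
    the range of \<open>h\<close> in the hypotheses.\<close>
  define d where "d n x = real (Suc n) * (g (x + (1 / real (Suc n)) *\<^sub>R ?e) - g x)" for n x
  have g': "continuous_on UNIV (partial i g)" "continuous_on UNIV g"
    using Ck_on_partial[of 0 UNIV g i] g Ck_on_imp_continuous_on[OF g] by auto
  have der: "((\<lambda>h. g (x + h *\<^sub>R ?e)) has_real_derivative partial i g (x + h *\<^sub>R ?e)) (at h)" for x h
  proof -
    have gd: "(g has_derivative frechet_derivative g (at (x + h *\<^sub>R ?e))) (at (x + h *\<^sub>R ?e))"
      using g Ck_on_has_derivative[of 0 UNIV g] by simp
    have "((\<lambda>h. x + h *\<^sub>R ?e) has_derivative (\<lambda>k. k *\<^sub>R ?e)) (at h)"
      by (auto intro!: derivative_eq_intros)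
    from has_derivative_compose[OF this gd]
    show ?thesis unfolding has_field_derivative_def partial_def
      by (rule has_derivative_eq_rhs)
        (simp add: fun_eq_iff linear_scale[OF has_derivative_linear[OF gd]])
  qed
  \<comment> \<open>All points reached from \<open>C\<close> by a step of length at most 1. The
    intermediate points of the mean value theorem lie there, so one constant \<open>B\<close>
    dominates all difference quotients.\<close>
  define C' where "C' = (\<lambda>(x, h). x + h *\<^sub>R ?e) ` (C \<times> {0..1})"
  have C': "compact C'" unfolding C'_def case_prod_unfold
    using C(1) by (intro compact_continuous_image compact_Times continuous_intros) auto
  then have "compact (partial i g ` C')"
    using g'(1) by (intro compact_continuous_image) (auto intro: continuous_on_subset)
  then obtain B where B: "B > 0" "\<And>y. y \<in> C' \<Longrightarrow> \<bar>partial i g y\<bar> \<le> B"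
    using compact_imp_bounded bounded_pos by (metis imageI real_norm_def)
  have meas: "(\<lambda>x. indicator D x * d n x) \<in> borel_measurable lborel" for n
    unfolding d_def using D g'(2)
    by (intro borel_measurable_times borel_measurable_indicator borel_measurable_diff borel_measurable_continuous_onI)
      (auto intro!: continuous_intros continuous_on_compose2[OF g'(2)] borel_measurable_continuous_onI)
  have bound: "\<bar>indicator D x * d n x\<bar> \<le> B * indicator C x" for n x
  proof (cases "x \<in> D \<and> x \<in> C")
    case True
    let ?h = "1 / real (Suc n)"
    have h: "0 < ?h" "?h \<le> 1" by auto
    obtain z where z: "0 < z" "z < ?h" "g (x + ?h *\<^sub>R ?e) - g (x + 0 *\<^sub>R ?e) = (?h - 0) * partial i g (x + z *\<^sub>R ?e)"
      using MVT2[OF h(1), of "\<lambda>h. g (x + h *\<^sub>R ?e)" "\<lambda>h. partial i g (x + h *\<^sub>R ?e)"] der by blast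
    then have "d n x = partial i g (x + z *\<^sub>R ?e)" by (simp add: d_def field_simps)
    moreover have "z \<le> 1" using z(2) h(2) by linarith
    then have "x + z *\<^sub>R ?e \<in> C'" unfolding C'_def using True z(1) by (intro image_eqI[of _ _ "(x, z)"]) auto
    ultimately show ?thesis using B(2) True by simp
  next
    case False
    then show ?thesis using C(2)[of x "1 / real (Suc n)"] C(2)[of x 0] B(1)
      by (auto simp: d_def indicator_def)
  qed
  have lim: "(\<lambda>n. indicator D x * d n x) \<longlonglongrightarrow> indicator D x * partial i g x" for x
  proof -
    have "((\<lambda>h. (g (x + h *\<^sub>R ?e) - g x) / h) \<longlongrightarrow> partial i g x) (at 0)"
      using der[of x 0] by (simp add: has_field_derivative_iff)
    moreover have "filterlim (\<lambda>n. 1 / real (Suc n)) (at 0) sequentially"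
      unfolding filterlim_at using LIMSEQ_inverse_real_of_nat by (auto simp: inverse_eq_divide)
    ultimately have "(\<lambda>n. (g (x + (1 / real (Suc n)) *\<^sub>R ?e) - g x) / (1 / real (Suc n))) \<longlonglongrightarrow> partial i g x"
      by (rule filterlim_compose)
    then have "(\<lambda>n. d n x) \<longlonglongrightarrow> partial i g x" by (simp add: d_def mult.commute)
    then show ?thesis by (intro tendsto_intros)
  qed
  have "(\<lambda>n. \<integral>x. indicator D x * d n x \<partial>lborel) \<longlonglongrightarrow> (\<integral>x. indicator D x * partial i g x \<partial>lborel)"
  proof (rule integral_dominated_convergence)
    show "(\<lambda>x. indicator D x * partial i g x) \<in> borel_measurable lborel"
      using D g'(1) by (intro borel_measurable_times borel_measurable_indicator) (auto intro: borel_measurable_continuous_onI)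
    show "integrable lborel (\<lambda>x. B * indicator C x :: real)"
      using C(1) by (intro integrable_mult_right) (use emeasure_bounded_finite[OF compact_imp_bounded] in \<open>auto simp: compact_imp_closed integrable_indicator_iff\<close>)
    show "(\<lambda>x. indicator D x * d n x) \<in> borel_measurable lborel" for n by (rule meas)
    show "AE x in lborel. (\<lambda>n. indicator D x * d n x) \<longlonglongrightarrow> indicator D x * partial i g x"
      using lim by simp
    show "AE x in lborel. norm (indicator D x * d n x) \<le> B * indicator C x" for n
      using bound by simp
  qed
  moreover have "(\<integral>x. indicator D x * d n x \<partial>lborel) = 0" for n
  proof -
    let ?h = "1 / real (Suc n)"
    have "integrable lborel (\<lambda>x. indicator D x * g (x + ?h *\<^sub>R ?e))"
      by (rule integrable_indicator_bounded_support[OF D C(1)])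
        (auto intro!: continuous_on_compose2[OF g'(2)] continuous_intros C(2))
    moreover have "integrable lborel (\<lambda>x. indicator D x * g x)"
      by (rule integrable_indicator_bounded_support[OF D C(1)])
        (use C(2)[of _ 0] in \<open>auto intro!: continuous_on_subset[OF g'(2)]\<close>)
    moreover have "(\<lambda>x. indicator D x * d n x) =
      (\<lambda>x. real (Suc n) * (indicator D x * g (x + ?h *\<^sub>R ?e) - indicator D x * g x))"
      unfolding d_def by (auto simp: algebra_simps)
    ultimately show ?thesis using inv[of ?h] by simp
  qed
  ultimately show ?thesis by (simp add: LIMSEQ_const_iff)
qed

text \<open>Extended by zero, \<open>Z\<close> is of class C^1 on the whole space, because
  \<open>U\<close> and the complement of \<open>C\<close> are open and cover it. On the whole space
  the integral is translation invariant.\<close>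

lemma integral_partial_compact_support:
  assumes U: "open U" and C: "compact C" "C \<subseteq> U" and Z: "Ck_on 1 U Z" "\<And>x. x \<in> U \<Longrightarrow> x \<notin> C \<Longrightarrow> Z x = 0"
  shows "(\<integral>x. indicator U x * partial i Z x \<partial>lborel) = 0"
proof -
  define g where "g x = (if x \<in> U then Z x else 0)" for x
  have "Ck_on 1 UNIV g"
  proof (rule Ck_on_local)
    fix x :: "real^3"
    show "\<exists>V. open V \<and> x \<in> V \<and> Ck_on 1 V g"
    proof (cases "x \<in> U")
      case True
      have "Ck_on 1 U g" by (rule Ck_on_cong[OF U _ Z(1)]) (simp add: g_def)
      with True U show ?thesis by blast
    next
      case False
      have "open (- C)" using C(1) by (simp add: compact_imp_closed open_Compl)
      moreover have "Ck_on 1 (- C) g"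
        by (rule Ck_on_cong[OF \<open>open (- C)\<close> _ Ck_on_const[of 1 _ 0]]) (auto simp: g_def Z(2))
      ultimately show ?thesis using False C(2) by blast
    qed
  qed
  \<comment> \<open>The points from which a step of length at most 1 can end in \<open>C\<close>;
    outside of them all these translates of \<open>g\<close> vanish.\<close>
  define C' where "C' = (\<lambda>(x, h). x - h *\<^sub>R axis i (1::real)) ` (C \<times> {0..1})"
  have C': "compact C'" unfolding C'_def case_prod_unfold
    using C(1) by (intro compact_continuous_image compact_Times continuous_intros) auto
  have "(\<integral>x. indicator UNIV x * partial i g x \<partial>lborel) = 0"
  proof (rule integral_partial_eq_0[OF _ C'])
    show "g (x + h *\<^sub>R axis i 1) = 0" if "x \<notin> C'" "0 \<le> h" "h \<le> 1" for x h
    proof -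
      have "x + h *\<^sub>R axis i 1 \<notin> C"
      proof
        assume "x + h *\<^sub>R axis i 1 \<in> C"
        then have "(x + h *\<^sub>R axis i 1) - h *\<^sub>R axis i 1 \<in> C'" using that unfolding C'_def by force
        with that show False by simp
      qed
      then show ?thesis using Z(2) by (simp add: g_def)
    qed
    show "(\<integral>x. indicator UNIV x * g (x + h *\<^sub>R axis i 1) \<partial>lborel) = (\<integral>x. indicator UNIV x * g x \<partial>lborel)" for h
      using integral_translation[of g] by simp
  qed (use \<open>Ck_on 1 UNIV g\<close> in auto)
  moreover have "partial i g x = indicator U x * partial i Z x" for x
  proof (cases "x \<in> U")
    case True
    then have "partial i g x = partial i Z x" by (intro partial_cong_open[OF U]) (auto simp: g_def)
    with True show ?thesis by simp
  next
    case False
    have "partial i g x = partial i (\<lambda>_. 0) x"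
      by (rule partial_cong_open[of "- C"]) (use False C Z(2) in \<open>auto simp: g_def compact_imp_closed open_Compl\<close>)
    also have "\<dots> = 0" using partial_eqI[OF has_derivative_const] by simp
    finally show ?thesis using False by simp
  qed
  ultimately show ?thesis by simp
qed

text \<open>A translation along the first axis removes one end of the slab and adds another, with
  the same integral by periodicity. The other two translations map the slab to itself.\<close>

lemma integral_partial_periodic:
  assumes L: "L > 0" and per: "\<And>x. Z (x + L *\<^sub>R axis 1 1) = Z x" and Z: "Ck_on 1 UNIV Z"
    and supp: "\<And>x. Z x \<noteq> 0 \<Longrightarrow> \<bar>x$2\<bar> \<le> R \<and> \<bar>x$3\<bar> \<le> R"
  shows "(\<integral>x. indicator {x. 0 \<le> x$1 \<and> x$1 < L} x * partial i Z x \<partial>lborel) = 0"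
proof -
  define S where "S a b = {x::real^3. a \<le> x$1 \<and> x$1 < b}" for a b
  have S [measurable]: "S a b \<in> sets borel" for a b
    unfolding S_def by measurable
  have cont: "continuous_on UNIV Z" using Ck_on_imp_continuous_on[OF Z] .
  \<comment> \<open>The margin 1 around \<open>R\<close> leaves room for translations of length up
    to 1.\<close>
  define B where "B a b = cbox (vector [a, -R - 1, -R - 1]) (vector [b, R + 1, R + 1] :: real^3)" for a b
  have B: "compact (B a b)" "x \<in> B a b \<longleftrightarrow> a \<le> x$1 \<and> x$1 \<le> b \<and> \<bar>x$2\<bar> \<le> R + 1 \<and> \<bar>x$3\<bar> \<le> R + 1" for a b x
    unfolding B_def by (auto simp: mem_box_cart forall_3)
  have int: "integrable lborel (\<lambda>x. indicator (S a b) x * Z x)" for a b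
    by (rule integrable_indicator_bounded_support[OF S B(1)[of a b]])
      (use supp in \<open>fastforce simp: B(2) S_def intro: continuous_on_subset[OF cont]\<close>)+
  have shift: "(\<integral>x. indicator (S a b) x * Z (x + h *\<^sub>R axis 1 1) \<partial>lborel) = (\<integral>x. indicator (S (a+h) (b+h)) x * Z x \<partial>lborel)" for a b h
  proof -
    have "indicator (S a b) x = (indicator (S (a+h) (b+h)) (x + h *\<^sub>R axis 1 1) :: real)" for x
      by (auto simp: S_def indicator_def axis_def)
    then show ?thesis using integral_translation[of "\<lambda>x. indicator (S (a+h) (b+h)) x * Z x" "h *\<^sub>R axis 1 1"] by simp
  qed
  have "(\<integral>x. indicator (S 0 L) x * partial i Z x \<partial>lborel) = 0"
  proof (rule integral_partial_eq_0[OF S B(1)[of 0 L] _ Z])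
    show "Z (x + h *\<^sub>R axis i 1) = 0" if "x \<in> S 0 L" "x \<notin> B 0 L" "0 \<le> h" "h \<le> 1" for x h
    proof (rule ccontr)
      assume "Z (x + h *\<^sub>R axis i 1) \<noteq> 0"
      from supp[OF this] that show False
        unfolding B(2) using exhaust_3[of i] by (auto simp: S_def axis_def)
    qed
    fix h :: real assume h: "0 < h" "h \<le> 1"
    show "(\<integral>x. indicator (S 0 L) x * Z (x + h *\<^sub>R axis i 1) \<partial>lborel) = (\<integral>x. indicator (S 0 L) x * Z x \<partial>lborel)"
    proof (cases "i = 1")
      case True
      \<comment> \<open>Both sides restrict \<open>Z\<close> to the slab from 0 to L + h, also when
        \<open>h\<close> exceeds \<open>L\<close>.\<close>
      have "indicator (S h (L + h)) x * Z x + indicator (S 0 h) x * Z x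
          = indicator (S 0 L) x * Z x + indicator (S L (L + h)) x * Z x" for x
        using h L by (auto simp: S_def indicator_def)
      then have "(\<integral>x. indicator (S h (L + h)) x * Z x \<partial>lborel) + (\<integral>x. indicator (S 0 h) x * Z x \<partial>lborel)
          = (\<integral>x. indicator (S 0 L) x * Z x \<partial>lborel) + (\<integral>x. indicator (S L (L + h)) x * Z x \<partial>lborel)"
        using int by (simp flip: Bochner_Integration.integral_add)
      moreover have "(\<integral>x. indicator (S L (L + h)) x * Z x \<partial>lborel) = (\<integral>x. indicator (S 0 h) x * Z x \<partial>lborel)"
        using shift[of 0 h L] by (simp add: per add.commute)
      ultimately show ?thesis using True shift[of 0 L h] by simp
    next
      case False
      then have "indicator (S 0 L) x = (indicator (S 0 L) (x + h *\<^sub>R axis i 1) :: real)" for x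
        by (auto simp: S_def indicator_def axis_def)
      then show ?thesis using integral_translation[of "\<lambda>x. indicator (S 0 L) x * Z x" "h *\<^sub>R axis i 1"] by simp
    qed
  qed
  then show ?thesis by (simp add: S_def)
qed

section \<open>The manifold over a curve\<close>

lemma openin_EH_top:
  "openin EH_top W \<longleftrightarrow> W \<subseteq> EH \<and> openin (top_of_set eh_dom) {x \<in> eh_dom. eh_class x \<in> W}"
proof -
  let ?O = "\<lambda>W. W \<subseteq> EH \<and> openin (top_of_set eh_dom) {x \<in> eh_dom. eh_class x \<in> W}"
  have "istopology ?O"
    unfolding istopology_def
  proof (intro conjI allI impI)
    fix S T assume "?O S" "?O T"
    moreover have "{x \<in> eh_dom. eh_class x \<in> S \<inter> T} = {x \<in> eh_dom. eh_class x \<in> S} \<inter> {x \<in> eh_dom. eh_class x \<in> T}"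
      by auto
    ultimately show "S \<inter> T \<subseteq> EH" "openin (top_of_set eh_dom) {x \<in> eh_dom. eh_class x \<in> S \<inter> T}"
      by (auto intro: openin_Int)
  next
    fix \<K> assume K: "\<forall>K\<in>\<K>. ?O K"
    have "{x \<in> eh_dom. eh_class x \<in> \<Union>\<K>} = \<Union> ((\<lambda>K. {x \<in> eh_dom. eh_class x \<in> K}) ` \<K>)" by auto
    with K show "openin (top_of_set eh_dom) {x \<in> eh_dom. eh_class x \<in> \<Union>\<K>}"
      by (auto intro!: openin_Union)
    show "\<Union>\<K> \<subseteq> EH" using K by blast
  qed
  then show ?thesis by (simp add: EH_top_def topology_inverse')
qed

lemma topspace_EH_top: "topspace EH_top = EH"
proof -
  have "{x \<in> eh_dom. eh_class x \<in> EH} = eh_dom" by (auto intro: eh_class_in_EH)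
  then have "openin EH_top EH" by (simp add: openin_EH_top)
  then show ?thesis by (metis openin_EH_top openin_subset openin_topspace subset_antisym)
qed

lemma eh_param_in_EH: "eh_param x \<in> EH"
  by (auto simp: eh_param_def eh_dom_def intro!: eh_class_in_EH)

lemma continuous_map_eh_param: "continuous_map euclidean EH_top eh_param"
  unfolding continuous_map_def
proof (intro conjI allI impI)
  show "eh_param \<in> topspace euclidean \<rightarrow> topspace EH_top" by (simp add: topspace_EH_top eh_param_in_EH)
  fix W assume "openin EH_top W"
  then obtain T where T: "open T" "{x \<in> eh_dom. eh_class x \<in> W} = eh_dom \<inter> T"
    by (auto simp: openin_EH_top openin_open)
  have "{x. eh_param x \<in> W} = (\<lambda>x. (x$1, 1, x$2)) -` T"
  proof -
    have "eh_param x \<in> W \<longleftrightarrow> (x$1, 1, x$2) \<in> {x \<in> eh_dom. eh_class x \<in> W}" for x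
      by (simp add: eh_param_def eh_dom_def)
    then show ?thesis unfolding T(2) by (auto simp: eh_dom_def)
  qed
  moreover have "open ((\<lambda>x::complex^2. (x$1, 1::complex, x$2)) -` T)"
    by (intro open_vimage T(1) continuous_intros)
  ultimately show "openin euclidean {x \<in> topspace euclidean. eh_param x \<in> W}" by simp
qed

lemma vector_2_axis: "(vector [a, b] :: 'a::real_normed_vector^2) = axis 1 a + axis 2 b"
  by (simp add: vec_eq_iff forall_2 axis_def)

lemma bounded_linear_axis: "bounded_linear (axis i :: 'a::real_normed_vector \<Rightarrow> 'a^'n)"
proof
  show "axis i (a + b) = (axis i a + axis i b :: 'a^'n)" for a b by (simp add: vec_eq_iff axis_def)
  show "axis i (r *\<^sub>R a) = (r *\<^sub>R axis i a :: 'a^'n)" for r a by (simp add: vec_eq_iff axis_def)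
  have "norm (axis i a :: 'a^'n) \<le> norm a * 1" for a
  proof -
    have "norm (axis i a :: 'a^'n) \<le> (\<Sum>j\<in>UNIV. norm ((axis i a :: 'a^'n) $ j))"
      unfolding norm_vec_def by (rule L2_set_le_sum) simp
    also have "\<dots> = (\<Sum>j\<in>UNIV. if j = i then norm a else 0)" by (intro sum.cong) (auto simp: axis_def)
    finally show ?thesis by simp
  qed
  then show "\<exists>K. \<forall>a. norm (axis i a :: 'a^'n) \<le> norm a * K" by blast
qed

lemmas continuous_on_axis [continuous_intros] = bounded_linear.continuous_on[OF bounded_linear_axis]

text \<open>The union of the classes in the image of \<open>O'\<close> consists of the triples with
  \<beta> nonzero whose normalized coordinates (\<alpha> / \<beta>, \<gamma> \<beta>^2) lie in
  \<open>O'\<close>. These coordinates are continuous in the triple, so the union is open.\<close>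

lemma open_map_eh_param: "open_map euclidean EH_top eh_param"
  unfolding open_map_def
proof (intro allI impI)
  fix O' :: "(complex^2) set" assume "openin euclidean O'"
  then have op: "open O'" by simp
  let ?N = "{p::complex \<times> complex \<times> complex. fst (snd p) \<noteq> 0}"
  let ?F = "\<lambda>p::complex \<times> complex \<times> complex. vector [fst p / fst (snd p), snd (snd p) * (fst (snd p))\<^sup>2] :: complex^2"
  have N: "open ?N" by (intro open_Collect_neq continuous_intros)
  have "continuous_on ?N ?F" unfolding vector_2_axis by (intro continuous_intros) auto
  then have opN: "open (?N \<inter> ?F -` O')" using N op by (simp add: continuous_open_preimage)
  have "x \<in> eh_dom \<and> eh_class x \<in> eh_param ` O' \<longleftrightarrow> x \<in> ?N \<inter> ?F -` O'" for x
  proof -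
    obtain \<alpha> \<beta> \<gamma> where x: "x = (\<alpha>, \<beta>, \<gamma>)" by (metis prod_cases3)
    show ?thesis
    proof (cases "\<beta> = 0")
      case True
      have "eh_class x \<noteq> eh_param y" if "x \<in> eh_dom" for y
      proof
        assume "eh_class x = eh_param y"
        then have "(x, (y$1, 1, y$2)) \<in> eh_rel"
          using that unfolding eh_param_def by (subst (asm) eh_class_eq_iff) (auto simp: eh_dom_def)
        with True show False by (auto simp: eh_rel_def x)
      qed
      then show ?thesis using True by (auto simp: x)
    next
      case False
      then show ?thesis using eh_class_eh_param[OF False, of \<alpha> \<gamma>]
        by (auto simp: x eh_dom_def eh_param_eq_iff)
    qed
  qed
  then have "{x \<in> eh_dom. eh_class x \<in> eh_param ` O'} = eh_dom \<inter> (?N \<inter> ?F -` O')" by blast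
  then show "openin EH_top (eh_param ` O')"
    unfolding openin_EH_top using opN by (auto simp: eh_param_in_EH openin_open)
qed

text \<open>\<open>P\<close> is arbitrary because the set of interest, the part over a curve, is not
  open; an embedding restricts to every subset.\<close>

lemma homeomorphic_map_eh_param:
  "homeomorphic_map (top_of_set P) (subtopology EH_top (eh_param ` P)) eh_param"
proof -
  have "embedding_map euclidean EH_top eh_param"
    by (intro injective_open_imp_embedding_map continuous_map_eh_param open_map_eh_param) (simp add: inj_eh_param)
  then have "homeomorphic_map euclidean (subtopology EH_top (range eh_param)) eh_param"
    by (simp add: embedding_map_def)
  then have "homeomorphic_map (top_of_set P) (subtopology (subtopology EH_top (range eh_param)) (eh_param ` P)) eh_param"
    by (rule homeomorphic_map_subtopologies) (auto simp: topspace_EH_top eh_param_in_EH)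
  then show ?thesis by (simp add: subtopology_subtopology inf.absorb2 image_mono)
qed

lemma eh_preimage_eq: "eh_preimage C = eh_param ` {z. z $ 1 \<in> C}"
proof (intro equalityI subsetI)
  fix p assume "p \<in> eh_preimage C"
  then obtain w where w: "p \<in> EH" "eh_proj p = Some w" "w \<in> C" by (auto simp: eh_preimage_def)
  from eh_proj_Some_imp[OF w(1,2)] obtain \<gamma> where "p = eh_param (vector [w, \<gamma>])"
    by (auto simp: eh_param_def)
  then show "p \<in> eh_param ` {z. z $ 1 \<in> C}" using w(3) by (intro image_eqI) auto
next
  fix p assume "p \<in> eh_param ` {z. z $ 1 \<in> C}"
  then show "p \<in> eh_preimage C" by (auto simp: eh_preimage_def eh_param_in_EH)
qed

text \<open>The chart read in C^2, where continuity and openness are Euclidean questions;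
  \<open>eh_param\<close> carries the answers over to classes.\<close>

definition curve_lift :: "(real \<Rightarrow> complex) \<Rightarrow> real^3 \<Rightarrow> complex^2" where
  "curve_lift \<Gamma> x = vector [\<Gamma> (x $ 1), Complex (x $ 2) (x $ 3)]"

lemma curve_param_lift: "curve_param \<Gamma> x = eh_param (curve_lift \<Gamma> x)"
  by (simp add: curve_param_def eh_param_def curve_lift_def)

lemma curve_lift_axis:
  "curve_lift \<Gamma> x = axis 1 (\<Gamma> (x $ 1)) + axis 2 (of_real (x $ 2) + \<i> * of_real (x $ 3))"
  by (simp add: curve_lift_def vector_2_axis Complex_eq)

text \<open>A common frame for the two kinds of curves: a closed curve of length \<open>L > 0\<close>,
  parametrized periodically, and, with \<open>L = 0\<close>, an injectively parametrized open curve.\<close>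

locale eh_curve =
  fixes t :: real and \<Gamma> :: "real \<Rightarrow> complex" and J :: "real set" and L :: real
  assumes t: "t \<noteq> 0"
    and J: "open J" "connected J" "J \<noteq> {}"
    and smooth: "smooth_on J \<Gamma>"
    and unit_speed: "\<And>s. s \<in> J \<Longrightarrow> cmod (vector_derivative \<Gamma> (at s)) = 1"
    and L: "L \<ge> 0" "L > 0 \<Longrightarrow> J = UNIV"
    and period: "\<And>s s'. s \<in> J \<Longrightarrow> s' \<in> J \<Longrightarrow> \<Gamma> s = \<Gamma> s' \<longleftrightarrow> (\<exists>k::int. s' = s + of_int k * L)"
    and open_image: "\<And>I. open I \<Longrightarrow> I \<subseteq> J \<Longrightarrow> openin (top_of_set (\<Gamma> ` J)) (\<Gamma> ` I)"
begin

section \<open>Topology of the manifold over the curve\<close>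

abbreviation M :: "(eh_point, 3) riem_mfd" where "M \<equiv> eh_three_manifold t \<Gamma> J"
abbreviation \<sigma> :: "real^3 \<Rightarrow> eh_point" where "\<sigma> \<equiv> curve_param \<Gamma>"
abbreviation chart_dom :: "real set \<Rightarrow> (real^3) set" where "chart_dom I \<equiv> {x. x $ 1 \<in> I}"

lemma mtop_M: "mtop M = subtopology EH_top (eh_param ` {z. z $ 1 \<in> \<Gamma> ` J})"
  by (simp add: eh_three_manifold_def eh_preimage_eq)

lemma homeo_M: "homeomorphic_map (top_of_set {z. z $ 1 \<in> \<Gamma> ` J}) (mtop M) eh_param"
  unfolding mtop_M by (rule homeomorphic_map_eh_param)

lemma carr_M_param: "carr M = eh_param ` {z. z $ 1 \<in> \<Gamma> ` J}"
  using homeomorphic_imp_surjective_map[OF homeo_M] by simp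

lemma curve_lift_image: "curve_lift \<Gamma> ` chart_dom I = {z. z $ 1 \<in> \<Gamma> ` I}"
proof (intro equalityI subsetI)
  fix z :: "complex^2" assume "z \<in> {z. z $ 1 \<in> \<Gamma> ` I}"
  then obtain s where s: "s \<in> I" "z $ 1 = \<Gamma> s" by auto
  then have "z = curve_lift \<Gamma> (vector [s, Re (z $ 2), Im (z $ 2)])"
    by (simp add: curve_lift_def vec_eq_iff forall_2)
  then show "z \<in> curve_lift \<Gamma> ` chart_dom I" using s by (intro image_eqI) auto
qed (auto simp: curve_lift_def)

lemma carr_M: "carr M = \<sigma> ` chart_dom J"
  unfolding carr_M_param curve_lift_image[symmetric] image_image curve_param_lift ..

lemma atlas_M: "(U, \<tau>) \<in> atlas M \<longleftrightarrow> (\<exists>I. U = chart_dom I \<and> \<tau> = \<sigma> \<and> open I \<and> I \<subseteq> J \<and> inj_on \<Gamma> I)"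
  by (auto simp: eh_three_manifold_def)

lemma open_chart_dom: "open I \<Longrightarrow> open (chart_dom I)"
  by (rule open_vec_nth_vimage)

lemma continuous_on_\<Gamma>: "continuous_on J \<Gamma>"
  using smooth unfolding smooth_on_def by (metis Ck_on.simps(1))

lemma continuous_on_lift: "continuous_on (chart_dom J) (curve_lift \<Gamma>)"
  unfolding curve_lift_axis
  by (intro continuous_intros continuous_on_compose2[OF continuous_on_\<Gamma>]) auto

lemma continuous_map_\<sigma>: "I \<subseteq> J \<Longrightarrow> continuous_map (top_of_set (chart_dom I)) (mtop M) \<sigma>"
proof -
  assume I: "I \<subseteq> J"
  have "continuous_map (top_of_set (chart_dom I)) (top_of_set {z. z $ 1 \<in> \<Gamma> ` J}) (curve_lift \<Gamma>)"
    using continuous_on_subset[OF continuous_on_lift, of "chart_dom I"] I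
    by (auto simp: continuous_map_in_subtopology curve_lift_def)
  from continuous_map_compose[OF this homeomorphic_imp_continuous_map[OF homeo_M]]
  show ?thesis by (simp add: comp_def curve_param_lift[abs_def])
qed

text \<open>A neighbourhood in the image is the product of a piece of the curve with a disc in the
  fibre. The assumption \<open>open_image\<close> makes the first factor relatively open.\<close>

lemma openin_lift_image:
  assumes V: "open V" "V \<subseteq> chart_dom J"
  shows "openin (top_of_set {z. z $ 1 \<in> \<Gamma> ` J}) (curve_lift \<Gamma> ` V)"
proof (subst openin_subopen, intro ballI)
  fix z assume "z \<in> curve_lift \<Gamma> ` V"
  then obtain x where x: "x \<in> V" "z = curve_lift \<Gamma> x" by auto
  obtain e where e: "e > 0" "ball x e \<subseteq> V" using V(1) x(1) open_contains_ball by blast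
  \<comment> \<open>Radius e/2 for the parameter and e/2 for the fibre: the sum of the squares stays
    below e^2.\<close>
  have J': "open (J \<inter> ball (x$1) (e/2))" using J(1) by auto
  obtain T where T: "open T" "\<Gamma> ` (J \<inter> ball (x$1) (e/2)) = \<Gamma> ` J \<inter> T"
    using open_image[OF J'] by (auto simp: openin_open)
  define N where "N = {z::complex^2. z $ 1 \<in> T \<and> dist (z $ 2) (Complex (x$2) (x$3)) < e/2}"
  have "N = (\<lambda>z. z $ 1) -` T \<inter> (\<lambda>z. z $ 2) -` ball (Complex (x$2) (x$3)) (e/2)"
    by (auto simp: N_def dist_commute)
  moreover have "open ((\<lambda>z::complex^2. z $ 1) -` T)" "open ((\<lambda>z::complex^2. z $ 2) -` ball (Complex (x$2) (x$3)) (e/2))"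
    using T(1) by (auto intro!: open_vimage continuous_intros)
  ultimately have N: "open N" by auto
  show "\<exists>T'. openin (top_of_set {z. z $ 1 \<in> \<Gamma> ` J}) T' \<and> z \<in> T' \<and> T' \<subseteq> curve_lift \<Gamma> ` V"
  proof (intro exI[of _ "{z. z $ 1 \<in> \<Gamma> ` J} \<inter> N"] conjI)
    show "openin (top_of_set {z. z $ 1 \<in> \<Gamma> ` J}) ({z. z $ 1 \<in> \<Gamma> ` J} \<inter> N)"
      using N by (simp add: openin_open_Int)
    have "x$1 \<in> J \<inter> ball (x$1) (e/2)" using x(1) V(2) e by auto
    then have "\<Gamma> (x$1) \<in> \<Gamma> ` J \<inter> T" using T(2) by blast
    then show "z \<in> {z. z $ 1 \<in> \<Gamma> ` J} \<inter> N" using e(1) by (auto simp: N_def x(2) curve_lift_def)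
    show "{z. z $ 1 \<in> \<Gamma> ` J} \<inter> N \<subseteq> curve_lift \<Gamma> ` V"
    proof
      fix z' assume z': "z' \<in> {z. z $ 1 \<in> \<Gamma> ` J} \<inter> N"
      then have "z' $ 1 \<in> \<Gamma> ` (J \<inter> ball (x$1) (e/2))" unfolding T(2) by (auto simp: N_def)
      then obtain s where s: "s \<in> J" "dist (x$1) s < e/2" "z' $ 1 = \<Gamma> s" by auto
      define y where "y = (vector [s, Re (z' $ 2), Im (z' $ 2)] :: real^3)"
      have "z' = curve_lift \<Gamma> y" by (simp add: y_def curve_lift_def vec_eq_iff forall_2 s(3))
      moreover have "y \<in> ball x e"
      proof -
        let ?d = "z' $ 2 - Complex (x$2) (x$3)"
        have "(dist x y)\<^sup>2 = (x$1 - s)\<^sup>2 + ((Re ?d)\<^sup>2 + (Im ?d)\<^sup>2)"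
          by (simp add: dist_norm norm_vec_def L2_set_def sum_3 y_def power2_commute)
        also have "\<dots> = (x$1 - s)\<^sup>2 + (cmod ?d)\<^sup>2" by (simp only: cmod_power2)
        also have "\<dots> < (e/2)\<^sup>2 + (e/2)\<^sup>2"
        proof (rule add_strict_mono)
          show "(x$1 - s)\<^sup>2 < (e/2)\<^sup>2"
            using power_strict_mono[of "\<bar>x$1 - s\<bar>" "e/2" 2] s(2) by (simp add: dist_real_def)
          show "(cmod ?d)\<^sup>2 < (e/2)\<^sup>2"
            using z' by (intro power_strict_mono) (auto simp: N_def dist_norm)
        qed
        also have "\<dots> \<le> e\<^sup>2" using e(1) by (simp add: power2_eq_square field_simps)
        finally show ?thesis using e(1) by (simp add: power_less_imp_less_base)
      qed
      ultimately show "z' \<in> curve_lift \<Gamma> ` V" using e(2) by blast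
    qed
  qed
qed

lemma openin_\<sigma>_image: "open V \<Longrightarrow> V \<subseteq> chart_dom J \<Longrightarrow> openin (mtop M) (\<sigma> ` V)"
  using homeomorphic_map_openness_eq[OF homeo_M, of "curve_lift \<Gamma> ` V"] openin_lift_image[of V]
  by (simp add: image_image curve_param_lift)

text \<open>The coordinate \<gamma> trivializes the line bundle over the whole plane, so going once
  around a closed curve leaves it fixed: the deck transformations are pure translations of the
  parameter.\<close>

lemma \<sigma>_eq_iff:
  assumes "x$1 \<in> J" "y$1 \<in> J"
  shows "\<sigma> x = \<sigma> y \<longleftrightarrow> (\<exists>k::int. y = x + (of_int k * L) *\<^sub>R axis 1 1)"
proof -
  have "\<sigma> x = \<sigma> y \<longleftrightarrow> \<Gamma> (x$1) = \<Gamma> (y$1) \<and> x$2 = y$2 \<and> x$3 = y$3"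
    by (auto simp: curve_param_lift eh_param_eq_iff curve_lift_def vec_eq_iff forall_2)
  then show ?thesis unfolding period[OF assms]
    by (auto simp: vec_eq_iff forall_3 axis_def)
qed

lemma shift_in_J: "s \<in> J \<Longrightarrow> s + of_int k * L \<in> J"
  using L by (cases "L = 0") auto

lemma \<Gamma>_shift: "s \<in> J \<Longrightarrow> \<Gamma> (s + of_int k * L) = \<Gamma> s"
  using period[of s "s + of_int k * L"] shift_in_J[of s k] by auto

lemma \<sigma>_shift: "x$1 \<in> J \<Longrightarrow> \<sigma> (x + (of_int k * L) *\<^sub>R axis 1 1) = \<sigma> x"
  using \<sigma>_eq_iff[of x "x + (of_int k * L) *\<^sub>R axis 1 1"] shift_in_J[of "x$1" k]
  by (auto simp: axis_def)

lemma inj_on_\<sigma>: "I \<subseteq> J \<Longrightarrow> inj_on \<Gamma> I \<Longrightarrow> inj_on \<sigma> (chart_dom I)"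
  by (auto simp: inj_on_def curve_param_lift eh_param_eq_iff curve_lift_def vec_eq_iff forall_2 forall_3)

lemma homeomorphic_map_\<sigma>:
  assumes "open I" "I \<subseteq> J" "inj_on \<Gamma> I"
  shows "homeomorphic_map (top_of_set (chart_dom I)) (subtopology (mtop M) (\<sigma> ` chart_dom I)) \<sigma>"
proof -
  have "embedding_map (top_of_set (chart_dom I)) (mtop M) \<sigma>"
  proof (rule injective_open_imp_embedding_map)
    show "continuous_map (top_of_set (chart_dom I)) (mtop M) \<sigma>" using assms(2) by (rule continuous_map_\<sigma>)
    show "open_map (top_of_set (chart_dom I)) (mtop M) \<sigma>"
      unfolding open_map_def
      using assms open_chart_dom by (auto simp: openin_open_eq intro!: openin_\<sigma>_image)
    show "inj_on \<sigma> (topspace (top_of_set (chart_dom I)))" using inj_on_\<sigma> assms by simp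
  qed
  then show ?thesis by (simp add: embedding_map_def)
qed

lemma Hausdorff_M: "Hausdorff_space (mtop M)"
proof -
  have "Hausdorff_space (top_of_set {z::complex^2. z $ 1 \<in> \<Gamma> ` J})"
    by (simp add: Hausdorff_space_subtopology)
  then show ?thesis
    using homeomorphic_Hausdorff_space homeomorphic_map_imp_homeomorphic_space[OF homeo_M] by blast
qed

lemma second_countable_M: "second_countable (mtop M)"
proof (rule second_countable_open_map_image)
  show "continuous_map (top_of_set {z. z $ 1 \<in> \<Gamma> ` J}) (mtop M) eh_param"
    "open_map (top_of_set {z. z $ 1 \<in> \<Gamma> ` J}) (mtop M) eh_param"
    "eh_param ` topspace (top_of_set {z. z $ 1 \<in> \<Gamma> ` J}) = carr M"
    using homeo_M homeomorphic_imp_continuous_map homeomorphic_imp_open_map homeomorphic_imp_surjective_map by blast+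
  have "second_countable (euclidean :: (complex^2) topology)"
  proof -
    obtain \<B> :: "(complex^2) set set" where \<B>: "countable \<B>" "\<And>C. C \<in> \<B> \<Longrightarrow> open C"
      "\<And>S. open S \<Longrightarrow> \<exists>U. U \<subseteq> \<B> \<and> S = \<Union>U"
      by (rule univ_second_countable) blast
    then show ?thesis unfolding second_countable_def
      by (intro exI[of _ \<B>]) (simp, blast)
  qed
  then show "second_countable (top_of_set {z::complex^2. z $ 1 \<in> \<Gamma> ` J})"
    by (rule second_countable_subtopology)
qed

lemma connected_M: "connected_space (mtop M)"
proof -
  have "convex J" using J(2) connected_convex_1 by blast
  then have "convex (chart_dom J)" by (auto simp: convex_def)
  then have *: "connected (chart_dom J)" by (rule convex_connected)
  then have "connectedin (mtop M) (\<sigma> ` topspace (top_of_set (chart_dom J)))"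
    by (intro connectedin_continuous_map_image[OF continuous_map_\<sigma>]) (use * in \<open>auto simp: connectedin_subtopology\<close>)
  then show ?thesis using carr_M by (simp add: connectedin_topspace[symmetric])
qed

end

text \<open>Cauchy--Schwarz in the orthonormal frame: p, q, r are the components of the
  differential, a, b, e those of \<open>v\<close>, and Lagrange's identity writes the difference of
  the two sides as a sum of squares.\<close>

lemma frechet_derivative_sq_le:
  assumes Q: "Q x > 0" and f: "f differentiable (at x)"
  shows "(frechet_derivative f (at x) v)\<^sup>2 \<le> grad_norm_sq Q m1 m2 f x * frame_metric Q m1 m2 x v v"
proof -
  define s where "s = sqrt (Q x)"
  have s: "s > 0" "Q x = s * s" using Q by (auto simp: s_def)
  define p q r a b e where "p = horizontal m1 m2 f x * s" and "q = partial 2 f x / s" and "r = partial 3 f x / s"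
    and "a = v$1 / s" and "b = s * (v$2 + m1 x * v$1)" and "e = s * (v$3 + m2 x * v$1)"
  have 1: "frechet_derivative f (at x) v = p * a + q * b + r * e"
    unfolding frechet_derivative_partial[OF f] p_def q_def r_def a_def b_def e_def
    using s(1) by (simp add: horizontal_def field_simps)
  have 2: "grad_norm_sq Q m1 m2 f x = p\<^sup>2 + q\<^sup>2 + r\<^sup>2"
    unfolding grad_norm_sq_def p_def q_def r_def s(2) using s(1) by (simp add: field_simps power2_eq_square)
  have 3: "frame_metric Q m1 m2 x v v = a\<^sup>2 + b\<^sup>2 + e\<^sup>2"
    unfolding frame_metric_def a_def b_def e_def s(2) using s(1) by (simp add: field_simps power2_eq_square)
  have "(p\<^sup>2 + q\<^sup>2 + r\<^sup>2) * (a\<^sup>2 + b\<^sup>2 + e\<^sup>2) - (p * a + q * b + r * e)\<^sup>2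
      = (p * b - q * a)\<^sup>2 + (p * e - r * a)\<^sup>2 + (q * e - r * b)\<^sup>2"
    by (simp add: power2_eq_square algebra_simps)
  also have "\<dots> \<ge> 0" by simp
  finally show ?thesis unfolding 1 2 3 by simp
qed

context eh_curve begin

text \<open>In the coordinates \<open>s\<close> (arc length) and \<open>\<gamma> = x2 + i x3\<close> (fibre), with \<open>q = wt s\<close>, the
  induced metric is \<open>ds^2 / Q + Q |d\<gamma> + (m1 + i m2) ds|^2\<close>, where \<open>Q = q^2 / (2 S)\<close> and
  \<open>m1 + i m2 = 2 cnj \<Gamma> \<Gamma>' \<gamma> / q\<close>. The function \<open>q |\<gamma>|\<close>, hence also \<open>S\<close>, is constant along the
  horizontal direction \<open>(1, - m1, - m2)\<close>.\<close>

definition d\<Gamma> :: "real \<Rightarrow> complex" where "d\<Gamma> s = vector_derivative \<Gamma> (at s)"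
definition wt :: "real \<Rightarrow> real" where "wt s = 1 + (cmod (\<Gamma> s))\<^sup>2"
definition dwt :: "real \<Rightarrow> real" where "dwt s = 2 * Re (cnj (\<Gamma> s) * d\<Gamma> s)"
definition twist :: "real \<Rightarrow> real" where "twist s = 2 * Im (cnj (\<Gamma> s) * d\<Gamma> s)"
definition rsq :: "real^3 \<Rightarrow> real" where "rsq x = (x$2)\<^sup>2 + (x$3)\<^sup>2"
definition S :: "real^3 \<Rightarrow> real" where "S x = sqrt ((wt (x$1))\<^sup>2 * rsq x + t ^ 4)"
definition Q :: "real^3 \<Rightarrow> real" where "Q x = (wt (x$1))\<^sup>2 / (2 * S x)"
definition m1 :: "real^3 \<Rightarrow> real" where "m1 x = (dwt (x$1) * x$2 - twist (x$1) * x$3) / wt (x$1)"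
definition m2 :: "real^3 \<Rightarrow> real" where "m2 x = (twist (x$1) * x$2 + dwt (x$1) * x$3) / wt (x$1)"

lemma wt_ge_1: "wt s \<ge> 1" by (simp add: wt_def)
lemma wt_pos: "wt s > 0" using wt_ge_1[of s] by linarith
lemma S_pos: "S x > 0" using t by (simp add: S_def rsq_def add_nonneg_pos)
lemma S_sq: "(S x)\<^sup>2 = (wt (x$1))\<^sup>2 * rsq x + t ^ 4"
  by (simp add: S_def rsq_def)
text \<open>This bounds the base part 2 S dl^2 of the metric from below, and with it the gradient of
  the arc length l from above.\<close>

lemma S_ge: "S x \<ge> t\<^sup>2"
proof -
  have "(t\<^sup>2)\<^sup>2 \<le> (S x)\<^sup>2" unfolding S_sq by (simp add: rsq_def flip: power_mult)
  then show ?thesis using S_pos[of x] by (rule power2_le_imp_le[OF _ less_imp_le])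
qed
lemma Q_pos: "Q x > 0" using S_pos[of x] wt_pos[of "x$1"] by (simp add: Q_def)

lemma \<Gamma>_Ck: "Ck_on k J \<Gamma>" using smooth by (simp add: smooth_on_def)
lemma d\<Gamma>_Ck: "Ck_on k J d\<Gamma>"
  unfolding d\<Gamma>_def[abs_def] by (rule Ck_on_real_vector_derivative[OF J(1) \<Gamma>_Ck])
lemma \<Gamma>_deriv: "s \<in> J \<Longrightarrow> (\<Gamma> has_vector_derivative d\<Gamma> s) (at s)"
  using \<Gamma>_Ck[of 1] unfolding d\<Gamma>_def by (simp add: vector_derivative_works)
lemma norm_d\<Gamma>: "s \<in> J \<Longrightarrow> cmod (d\<Gamma> s) = 1" using unit_speed by (simp add: d\<Gamma>_def)

lemma wt_deriv: "s \<in> J \<Longrightarrow> (wt has_real_derivative dwt s) (at s)"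
proof -
  assume s: "s \<in> J"
  have "((\<lambda>s. 1 + \<Gamma> s \<bullet> \<Gamma> s) has_vector_derivative dwt s) (at s)"
    by (rule has_vector_derivative_eq_rhs[OF has_vector_derivative_add[OF has_vector_derivative_const
          bounded_bilinear.has_vector_derivative[OF bounded_bilinear_inner \<Gamma>_deriv[OF s] \<Gamma>_deriv[OF s]]]])
      (simp add: dwt_def inner_complex_def)
  then show ?thesis unfolding wt_def[abs_def] dot_square_norm
    by (simp add: has_real_derivative_iff_has_vector_derivative)
qed

lemma wt_Ck: "Ck_on k J wt"
proof -
  have "wt = (\<lambda>s. 1 + ((Re (\<Gamma> s))\<^sup>2 + (Im (\<Gamma> s))\<^sup>2))" by (simp add: wt_def[abs_def] cmod_power2)
  then show ?thesis using \<Gamma>_Ck J(1) by (auto intro!: Ck_intros)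
qed
lemma dwt_Ck: "Ck_on k J dwt"
  unfolding dwt_def[abs_def] using \<Gamma>_Ck d\<Gamma>_Ck J(1)
  by (auto intro!: Ck_intros)
lemma twist_Ck: "Ck_on k J twist"
  unfolding twist_def[abs_def] using \<Gamma>_Ck d\<Gamma>_Ck J(1)
  by (auto intro!: Ck_intros)

lemmas open_J3 = open_chart_dom[OF J(1)]
lemmas J_Ck_lift = Ck_on_of_vec_nth[OF J(1) wt_Ck, where i = 1 and ?'n = 3]
  Ck_on_of_vec_nth[OF J(1) dwt_Ck, where i = 1 and ?'n = 3]
  Ck_on_of_vec_nth[OF J(1) twist_Ck, where i = 1 and ?'n = 3]

lemma S_Ck: "Ck_on k (chart_dom J) S"
proof -
  have "0 < (wt (x$1))\<^sup>2 * rsq x + t ^ 4" for x using t by (simp add: rsq_def add_nonneg_pos)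
  then show ?thesis unfolding S_def[abs_def] unfolding rsq_def
    by (intro J_Ck_lift Ck_intros open_J3) auto
qed

lemma Q_Ck: "Ck_on k (chart_dom J) Q"
  unfolding Q_def[abs_def] using S_pos
  by (intro J_Ck_lift Ck_intros open_J3 S_Ck) (metis less_irrefl mult_pos_pos zero_less_numeral)

lemma m_Ck: "Ck_on k (chart_dom J) m1" "Ck_on k (chart_dom J) m2"
proof -
  have nz: "wt (x$1) \<noteq> 0" for x :: "real^3" using wt_pos[of "x$1"] by simp
  show "Ck_on k (chart_dom J) m1" "Ck_on k (chart_dom J) m2"
    unfolding m1_def[abs_def] m2_def[abs_def] by (intro J_Ck_lift Ck_intros open_J3 nz)+
qed

section \<open>The induced metric in the charts and the oriented atlas\<close>

lemma has_derivative_lift: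
  assumes "x$1 \<in> J"
  shows "(curve_lift \<Gamma> has_derivative
    (\<lambda>v. axis 1 (v$1 *\<^sub>R d\<Gamma> (x$1)) + axis 2 (of_real (v$2) + \<i> * of_real (v$3)))) (at x)"
proof -
  have n: "((\<lambda>x::real^3. x $ i) has_derivative (\<lambda>v. v $ i)) (at x)" for i
    by (rule bounded_linear_imp_has_derivative[OF bounded_linear_vec_nth])
  have c: "((\<lambda>x::real^3. complex_of_real (x $ i)) has_derivative (\<lambda>v. of_real (v $ i))) (at x)" for i
    by (rule bounded_linear.has_derivative[OF bounded_linear_of_real n])
  show ?thesis unfolding curve_lift_axis[abs_def]
    by (intro has_derivative_add bounded_linear.has_derivative[OF bounded_linear_axis] c has_derivative_mult_right
        has_derivative_compose[OF n \<Gamma>_deriv[OF assms, unfolded has_vector_derivative_def]])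
qed

text \<open>Unit speed reduces the base term to the product of the first components. In the
  connection form the motion along the curve adds 2 cnj \<Gamma> \<Gamma>' \<gamma> / wt to the
  fibre velocity, and since \<open>dwt\<close> and \<open>twist\<close> are the parts of 2 cnj
  \<Gamma> \<Gamma>', this is m1 + \<i> m2.\<close>

lemma gmetric_M:
  assumes x: "x$1 \<in> J"
  shows "gmetric M \<sigma> x = frame_metric Q m1 m2 x"
proof (intro ext)
  fix v w
  let ?z = "curve_lift \<Gamma> x" and ?w = "wt (x$1)"
  let ?D = "\<lambda>v::real^3. axis 1 (v$1 *\<^sub>R d\<Gamma> (x$1)) + axis 2 (of_real (v$2) + \<i> * of_real (v$3)) :: complex^2"
  have "eh_coords \<circ> \<sigma> = curve_lift \<Gamma>" by (simp add: fun_eq_iff curve_param_lift)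
  then have D: "frechet_derivative (eh_coords \<circ> \<sigma>) (at x) = ?D"
    using frechet_derivative_at[OF has_derivative_lift[OF x]] by simp
  have b: "base_weight ?z = ?w" by (simp add: base_weight_def wt_def curve_lift_def)
  have Sz: "eh_S t ?z = S x"
    by (simp add: eh_S_def S_def b rsq_def) (simp add: curve_lift_def cmod_power2)
  have c1: "?D v $ 1 = v$1 *\<^sub>R d\<Gamma> (x$1)" "?D v $ 2 = of_real (v$2) + \<i> * of_real (v$3)" for v
    by (auto simp: axis_def)
  have "d\<Gamma> (x$1) * cnj (d\<Gamma> (x$1)) = 1"
    using norm_d\<Gamma>[OF x] by (simp flip: complex_norm_square)
  then have 1: "Re (?D v $ 1 * cnj (?D w $ 1)) = v$1 * w$1"
    unfolding c1 by (simp add: scaleR_conv_of_real mult.assoc mult.left_commute[of "d\<Gamma> _"])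
  have th: "eh_theta ?z (?D v) = (?w / 2) *\<^sub>R Complex (v$2 + m1 x * v$1) (v$3 + m2 x * v$1)" for v
    unfolding eh_theta_def c1 b
    using wt_pos[of "x$1"]
    by (simp add: complex_eq_iff curve_lift_def m1_def m2_def dwt_def twist_def) (simp add: field_simps)
  have 2: "Re (eh_theta ?z (?D v) * cnj (eh_theta ?z (?D w))) =
     (?w / 2)\<^sup>2 * ((v$2 + m1 x * v$1) * (w$2 + m1 x * w$1) + (v$3 + m2 x * v$1) * (w$3 + m2 x * w$1))"
    unfolding th by (simp add: power2_eq_square algebra_simps)
  have "gmetric M \<sigma> x v w = eh_metric t ?z (?D v) (?D w)"
    unfolding eh_three_manifold_def Let_def by (simp only: riem_mfd.select_convs D) (simp add: curve_param_lift)
  also have "\<dots> = frame_metric Q m1 m2 x v w"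
    unfolding eh_metric_eq[OF t] 1 2 b Sz frame_metric_def Q_def
    using S_pos[of x] wt_pos[of "x$1"] by (simp add: field_simps power2_eq_square)
  finally show "gmetric M \<sigma> x v w = frame_metric Q m1 m2 x v w" .
qed

lemma d\<Gamma>_shift: "s \<in> J \<Longrightarrow> d\<Gamma> (s + of_int k * L) = d\<Gamma> s"
proof (cases "L = 0")
  case False
  then have J: "J = UNIV" using L by simp
  have "((\<lambda>s. s + of_int k * L) has_vector_derivative 1) (at s)"
    by (auto simp: has_vector_derivative_def intro!: derivative_eq_intros)
  from vector_diff_chain_at[OF this \<Gamma>_deriv]
  have "((\<lambda>s. \<Gamma> (s + of_int k * L)) has_vector_derivative d\<Gamma> (s + of_int k * L)) (at s)"
    using J by (simp add: comp_def)
  moreover have "(\<lambda>s. \<Gamma> (s + of_int k * L)) = \<Gamma>" using \<Gamma>_shift J by auto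
  ultimately show ?thesis using \<Gamma>_deriv[of s] J by (metis UNIV_I vector_derivative_at)
qed simp

lemma shift_nth: "(x + r *\<^sub>R axis 1 1) $ 1 = x$1 + r" "(x + r *\<^sub>R axis 1 1) $ 2 = x$2" "(x + r *\<^sub>R axis 1 1) $ 3 = x$3"
  for x :: "real^3"
  by (auto simp: axis_def)

lemma frame_shift:
  assumes "x$1 \<in> J"
  shows "Q (x + (of_int k * L) *\<^sub>R axis 1 1) = Q x" "m1 (x + (of_int k * L) *\<^sub>R axis 1 1) = m1 x"
    "m2 (x + (of_int k * L) *\<^sub>R axis 1 1) = m2 x" "S (x + (of_int k * L) *\<^sub>R axis 1 1) = S x"
  unfolding Q_def m1_def m2_def S_def rsq_def shift_nth wt_def dwt_def twist_def \<Gamma>_shift[OF assms] d\<Gamma>_shift[OF assms]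
  by (rule refl)+

text \<open>The integer found at \<open>x\<close> is kept: near \<open>x\<close> the translate by
  the same \<open>k\<close> still lies in \<open>chart_dom I'\<close>, and injectivity of
  \<open>\<sigma>\<close> there identifies it with the preimage that \<open>inv_into\<close>
  picks.\<close>

lemma transition_locally_shift:
  assumes I: "open I" "I \<subseteq> J" and I': "open I'" "I' \<subseteq> J" "inj_on \<Gamma> I'"
    and x: "x \<in> chart_dom I" "\<sigma> x \<in> \<sigma> ` chart_dom I'"
  shows "\<exists>W (k::int). open W \<and> x \<in> W \<and>
    (\<forall>y\<in>W. transition_map (chart_dom I') \<sigma> \<sigma> y = y + (of_int k * L) *\<^sub>R axis 1 1)"
proof -
  obtain z where z: "z \<in> chart_dom I'" "\<sigma> x = \<sigma> z" using x(2) by auto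
  then obtain k :: int where k: "z = x + (of_int k * L) *\<^sub>R axis 1 1"
    using \<sigma>_eq_iff[of x z] x(1) I(2) I'(2) by auto
  let ?f = "\<lambda>y::real^3. y + (of_int k * L) *\<^sub>R axis 1 1"
  define W where "W = chart_dom I \<inter> ?f -` chart_dom I'"
  have 1: "open W" unfolding W_def
    by (intro open_Int open_vimage open_chart_dom I(1) I'(1) continuous_intros)
  have 2: "x \<in> W" using x(1) z(1) k by (simp add: W_def)
  have dom: "?f y \<in> chart_dom I'" "y \<in> chart_dom I" "y$1 \<in> J" if "y \<in> W" for y
    using that I(2) by (auto simp: W_def)
  have 4: "transition_map (chart_dom I') \<sigma> \<sigma> y = ?f y" if "y \<in> W" for y
    using inv_into_f_f[OF inj_on_\<sigma>[OF I'(2,3)] dom(1)[OF that]] unfolding \<sigma>_shift[OF dom(3)[OF that]] .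
  show ?thesis using 1 2 4 by blast
qed

lemma smooth_gmetric:
  assumes "I \<subseteq> J" "open I" shows "smooth_on (chart_dom I) (\<lambda>x. gmetric M \<sigma> x v w)"
  unfolding smooth_on_def
proof
  fix k
  have "Ck_on k (chart_dom J) (\<lambda>x. frame_metric Q m1 m2 x v w)"
    unfolding frame_metric_def using Q_pos
    by (intro Ck_intros open_J3 Q_Ck m_Ck) (metis less_irrefl)
  then have "Ck_on k (chart_dom J) (\<lambda>x. gmetric M \<sigma> x v w)"
    by (rule Ck_on_cong[OF open_J3, rotated]) (simp add: gmetric_M)
  then show "Ck_on k (chart_dom I) (\<lambda>x. gmetric M \<sigma> x v w)"
    by (rule Ck_on_subset) (use assms in auto)
qed

lemma inj_on_interval:
  assumes "L > 0" shows "inj_on \<Gamma> {a<..<a + L}"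
proof (rule inj_onI)
  fix x y assume xy: "x \<in> {a<..<a + L}" "y \<in> {a<..<a + L}" "\<Gamma> x = \<Gamma> y"
  then obtain k :: int where k: "y = x + of_int k * L" using period[of x y] L(2)[OF assms] by auto
  then have "\<bar>of_int k * L\<bar> < L" using xy by auto
  then have "\<bar>of_int k\<bar> < (1::real)" using assms by (simp add: abs_mult)
  then have "k = 0" by linarith
  then show "x = y" using k by simp
qed

lemma ex_chart:
  assumes "s \<in> J" obtains I where "open I" "I \<subseteq> J" "inj_on \<Gamma> I" "s \<in> I"
proof (cases "L = 0")
  case True
  then have "inj_on \<Gamma> J" using period by (auto simp: inj_on_def)
  with assms J(1) that show ?thesis by blast
next
  case False
  then have L: "L > 0" "J = UNIV" using L by auto
  have "inj_on \<Gamma> {s - L/2 <..< s + L/2}"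
    using inj_on_interval[OF L(1), of "s - L/2"] by (simp add: add.commute)
  then show ?thesis using that[of "{s - L/2 <..< s + L/2}"] L by auto
qed

lemma oriented_M: "oriented_riemannian_manifold M"
  unfolding oriented_riemannian_manifold_def
proof (intro conjI)
  show "Hausdorff_space (mtop M)" by (rule Hausdorff_M)
  show "\<exists>\<B>. countable \<B> \<and> (\<forall>B\<in>\<B>. openin (mtop M) B) \<and>
          (\<forall>W x. openin (mtop M) W \<and> x \<in> W \<longrightarrow> (\<exists>B\<in>\<B>. x \<in> B \<and> B \<subseteq> W))"
    using second_countable_M unfolding second_countable_def .
  show "(\<Union>(U, \<tau>)\<in>atlas M. \<tau> ` U) = carr M"
  proof (intro equalityI subsetI)
    fix p assume "p \<in> (\<Union>(U, \<tau>)\<in>atlas M. \<tau> ` U)"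
    then show "p \<in> carr M" unfolding carr_M by (auto simp: atlas_M subset_iff intro!: imageI)
  next
    fix p assume "p \<in> carr M"
    then obtain x where x: "x$1 \<in> J" "p = \<sigma> x" unfolding carr_M by auto
    obtain I where "open I" "I \<subseteq> J" "inj_on \<Gamma> I" "x$1 \<in> I" using ex_chart[OF x(1)] .
    then have "(chart_dom I, \<sigma>) \<in> atlas M" "p \<in> \<sigma> ` chart_dom I" using x(2) by (auto simp: atlas_M)
    then show "p \<in> (\<Union>(U, \<tau>)\<in>atlas M. \<tau> ` U)" by blast
  qed
  show "\<forall>(U, \<tau>)\<in>atlas M.
        open U \<and> openin (mtop M) (\<tau> ` U) \<and>
        homeomorphic_map (top_of_set U) (subtopology (mtop M) (\<tau> ` U)) \<tau> \<and>
        (\<forall>x\<in>U. bilinear (gmetric M \<tau> x) \<and>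
           (\<forall>v w. gmetric M \<tau> x v w = gmetric M \<tau> x w v) \<and>
           (\<forall>v. v \<noteq> 0 \<longrightarrow> 0 < gmetric M \<tau> x v v)) \<and>
        (\<forall>v w. smooth_on U (\<lambda>x. gmetric M \<tau> x v w))"
  proof (safe, goal_cases)
    case (1 U \<tau>) then show ?case by (auto simp: atlas_M open_chart_dom)
  next
    case (2 U \<tau>) then show ?case by (auto simp: atlas_M intro!: openin_\<sigma>_image open_chart_dom)
  next
    case (3 U \<tau>) then show ?case using homeomorphic_map_\<sigma> by (auto simp: atlas_M)
  next
    case (4 U \<tau> x) then show ?case by (auto simp: atlas_M gmetric_M bilinear_frame_metric subset_iff)
  next
    case (5 U \<tau> x v w) then show ?case by (auto simp: atlas_M gmetric_M subset_iff frame_metric_def mult.commute)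
  next
    case (6 U \<tau> x v) then show ?case by (auto simp: atlas_M gmetric_M subset_iff frame_metric_pos Q_pos)
  next
    case (7 U \<tau> v w) then show ?case by (auto simp: atlas_M intro!: smooth_gmetric)
  qed
  show "\<forall>(U, \<sigma>')\<in>atlas M. \<forall>(V, \<tau>)\<in>atlas M.
        smooth_on {x \<in> U. \<sigma>' x \<in> \<tau> ` V} (transition_map V \<tau> \<sigma>') \<and>
        (\<forall>x\<in>U. \<sigma>' x \<in> \<tau> ` V \<longrightarrow>
           (let D = frechet_derivative (transition_map V \<tau> \<sigma>') (at x) in
              0 < det (matrix D) \<and>
              (\<forall>v w. gmetric M \<sigma>' x v w =
                 gmetric M \<tau> (transition_map V \<tau> \<sigma>' x) (D v) (D w))))"
  proof (clarsimp simp only: atlas_M, intro conjI)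
    fix I I' assume I: "open I" "I \<subseteq> J" and I': "open I'" "I' \<subseteq> J" "inj_on \<Gamma> I'"
    show "smooth_on {x \<in> chart_dom I. \<sigma> x \<in> \<sigma> ` chart_dom I'} (transition_map (chart_dom I') \<sigma> \<sigma>)"
      unfolding smooth_on_def
    proof (intro allI Ck_on_local)
      fix k x assume "x \<in> {x \<in> chart_dom I. \<sigma> x \<in> \<sigma> ` chart_dom I'}"
      then have x: "x \<in> chart_dom I" "\<sigma> x \<in> \<sigma> ` chart_dom I'" by auto
      obtain W and j :: int where W: "open W" "x \<in> W" "\<And>y. y \<in> W \<Longrightarrow> transition_map (chart_dom I') \<sigma> \<sigma> y = y + (of_int j * L) *\<^sub>R axis 1 1"
        using transition_locally_shift[OF I I' x] by blast
      have "Ck_on k W (\<lambda>y::real^3. y + (of_int j * L) *\<^sub>R axis 1 1)"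
        by (intro Ck_on_add W(1) Ck_on_const Ck_on_bounded_linear bounded_linear_ident)
      then have "Ck_on k W (transition_map (chart_dom I') \<sigma> \<sigma>)"
        by (rule Ck_on_cong[OF W(1), rotated]) (simp add: W(3))
      with W(1,2) show "\<exists>V. open V \<and> x \<in> V \<and> Ck_on k V (transition_map (chart_dom I') \<sigma> \<sigma>)" by blast
    qed
    show "\<forall>x\<in>chart_dom I. \<sigma> x \<in> \<sigma> ` chart_dom I' \<longrightarrow>
           (let D = frechet_derivative (transition_map (chart_dom I') \<sigma> \<sigma>) (at x) in
              0 < det (matrix D) \<and>
              (\<forall>v w. gmetric M \<sigma> x v w =
                 gmetric M \<sigma> (transition_map (chart_dom I') \<sigma> \<sigma> x) (D v) (D w)))"
    proof (intro ballI impI)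
      fix x assume x: "x \<in> chart_dom I" "\<sigma> x \<in> \<sigma> ` chart_dom I'"
      obtain W and j :: int where W: "open W" "x \<in> W" "\<And>y. y \<in> W \<Longrightarrow> transition_map (chart_dom I') \<sigma> \<sigma> y = y + (of_int j * L) *\<^sub>R axis 1 1"
        using transition_locally_shift[OF I I' x] by blast
      \<comment> \<open>Locally the transition is a translation by periods: its derivative is the
        identity, of determinant 1, and the frame coefficients are periodic, so the metric is
        preserved.\<close>
      have "((\<lambda>y::real^3. y + (of_int j * L) *\<^sub>R axis 1 1) has_derivative (\<lambda>v. v)) (at x)"
        by (auto intro!: derivative_eq_intros)
      then have "(transition_map (chart_dom I') \<sigma> \<sigma> has_derivative (\<lambda>v. v)) (at x)"
        by (rule has_derivative_transform_within_open[OF _ W(1,2)]) (simp add: W(3))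
      then have D: "frechet_derivative (transition_map (chart_dom I') \<sigma> \<sigma>) (at x) = (\<lambda>v. v)"
        by (metis frechet_derivative_at)
      have "matrix (\<lambda>v::real^3. v) = mat 1" using matrix_id_mat_1 by (simp add: id_def)
      moreover have "x$1 \<in> J" "x$1 + of_int j * L \<in> J" using x(1) I(2) shift_in_J by auto
      ultimately show "let D = frechet_derivative (transition_map (chart_dom I') \<sigma> \<sigma>) (at x) in
              0 < det (matrix D) \<and>
              (\<forall>v w. gmetric M \<sigma> x v w =
                 gmetric M \<sigma> (transition_map (chart_dom I') \<sigma> \<sigma> x) (D v) (D w))"
        unfolding D Let_def W(3)[OF W(2)]
        by (simp add: gmetric_M shift_nth frame_metric_def frame_shift)
    qed
  qed
qed

end

section \<open>Lipschitz functions and lengths of paths\<close>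

text \<open>Below \<open>s\<close> is the speed of a path, defined by a choice of charts. It enters only through the
  monotonicity of the integral, and the derivative of \<open>g\<close> is measurable as a limit of difference
  quotients.\<close>

lemma path_growth_le_nn_integral:
  fixes g :: "real \<Rightarrow> real"
  assumes g: "continuous_on {0..1} g" and F: "finite F" and B: "B > 0"
    and d: "\<And>r. r \<in> {0<..<1} - F \<Longrightarrow> (g has_real_derivative g' r) (at r)"
    and b: "\<And>r. r \<in> {0<..<1} - F \<Longrightarrow> \<bar>g' r\<bar> \<le> B * s r"
  shows "ennreal \<bar>g 1 - g 0\<bar> \<le> ennreal B * (\<integral>\<^sup>+r\<in>{0<..<1}. ennreal (s r) \<partial>lborel)"
proof -
  define A where "A = {0<..<1} - F"
  have A: "open A" unfolding A_def using F by (intro open_Diff finite_imp_closed) auto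
  define h where "h r = indicator A r * g' r" for r
  \<comment> \<open>\<open>g\<close> is continued by its end values, which makes the difference
    quotients continuous on the whole line.\<close>
  define ge where "ge r = g (max 0 (min 1 r))" for r
  have ge: "continuous_on UNIV ge" unfolding ge_def
    by (intro continuous_on_compose2[OF g] continuous_intros) auto
  define q where "q n r = indicator A r * ((ge (r + 1 / real (Suc n)) - ge r) / (1 / real (Suc n)))" for n r
  have h_meas: "h \<in> borel_measurable borel"
  proof (rule borel_measurable_LIMSEQ_real)
    show "q n \<in> borel_measurable borel" for n
    proof -
      have "continuous_on UNIV (\<lambda>r. (ge (r + 1 / real (Suc n)) - ge r) / (1 / real (Suc n)))"
        by (intro continuous_intros continuous_on_compose2[OF ge]) auto
      then have "(\<lambda>r. (ge (r + 1 / real (Suc n)) - ge r) / (1 / real (Suc n))) \<in> borel_measurable borel"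
        by (rule borel_measurable_continuous_onI)
      then show ?thesis unfolding q_def using A by (intro borel_measurable_times borel_measurable_indicator) auto
    qed
    show "(\<lambda>n. q n r) \<longlonglongrightarrow> h r" for r
    proof (cases "r \<in> A")
      case True
      then have r: "0 < r" "r < 1" by (auto simp: A_def)
      have "(ge has_real_derivative g' r) (at r)"
        by (rule DERIV_cong_ev[THEN iffD1, OF refl _ refl d])
          (use True r in \<open>auto simp: A_def ge_def eventually_nhds intro!: exI[of _ "{0<..<1}"]\<close>)
      then have "((\<lambda>k. (ge (r + k) - ge r) / k) \<longlongrightarrow> g' r) (at 0)" by (simp add: DERIV_def)
      moreover have "filterlim (\<lambda>n. 1 / real (Suc n)) (at 0) sequentially"
        unfolding filterlim_at using LIMSEQ_inverse_real_of_nat by (auto simp: inverse_eq_divide)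
      ultimately have "(\<lambda>n. (ge (r + 1 / real (Suc n)) - ge r) / (1 / real (Suc n))) \<longlonglongrightarrow> g' r"
        by (rule filterlim_compose)
      then show ?thesis unfolding q_def h_def by (intro tendsto_intros)
    qed (simp add: q_def h_def)
  qed
  \<comment> \<open>\<open>B\<close> is put on the side of \<open>h\<close>, since a constant can be
    pulled out of the integral only for a function known to be measurable.\<close>
  have hs: "ennreal (\<bar>h r\<bar> / B) \<le> ennreal (s r) * indicator {0<..<1} r" for r
  proof (cases "r \<in> A")
    case True
    then have "\<bar>h r\<bar> / B \<le> s r" using b[of r] B by (simp add: h_def A_def divide_le_eq mult.commute)
    then show ?thesis using True by (auto simp: A_def intro: ennreal_leI)
  qed (simp add: h_def)
  have "(\<integral>\<^sup>+r. ennreal \<bar>h r\<bar> \<partial>lborel) = (\<integral>\<^sup>+r. ennreal B * ennreal (\<bar>h r\<bar> / B) \<partial>lborel)"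
    using B by (intro nn_integral_cong) (simp add: ennreal_mult'[symmetric])
  also have "\<dots> = ennreal B * (\<integral>\<^sup>+r. ennreal (\<bar>h r\<bar> / B) \<partial>lborel)"
    using h_meas by (intro nn_integral_cmult) auto
  also have "\<dots> \<le> ennreal B * (\<integral>\<^sup>+r\<in>{0<..<1}. ennreal (s r) \<partial>lborel)"
    by (intro mult_left_mono nn_integral_mono hs) auto
  finally have le: "(\<integral>\<^sup>+r. ennreal \<bar>h r\<bar> \<partial>lborel) \<le> ennreal B * (\<integral>\<^sup>+r\<in>{0<..<1}. ennreal (s r) \<partial>lborel)" .
  \<comment> \<open>If the integral of |h| is infinite, so is the right-hand side. Otherwise
    \<open>h\<close> is integrable, and the fundamental theorem of calculus applies off a finite
    set.\<close>
  show ?thesis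
  proof (cases "(\<integral>\<^sup>+r. ennreal \<bar>h r\<bar> \<partial>lborel) < \<infinity>")
    case True
    then have int: "integrable lborel h" using h_meas by (intro integrableI_bounded) auto
    have "(g' has_integral (g 1 - g 0)) {0..1}"
      using d by (intro fundamental_theorem_of_calculus_interior_strong[OF F _ _ g])
        (auto simp: has_real_derivative_iff_has_vector_derivative)
    then have "(h has_integral (g 1 - g 0)) {0..1}"
      by (rule has_integral_spike_finite[of "F \<union> {0, 1}", rotated -1]) (use F in \<open>auto simp: h_def A_def\<close>)
    then have "(h has_integral (g 1 - g 0)) UNIV"
      by (rule has_integral_on_superset) (auto simp: h_def A_def)
    then have "g 1 - g 0 = (\<integral>r. h r \<partial>lborel)"
      using has_integral_integral_lborel[OF int] has_integral_unique by blast
    then have "\<bar>g 1 - g 0\<bar> \<le> (\<integral>r. \<bar>h r\<bar> \<partial>lborel)" by simp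
    then have "ennreal \<bar>g 1 - g 0\<bar> \<le> (\<integral>\<^sup>+r. ennreal \<bar>h r\<bar> \<partial>lborel)"
      using int by (subst nn_integral_eq_integral) (auto intro: ennreal_leI)
    with le show ?thesis by (rule order_trans[rotated])
  next
    case False
    then have "ennreal B * (\<integral>\<^sup>+r\<in>{0<..<1}. ennreal (s r) \<partial>lborel) = \<infinity>"
      using le by (metis infinity_ennreal_def top.not_eq_extremum top_unique)
    then show ?thesis by simp
  qed
qed

context eh_curve begin

text \<open>\<open>\<sigma>\<close> is open and onto \<open>carr M\<close>, so openness of a
  preimage can be tested on \<open>chart_dom J\<close>.\<close>

lemma continuous_map_M:
  assumes F: "continuous_on (chart_dom J) F" "\<And>x. x$1 \<in> J \<Longrightarrow> f (\<sigma> x) = F x"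
  shows "continuous_map (mtop M) euclideanreal f"
  unfolding continuous_map_def
proof (intro conjI allI impI)
  fix T :: "real set" assume "openin euclideanreal T"
  then have "open (chart_dom J \<inter> F -` T)" using F(1) open_J3 by (intro continuous_open_preimage) auto
  then have "openin (mtop M) (\<sigma> ` (chart_dom J \<inter> F -` T))" by (rule openin_\<sigma>_image) auto
  moreover have "{p \<in> carr M. f p \<in> T} = \<sigma> ` (chart_dom J \<inter> F -` T)"
    unfolding carr_M using F(2) by auto
  ultimately show "openin (mtop M) {p \<in> carr M. f p \<in> T}" by simp
qed simp

text \<open>\<open>speed\<close> computes in a chart picked by \<open>SOME\<close>. Whichever it is,
  it is a restriction of \<open>\<sigma>\<close>, so the formula for the metric is
  available.\<close>

lemma speed_chart:
  assumes "p \<in> carr M"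
  obtains I where "(SOME (U, \<tau>). (U, \<tau>) \<in> atlas M \<and> p \<in> \<tau> ` U) = (chart_dom I, \<sigma>)"
    "open I" "I \<subseteq> J" "inj_on \<Gamma> I" "p \<in> \<sigma> ` chart_dom I"
proof -
  let ?P = "\<lambda>(U, \<tau>). (U, \<tau>) \<in> atlas M \<and> p \<in> \<tau> ` U"
  obtain x where x: "x$1 \<in> J" "p = \<sigma> x" using assms unfolding carr_M by auto
  obtain I where "open I" "I \<subseteq> J" "inj_on \<Gamma> I" "x$1 \<in> I" using ex_chart[OF x(1)] .
  then have "?P (chart_dom I, \<sigma>)" using x(2) by (auto simp: atlas_M)
  then have "?P (Eps ?P)" by (rule someI)
  moreover obtain U \<tau> where "Eps ?P = (U, \<tau>)" by fastforce
  ultimately show ?thesis using that by (auto simp: atlas_M)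
qed

text \<open>Off finitely many parameters the path is followed in the chart that \<open>speed\<close>
  picks. There \<open>F\<close> changes at a rate of at most the gradient norm times the speed, by
  Cauchy--Schwarz.\<close>

lemma path_growth_le:
  assumes F: "Ck_on 1 (chart_dom J) F" and f: "\<And>x. x$1 \<in> J \<Longrightarrow> f (\<sigma> x) = F x"
    and B: "B > 0" "\<And>x. x$1 \<in> J \<Longrightarrow> grad_norm_sq Q m1 m2 F x \<le> B\<^sup>2"
    and c: "pw_C1_path M c"
  shows "ennreal \<bar>f (c 1) - f (c 0)\<bar> \<le> ennreal B * path_len M c"
proof -
  have fc: "continuous_map (mtop M) euclideanreal f"
    using continuous_map_M[OF Ck_on_imp_continuous_on[OF F] f] .
  have cc: "continuous_map (top_of_set {0..1}) (mtop M) c"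
    using c by (simp add: pw_C1_path_def pathin_def)
  obtain E where E: "finite E" "\<And>U \<tau>. (U, \<tau>) \<in> atlas M \<Longrightarrow>
       (inv_into U \<tau> \<circ> c) C1_differentiable_on {s \<in> {0<..<1} - E. c s \<in> \<tau> ` U}"
    using c unfolding pw_C1_path_def by fast
  define g where "g = f \<circ> c"
  have g: "continuous_on {0..1} g"
    using continuous_map_compose[OF cc fc] by (simp add: g_def)
  have key: "\<exists>d. (g has_real_derivative d) (at r) \<and> \<bar>d\<bar> \<le> B * speed M c r" if r: "r \<in> {0<..<1} - E" for r
  proof -
    have "c r \<in> carr M" using cc r by (auto simp: continuous_map_def)
    then obtain I where I: "(SOME (U, \<tau>). (U, \<tau>) \<in> atlas M \<and> c r \<in> \<tau> ` U) = (chart_dom I, \<sigma>)"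
      "open I" "I \<subseteq> J" "inj_on \<Gamma> I" "c r \<in> \<sigma> ` chart_dom I"
      by (rule speed_chart)
    define y where "y = inv_into (chart_dom I) \<sigma> \<circ> c"
    define v where "v = vector_derivative y (at r)"
    have "(chart_dom I, \<sigma>) \<in> atlas M" using I by (auto simp: atlas_M)
    from E(2)[OF this] have yd: "(y has_vector_derivative v) (at r)"
      using r I(5) unfolding C1_differentiable_on_def y_def[symmetric] v_def
      by (auto simp: vector_derivative_at)
    have "openin (top_of_set {0..1}) {s \<in> {0..1}. c s \<in> \<sigma> ` chart_dom I}"
      using openin_continuous_map_preimage[OF cc openin_\<sigma>_image[OF open_chart_dom[OF I(2)]]] I(3) by auto
    then obtain T where T: "open T" "{s \<in> {0..1}. c s \<in> \<sigma> ` chart_dom I} = {0..1} \<inter> T"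
      by (auto simp: openin_open)
    \<comment> \<open>Only while the path stays in the chart is \<open>inv_into\<close> a true
      inverse; openness of the chart image keeps it there near \<open>r\<close>.\<close>
    define W where "W = {0<..<1} \<inter> T"
    have W: "open W" "r \<in> W" using T r I(5) by (auto simp: W_def)
    have yU: "y s \<in> chart_dom I" "\<sigma> (y s) = c s" if "s \<in> W" for s
    proof -
      have "s \<in> {0..1} \<inter> T" using that by (auto simp: W_def)
      then have "c s \<in> \<sigma> ` chart_dom I" unfolding T(2)[symmetric] by simp
      then show "y s \<in> chart_dom I" "\<sigma> (y s) = c s"
        unfolding y_def comp_def by (rule inv_into_into, rule f_inv_into_f)
    qed
    have gF: "F (y s) = g s" if "s \<in> W" for s
      using yU[OF that] f[of "y s"] I(3) by (auto simp: g_def)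
    have yr: "y r $ 1 \<in> J" using yU(1)[OF W(2)] I(3) by auto
    have Fd: "(F has_derivative frechet_derivative F (at (y r))) (at (y r))"
      using F yr Ck_on_has_derivative[of 0 "chart_dom J" F] by simp
    have "((\<lambda>s. F (y s)) has_derivative (\<lambda>h. frechet_derivative F (at (y r)) (h *\<^sub>R v))) (at r)"
      by (rule has_derivative_compose[OF yd[unfolded has_vector_derivative_def] Fd])
    then have "((\<lambda>s. F (y s)) has_real_derivative frechet_derivative F (at (y r)) v) (at r)"
      unfolding has_field_derivative_def
      by (rule has_derivative_eq_rhs) (simp add: fun_eq_iff linear_scale[OF has_derivative_linear[OF Fd]])
    then have gd: "(g has_real_derivative frechet_derivative F (at (y r)) v) (at r)"
      unfolding has_field_derivative_def
      by (rule has_derivative_transform_within_open[OF _ W]) (rule gF)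
    have pos: "frame_metric Q m1 m2 (y r) v v \<ge> 0"
    proof (cases "v = 0")
      case False
      then show ?thesis using frame_metric_pos[where Q = Q and x = "y r" and v = v] Q_pos by (auto simp: less_imp_le)
    qed (simp add: frame_metric_def)
    have sp: "speed M c r = sqrt (frame_metric Q m1 m2 (y r) v v)"
      using gmetric_M[OF yr] unfolding speed_def I(1) Let_def v_def by (simp add: y_def)
    have "(frechet_derivative F (at (y r)) v)\<^sup>2 \<le> grad_norm_sq Q m1 m2 F (y r) * frame_metric Q m1 m2 (y r) v v"
      by (rule frechet_derivative_sq_le[OF Q_pos]) (use Fd in \<open>auto simp: differentiable_def\<close>)
    also have "\<dots> \<le> B\<^sup>2 * frame_metric Q m1 m2 (y r) v v"
      using B(2)[OF yr] pos by (rule mult_right_mono)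
    finally have "\<bar>frechet_derivative F (at (y r)) v\<bar>\<^sup>2 \<le> (B * sqrt (frame_metric Q m1 m2 (y r) v v))\<^sup>2"
      using pos by (simp add: power_mult_distrib)
    then have "\<bar>frechet_derivative F (at (y r)) v\<bar> \<le> B * sqrt (frame_metric Q m1 m2 (y r) v v)"
      by (rule power2_le_imp_le) (use B(1) pos in auto)
    then show ?thesis using gd sp by auto
  qed
  have "ennreal \<bar>g 1 - g 0\<bar> \<le> ennreal B * (\<integral>\<^sup>+r\<in>{0<..<1}. ennreal (speed M c r) \<partial>lborel)"
    by (rule path_growth_le_nn_integral[OF g E(1) B(1), of "\<lambda>r. SOME d. (g has_real_derivative d) (at r) \<and> \<bar>d\<bar> \<le> B * speed M c r"])
      (use someI_ex[OF key] in blast)+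
  then show ?thesis by (simp add: g_def path_len_def)
qed

text \<open>\<open>B\<close> is divided out first, so that the estimate for single paths is a lower
  bound of the infimum itself; without any path that infimum is infinite.\<close>

lemma riem_dist_Lipschitz:
  assumes F: "Ck_on 1 (chart_dom J) F" and f: "\<And>x. x$1 \<in> J \<Longrightarrow> f (\<sigma> x) = F x"
    and B: "B > 0" "\<And>x. x$1 \<in> J \<Longrightarrow> grad_norm_sq Q m1 m2 F x \<le> B\<^sup>2"
  shows "ennreal \<bar>f p - f q\<bar> \<le> ennreal B * riem_dist M p q"
proof -
  have inv: "ennreal (1 / B) * ennreal B = 1" using B(1) by (simp add: ennreal_mult'[symmetric])
  have "ennreal (1 / B) * ennreal \<bar>f p - f q\<bar> \<le> riem_dist M p q"
    unfolding riem_dist_def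
  proof (rule INF_greatest)
    fix c assume "c \<in> {c. pw_C1_path M c \<and> c 0 = p \<and> c 1 = q}"
    then have "ennreal \<bar>f p - f q\<bar> \<le> ennreal B * path_len M c"
      using path_growth_le[OF F f B, of c] by (simp add: abs_minus_commute)
    from mult_left_mono[OF this, of "ennreal (1 / B)"]
    show "ennreal (1 / B) * ennreal \<bar>f p - f q\<bar> \<le> path_len M c"
      by (simp add: mult.assoc[symmetric] inv)
  qed
  from mult_left_mono[OF this, of "ennreal B"]
  show ?thesis by (simp add: mult.assoc[symmetric] inv mult.commute[of "ennreal B" "ennreal (1 / B)"])
qed

text \<open>On the zero section \<open>m1\<close> and \<open>m2\<close> vanish and \<open>S\<close>
  equals \<open>t\<^sup>2\<close>. Hence the straight path in the parameter has length sqrt 2 |t|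
  times the absolute value of the integral of 1 / wt.\<close>

lemma riem_dist_zero_section:
  assumes L0: "L = 0" and ab: "a \<in> J" "b \<in> J"
    and l: "\<And>s. s \<in> J \<Longrightarrow> (l has_real_derivative 1 / wt s) (at s)"
  shows "riem_dist M (\<sigma> (vector [a, 0, 0])) (\<sigma> (vector [b, 0, 0])) \<le> ennreal (sqrt 2 * \<bar>t\<bar> * \<bar>l b - l a\<bar>)"
proof -
  define y where "y r = (vector [a + r * (b - a), 0, 0] :: real^3)" for r
  define c where "c = \<sigma> \<circ> y"
  have y_axis: "y = (\<lambda>r. axis 1 (a + r * (b - a)))"
    by (auto simp: y_def fun_eq_iff vec_eq_iff forall_3 axis_def)
  have J': "is_interval J" using J(2) is_interval_connected_1 by blast
  have inJ: "a + r * (b - a) \<in> J" if "r \<in> {0..1}" for r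
  proof -
    have "convex J" using J(2) connected_convex_1 by blast
    then have "(1 - r) *\<^sub>R a + r *\<^sub>R b \<in> J" using ab that by (intro convexD) auto
    then show ?thesis by (simp add: algebra_simps)
  qed
  have yd: "(y has_vector_derivative axis 1 (b - a)) (at r)" for r
    unfolding y_axis
    by (rule bounded_linear.has_vector_derivative[OF bounded_linear_axis])
      (auto intro!: derivative_eq_intros simp: has_real_derivative_iff_has_vector_derivative[symmetric])
  have yc: "continuous_on UNIV y" unfolding y_axis by (intro continuous_intros)
  have path: "pathin (mtop M) c"
  proof -
    have "continuous_map (top_of_set {0..1}) (top_of_set (chart_dom J)) y"
      using yc inJ by (auto simp: continuous_map_in_subtopology y_def intro: continuous_on_subset)
    then show ?thesis unfolding pathin_def c_def
      using continuous_map_compose[OF _ continuous_map_\<sigma>[OF order_refl]] by blast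
  qed
  have \<Gamma>inj: "\<sigma> x = \<sigma> z \<longleftrightarrow> x = z" if "x$1 \<in> J" "z$1 \<in> J" for x z
    using \<sigma>_eq_iff[OF that] L0 by auto
  have inv: "inv_into (chart_dom I) \<sigma> (c r) = y r" "a + r * (b - a) \<in> I"
    if that: "I \<subseteq> J" "inj_on \<Gamma> I" "c r \<in> \<sigma> ` chart_dom I" "r \<in> {0..1}" for I r
  proof -
    from that(3) obtain z where z: "z \<in> chart_dom I" "c r = \<sigma> z" by auto
    then have "z = y r" using \<Gamma>inj[of "y r" z] inJ[OF that(4)] that(1) by (auto simp: c_def y_def)
    then show "inv_into (chart_dom I) \<sigma> (c r) = y r" "a + r * (b - a) \<in> I"
      using z inv_into_f_f[OF inj_on_\<sigma>[OF that(1,2)] z(1)] by (auto simp: y_def)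
  qed
  have invd: "((inv_into (chart_dom I) \<sigma> \<circ> c) has_vector_derivative axis 1 (b - a)) (at r)"
    if I: "open I" "I \<subseteq> J" "inj_on \<Gamma> I" "c r \<in> \<sigma> ` chart_dom I" "r \<in> {0<..<1}" for I r
  proof -
    define W where "W = {0<..<1} \<inter> (\<lambda>r. a + r * (b - a)) -` I"
    have W: "open W" "r \<in> W"
      using I inv(2)[OF I(2,3,4)] unfolding W_def by (auto intro!: open_Int open_vimage continuous_intros)
    have "y s = (inv_into (chart_dom I) \<sigma> \<circ> c) s" if "s \<in> W" for s
    proof -
      have "y s \<in> chart_dom I" using that by (simp add: W_def y_def)
      then show ?thesis using inv_into_f_f[OF inj_on_\<sigma>[OF I(2,3)]] by (simp add: c_def)
    qed
    from has_derivative_transform_within_open[OF yd[unfolded has_vector_derivative_def] W this]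
    show ?thesis unfolding has_vector_derivative_def .
  qed
  have pw: "pw_C1_path M c"
    unfolding pw_C1_path_def
  proof (intro conjI path exI[of _ "{}"])
    show "\<forall>(U, \<tau>)\<in>atlas M. (inv_into U \<tau> \<circ> c) C1_differentiable_on {s \<in> {0<..<1} - {}. c s \<in> \<tau> ` U}"
      unfolding C1_differentiable_on_def using invd
      by (auto simp: atlas_M intro!: exI[of _ "\<lambda>_. axis 1 (b - a)"])
  qed simp
  have sp: "speed M c r = \<bar>b - a\<bar> * (sqrt 2 * \<bar>t\<bar> / wt (a + r * (b - a)))" if r: "r \<in> {0<..<1}" for r
  proof -
    have "c r \<in> carr M" unfolding carr_M c_def using inJ[of r] r by (auto simp: y_def)
    then obtain I where I: "(SOME (U, \<tau>). (U, \<tau>) \<in> atlas M \<and> c r \<in> \<tau> ` U) = (chart_dom I, \<sigma>)"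
      "open I" "I \<subseteq> J" "inj_on \<Gamma> I" "c r \<in> \<sigma> ` chart_dom I"
      by (rule speed_chart)
    have v: "vector_derivative (inv_into (chart_dom I) \<sigma> \<circ> c) (at r) = axis 1 (b - a)"
      using invd[OF I(2-5) r] by (rule vector_derivative_at)
    have yr: "inv_into (chart_dom I) \<sigma> (c r) = y r" using inv(1)[OF I(3-5)] r by auto
    have "y r $ 1 \<in> J" using inJ[of r] r by (simp add: y_def)
    then have "speed M c r = sqrt (frame_metric Q m1 m2 (y r) (axis 1 (b - a)) (axis 1 (b - a)))"
      unfolding speed_def I(1) by (simp add: v yr gmetric_M Let_def)
    also have "frame_metric Q m1 m2 (y r) (axis 1 (b - a)) (axis 1 (b - a)) = (\<bar>b - a\<bar> * (sqrt 2 * \<bar>t\<bar> / wt (a + r * (b - a))))\<^sup>2"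
    proof -
      have "sqrt (t ^ 4) = t\<^sup>2" by (simp add: real_sqrt_unique)
      then have "Q (y r) = (wt (a + r * (b - a)))\<^sup>2 / (2 * t\<^sup>2)" by (simp add: Q_def S_def rsq_def y_def)
      moreover have "m1 (y r) = 0" "m2 (y r) = 0" by (auto simp: m1_def m2_def y_def)
      ultimately have "frame_metric Q m1 m2 (y r) (axis 1 (b - a)) (axis 1 (b - a)) =
          (b - a)\<^sup>2 / ((wt (a + r * (b - a)))\<^sup>2 / (2 * t\<^sup>2))"
        by (simp add: frame_metric_def axis_def power2_eq_square)
      also have "\<dots> = (b - a)\<^sup>2 * (2 * t\<^sup>2 / (wt (a + r * (b - a)))\<^sup>2)" by simp
      finally show ?thesis by (simp add: power_mult_distrib power_divide)
    qed
    also have "sqrt \<dots> = \<bar>b - a\<bar> * (sqrt 2 * \<bar>t\<bar> / wt (a + r * (b - a)))"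
      using wt_pos[of "a + r * (b - a)"] by simp
    finally show ?thesis .
  qed
  define f where "f r = \<bar>b - a\<bar> * (sqrt 2 * \<bar>t\<bar> / wt (a + r * (b - a)))" for r
  have f0: "f r \<ge> 0" for r using wt_pos[of "a + r * (b - a)"] by (simp add: f_def)
  \<comment> \<open>The sign lets one antiderivative serve both orders of \<open>a\<close> and
    \<open>b\<close>.\<close>
  define G where "G r = sgn (b - a) * (sqrt 2 * \<bar>t\<bar> * l (a + r * (b - a)))" for r
  have "(f has_integral (G 1 - G 0)) {0..1}"
  proof (rule fundamental_theorem_of_calculus)
    fix r :: real assume "r \<in> {0..1}"
    have "((\<lambda>r. l (a + r * (b - a))) has_real_derivative 1 / wt (a + r * (b - a)) * (b - a)) (at r)"
    proof (rule DERIV_chain2[where f = l and g = "\<lambda>r. a + r * (b - a)"])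
      show "(l has_real_derivative 1 / wt (a + r * (b - a))) (at (a + r * (b - a)))"
        by (rule l[OF inJ[OF \<open>r \<in> {0..1}\<close>]])
    qed (auto intro!: derivative_eq_intros)
    then have "(G has_real_derivative sgn (b - a) * (sqrt 2 * \<bar>t\<bar> * (1 / wt (a + r * (b - a)) * (b - a)))) (at r)"
      unfolding G_def by (intro DERIV_cmult)
    also have "sgn (b - a) * (sqrt 2 * \<bar>t\<bar> * (1 / wt (a + r * (b - a)) * (b - a))) = f r"
      by (simp add: f_def sgn_real_def)
    finally show "(G has_vector_derivative f r) (at r within {0..1})"
      by (simp add: has_real_derivative_iff_has_vector_derivative[symmetric] has_field_derivative_at_within)
  qed simp
  then have I: "(\<integral>\<^sup>+r. ennreal (indicator {0..1} r * f r) \<partial>lborel) = ennreal (G 1 - G 0)"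
    using f0 by (intro nn_integral_has_integral_lebesgue) auto
  have "path_len M c \<le> (\<integral>\<^sup>+r. ennreal (indicator {0..1} r * f r) \<partial>lborel)"
    unfolding path_len_def
    by (intro nn_integral_mono) (auto simp: indicator_def sp f_def)
  also have "\<dots> = ennreal (G 1 - G 0)" by (rule I)
  also have "\<dots> \<le> ennreal (sqrt 2 * \<bar>t\<bar> * \<bar>l b - l a\<bar>)"
  proof (rule ennreal_leI)
    have "G 1 - G 0 = sgn (b - a) * (sqrt 2 * \<bar>t\<bar> * (l b - l a))" by (simp add: G_def algebra_simps)
    also have "\<dots> \<le> \<bar>sgn (b - a)\<bar> * (sqrt 2 * \<bar>t\<bar> * \<bar>l b - l a\<bar>)"
      using abs_ge_self[of "sgn (b - a) * (sqrt 2 * \<bar>t\<bar> * (l b - l a))"] by (simp add: abs_mult)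
    also have "\<dots> \<le> 1 * (sqrt 2 * \<bar>t\<bar> * \<bar>l b - l a\<bar>)"
      by (intro mult_right_mono) (auto simp: abs_sgn_eq)
    finally show "G 1 - G 0 \<le> sqrt 2 * \<bar>t\<bar> * \<bar>l b - l a\<bar>" by simp
  qed
  finally have "path_len M c \<le> ennreal (sqrt 2 * \<bar>t\<bar> * \<bar>l b - l a\<bar>)" .
  moreover have "c \<in> {c. pw_C1_path M c \<and> c 0 = \<sigma> (vector [a, 0, 0]) \<and> c 1 = \<sigma> (vector [b, 0, 0])}"
    using pw by (simp add: c_def y_def)
  ultimately show ?thesis unfolding riem_dist_def by (meson INF_lower2)
qed

end

section \<open>The exhaustion function\<close>

lemma DERIV_imp_differentiable: "(f has_real_derivative d) (at x) \<Longrightarrow> f differentiable (at x)"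
  by (auto simp: has_field_derivative_def differentiable_def)

lemma nth_differentiable: "(\<lambda>y::real^3. y $ i) differentiable (at x)"
  by (rule bounded_linear_imp_differentiable[OF bounded_linear_vec_nth])

lemma partial_nth: "partial i (\<lambda>y. y $ j) x = (if i = j then 1 else 0)"
  using partial_eqI[OF bounded_linear_imp_has_derivative[OF bounded_linear_vec_nth], of i j x]
  by (simp add: axis_def)

lemma partial_of_nth:
  assumes "(h has_real_derivative d) (at (x$1))"
  shows "partial i (\<lambda>y. h (y$1)) x = (if i = 1 then d else 0)" "(\<lambda>y. h (y$1)) differentiable (at x)"
proof -
  show "partial i (\<lambda>y. h (y$1)) x = (if i = 1 then d else 0)"
    using partial_chain[OF nth_differentiable assms, of i] by (simp add: partial_nth)
  show "(\<lambda>y. h (y$1)) differentiable (at x)"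
    using differentiable_chain_at[OF nth_differentiable[of 1 x] DERIV_imp_differentiable[OF assms]]
    by (simp add: comp_def)
qed

definition box3 :: "real \<Rightarrow> real \<Rightarrow> real \<Rightarrow> (real^3) set" where
  "box3 a b R = cbox (vector [a, -R, -R]) (vector [b, R, R])"

lemma box3: "x \<in> box3 a b R \<longleftrightarrow> a \<le> x$1 \<and> x$1 \<le> b \<and> \<bar>x$2\<bar> \<le> R \<and> \<bar>x$3\<bar> \<le> R"
  by (auto simp: box3_def mem_box_cart forall_3)

lemma compact_box3: "compact (box3 a b R)" by (simp add: box3_def)

text \<open>With dl = ds / wt the bound says that |dc/dl| is at most 1, and \<open>c_convex\<close>
  that dc/dl = c' wt is nondecreasing. Properness is understood modulo the period, so that a
  constant qualifies for a closed curve.\<close>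

locale eh_exhaustion = eh_curve +
  fixes c c' c'' :: "real \<Rightarrow> real"
  assumes c_smooth: "smooth_on J c"
    and c_deriv: "\<And>s. s \<in> J \<Longrightarrow> (c has_real_derivative c' s) (at s)"
      "\<And>s. s \<in> J \<Longrightarrow> (c' has_real_derivative c'' s) (at s)"
    and c_bound: "\<And>s. s \<in> J \<Longrightarrow> \<bar>c' s\<bar> * wt s \<le> 1"
    and c_convex: "\<And>s. s \<in> J \<Longrightarrow> 0 \<le> c'' s * wt s + c' s * dwt s"
    and c_nonneg: "\<And>s. s \<in> J \<Longrightarrow> 0 \<le> c s"
    and c_period: "\<And>s k. s \<in> J \<Longrightarrow> c (s + of_int k * L) = c s"
    and c_proper: "\<And>\<tau>. \<exists>a b. {a..b} \<subseteq> J \<and> (\<forall>s\<in>J. c s \<le> \<tau> \<longrightarrow> (\<exists>k::int. s + of_int k * L \<in> {a..b}))"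
begin

definition \<phi>c :: "real^3 \<Rightarrow> real" where "\<phi>c x = sqrt (S x) + c (x$1)"
definition \<phi> :: "eh_point \<Rightarrow> real" where "\<phi> p = \<phi>c (SOME x. x$1 \<in> J \<and> \<sigma> x = p)"

text \<open>Two preimages of a point differ by a multiple of the period, and both summands of
  \<open>\<phi>c\<close> are periodic, so the choice in \<open>\<phi>\<close> does not
  matter.\<close>

lemma \<phi>_\<sigma>: "x$1 \<in> J \<Longrightarrow> \<phi> (\<sigma> x) = \<phi>c x"
proof -
  assume x: "x$1 \<in> J"
  define y where "y = (SOME y. y$1 \<in> J \<and> \<sigma> y = \<sigma> x)"
  have y: "y$1 \<in> J" "\<sigma> x = \<sigma> y" using someI[of "\<lambda>y. y$1 \<in> J \<and> \<sigma> y = \<sigma> x" x] x by (auto simp: y_def)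
  then obtain k :: int where "y = x + (of_int k * L) *\<^sub>R axis 1 1" using \<sigma>_eq_iff[OF x y(1)] by auto
  then have "\<phi>c y = \<phi>c x" using c_period[OF x] by (simp add: \<phi>c_def frame_shift[OF x] shift_nth)
  then show ?thesis by (simp add: \<phi>_def y_def)
qed

lemma \<phi>c_Ck: "Ck_on k (chart_dom J) \<phi>c"
  unfolding \<phi>c_def[abs_def] using c_smooth S_pos
  by (intro Ck_on_add Ck_on_sqrt open_J3 S_Ck Ck_on_of_vec_nth[OF J(1)]) (auto simp: smooth_on_def)

lemma Cinf_\<phi>: "Cinf M \<phi>"
  unfolding Cinf_def smooth_on_def
proof (clarsimp simp: atlas_M)
  fix k I assume I: "open I" "I \<subseteq> J"
  have "Ck_on k (chart_dom I) \<phi>c" by (rule Ck_on_subset[OF \<phi>c_Ck]) (use I in auto)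
  then show "Ck_on k (chart_dom I) (\<phi> \<circ> \<sigma>)"
    by (rule Ck_on_cong[OF open_chart_dom[OF I(1)], rotated]) (use I(2) in \<open>auto simp: \<phi>_\<sigma>\<close>)
qed

lemma continuous_map_\<phi>: "continuous_map (mtop M) euclideanreal \<phi>"
  by (rule continuous_map_M[OF Ck_on_imp_continuous_on[OF \<phi>c_Ck] \<phi>_\<sigma>])

lemma abs_le_S: "\<bar>x$2\<bar> \<le> S x" "\<bar>x$3\<bar> \<le> S x"
proof -
  have "rsq x \<le> (wt (x$1))\<^sup>2 * rsq x"
    using mult_right_mono[of 1 "(wt (x$1))\<^sup>2" "rsq x"] wt_ge_1[of "x$1"] by (simp add: rsq_def)
  then have "rsq x \<le> (S x)\<^sup>2" unfolding S_sq by (simp add: add_increasing2)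
  then have "\<bar>x$2\<bar>\<^sup>2 \<le> (S x)\<^sup>2" "\<bar>x$3\<bar>\<^sup>2 \<le> (S x)\<^sup>2"
    by (rule_tac order_trans[of _ "rsq x"]; simp add: rsq_def)+
  then show "\<bar>x$2\<bar> \<le> S x" "\<bar>x$3\<bar> \<le> S x"
    using S_pos[of x] by (auto intro: power2_le_imp_le)
qed

text \<open>As \<open>c\<close> is nonnegative, sqrt (S x) \<le> \<tau>; and \<open>S\<close>
  dominates the fibre coordinates because wt \<ge> 1.\<close>

lemma sublevel_bound:
  assumes "x$1 \<in> J" "\<phi>c x \<le> \<tau>" shows "\<bar>x$2\<bar> \<le> \<tau>\<^sup>2" "\<bar>x$3\<bar> \<le> \<tau>\<^sup>2" "c (x$1) \<le> \<tau>"
proof -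
  have "sqrt (S x) \<le> \<tau>" using assms c_nonneg[OF assms(1)] by (simp add: \<phi>c_def)
  then have "S x \<le> \<tau>\<^sup>2" using S_pos[of x] by (simp add: sqrt_le_D)
  then show "\<bar>x$2\<bar> \<le> \<tau>\<^sup>2" "\<bar>x$3\<bar> \<le> \<tau>\<^sup>2" using abs_le_S[of x] by auto
  show "c (x$1) \<le> \<tau>" using assms(2) real_sqrt_gt_zero[OF S_pos[of x]] unfolding \<phi>c_def by linarith
qed

lemma compact_sublevel: "\<exists>C. compactin (mtop M) C \<and> {p \<in> carr M. \<phi> p \<le> \<tau>} \<subseteq> C"
proof -
  obtain a b where ab: "{a..b} \<subseteq> J" "\<And>s. s \<in> J \<Longrightarrow> c s \<le> \<tau> \<Longrightarrow> \<exists>k::int. s + of_int k * L \<in> {a..b}"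
    using c_proper[of \<tau>] by blast
  let ?C = "\<sigma> ` box3 a b (\<tau>\<^sup>2)"
  have "box3 a b (\<tau>\<^sup>2) \<subseteq> chart_dom J" using ab(1) by (auto simp: box3)
  then have "compactin (top_of_set (chart_dom J)) (box3 a b (\<tau>\<^sup>2))"
    by (simp add: compactin_subtopology compact_box3)
  then have "compactin (mtop M) ?C" by (rule image_compactin[OF _ continuous_map_\<sigma>[OF order_refl]])
  moreover have "{p \<in> carr M. \<phi> p \<le> \<tau>} \<subseteq> ?C"
  proof
    fix p assume "p \<in> {p \<in> carr M. \<phi> p \<le> \<tau>}"
    then obtain x where x: "x$1 \<in> J" "p = \<sigma> x" "\<phi>c x \<le> \<tau>" unfolding carr_M by (auto simp: \<phi>_\<sigma>)
    note b = sublevel_bound[OF x(1,3)]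
    obtain k :: int where k: "x$1 + of_int k * L \<in> {a..b}" using ab(2)[OF x(1) b(3)] by blast
    have "x + (of_int k * L) *\<^sub>R axis 1 1 \<in> box3 a b (\<tau>\<^sup>2)" unfolding box3 shift_nth using k b by auto
    then show "p \<in> ?C" using \<sigma>_shift[OF x(1), of k] x(2) by (metis imageI)
  qed
  ultimately show ?thesis by blast
qed

lemma proper_map_\<phi>: "proper_map (mtop M) euclideanreal \<phi>"
proof (rule compact_imp_proper_map)
  show "k_space euclideanreal" by (simp add: metrizable_imp_k_space metrizable_space_euclidean)
  show "kc_space euclideanreal" by (simp add: Hausdorff_imp_kc_space)
  show "\<phi> \<in> carr M \<rightarrow> topspace euclideanreal" by simp
  show "continuous_map (mtop M) euclideanreal \<phi> \<or> kc_space (mtop M)" using continuous_map_\<phi> by blast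
  fix K :: "real set" assume "compactin euclideanreal K"
  then have K: "compact K" by simp
  then obtain \<tau> where \<tau>: "\<And>y. y \<in> K \<Longrightarrow> y \<le> \<tau>"
    using compact_imp_bounded bounded_real by (metis abs_le_D1)
  obtain C where C: "compactin (mtop M) C" "{p \<in> carr M. \<phi> p \<le> \<tau>} \<subseteq> C" using compact_sublevel by blast
  have "closedin (mtop M) {p \<in> carr M. \<phi> p \<in> K}"
    using closedin_continuous_map_preimage[OF continuous_map_\<phi>] K by (simp add: compact_imp_closed)
  moreover have "{p \<in> carr M. \<phi> p \<in> K} \<subseteq> C" using C(2) \<tau> by blast
  ultimately show "compactin (mtop M) {p \<in> carr M. \<phi> p \<in> K}" using C(1) closed_compactin by blast
qed

lemma not_compact_M: "\<not> compact_space (mtop M)"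
proof
  assume "compact_space (mtop M)"
  then have "compactin (mtop M) (carr M)" by (simp add: compact_space_def)
  then have "compact (\<phi> ` carr M)" using image_compactin[OF _ continuous_map_\<phi>] by auto
  then obtain b where b: "\<And>p. p \<in> carr M \<Longrightarrow> \<phi> p \<le> b"
    using compact_imp_bounded bounded_real by (metis abs_le_D1 imageI)
  obtain s where s: "s \<in> J" using J(3) by blast
  \<comment> \<open>A point of the fibre over \<open>s\<close> beyond the radius
    \<open>b\<^sup>2\<close> that the sublevel set at \<open>b\<close> allows.\<close>
  let ?x = "vector [s, b\<^sup>2 + 1, 0] :: real^3"
  have "\<phi>c ?x \<le> b" using b[of "\<sigma> ?x"] s by (simp add: \<phi>_\<sigma> carr_M)
  from sublevel_bound(1)[OF _ this] s show False by simp
qed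

section \<open>Gradient and Laplacian of the exhaustion function\<close>

lemma partial_S:
  assumes x: "x$1 \<in> J"
  shows "partial 1 S x = wt (x$1) * dwt (x$1) * rsq x / S x"
    "partial 2 S x = (wt (x$1))\<^sup>2 * x$2 / S x" "partial 3 S x = (wt (x$1))\<^sup>2 * x$3 / S x"
proof -
  have n: "((\<lambda>x::real^3. x $ i) has_derivative (\<lambda>v. v $ i)) (at x)" for i
    by (rule bounded_linear_imp_has_derivative[OF bounded_linear_vec_nth])
  have w: "((\<lambda>x::real^3. wt (x $ 1)) has_derivative (\<lambda>v. dwt (x$1) * v $ 1)) (at x)"
    using has_derivative_compose[OF n wt_deriv[OF x, unfolded has_field_derivative_def]] .
  have V: "((\<lambda>x. (wt (x$1))\<^sup>2 * ((x$2)\<^sup>2 + (x$3)\<^sup>2) + t ^ 4) has_derivative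
     (\<lambda>v. 2 * wt (x$1) * dwt (x$1) * rsq x * v$1 + 2 * (wt (x$1))\<^sup>2 * (x$2 * v$2 + x$3 * v$3))) (at x)"
    by (rule derivative_eq_intros n w refl)+ (auto simp: rsq_def algebra_simps power2_eq_square fun_eq_iff)
  have pos: "(wt (x$1))\<^sup>2 * ((x$2)\<^sup>2 + (x$3)\<^sup>2) + t ^ 4 > 0" using t by (simp add: add_nonneg_pos)
  have "(S has_derivative (\<lambda>v. (2 * wt (x$1) * dwt (x$1) * rsq x * v$1 + 2 * (wt (x$1))\<^sup>2 * (x$2 * v$2 + x$3 * v$3))
      * (inverse (S x) / 2))) (at x)"
    using has_derivative_compose[OF V DERIV_real_sqrt[OF pos, unfolded has_field_derivative_def]]
    unfolding S_def[abs_def] rsq_def by (simp add: mult.commute)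
  note p = partial_eqI[OF this]
  show "partial 1 S x = wt (x$1) * dwt (x$1) * rsq x / S x"
    "partial 2 S x = (wt (x$1))\<^sup>2 * x$2 / S x" "partial 3 S x = (wt (x$1))\<^sup>2 * x$3 / S x"
    using p[of 1] p[of 2] p[of 3] S_pos[of x] by (simp_all add: axis_def field_simps)
qed

lemma S_differentiable: "x$1 \<in> J \<Longrightarrow> S differentiable (at x)"
  using S_Ck[of 1] by simp

lemma sqrt_Q: "sqrt (Q x) = wt (x$1) / (sqrt 2 * sqrt (S x))"
  using wt_pos[of "x$1"] by (simp add: Q_def real_sqrt_divide real_sqrt_mult)

lemma partial_sqrt_S:
  assumes "x$1 \<in> J"
  shows "partial i (\<lambda>x. sqrt (S x)) x = partial i S x / (2 * sqrt (S x))" "(\<lambda>x. sqrt (S x)) differentiable (at x)"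
  using partial_chain[OF S_differentiable[OF assms] DERIV_real_sqrt[OF S_pos], of i]
    differentiable_compose[OF DERIV_imp_differentiable[OF DERIV_real_sqrt[OF S_pos]] S_differentiable[OF assms]]
  by (auto simp: field_simps comp_def)

lemma partial_\<phi>c:
  assumes x: "x$1 \<in> J"
  shows "partial i \<phi>c x = partial i S x / (2 * sqrt (S x)) + (if i = 1 then c' (x$1) else 0)"
  unfolding \<phi>c_def[abs_def]
  by (simp add: partial_add[OF partial_sqrt_S(2)[OF x] partial_of_nth(2)[OF c_deriv(1)[OF x]]]
      partial_sqrt_S(1)[OF x] partial_of_nth(1)[OF c_deriv(1)[OF x]])

lemma horizontal_S: assumes x: "x$1 \<in> J" shows "horizontal m1 m2 S x = 0"
  unfolding horizontal_def partial_S[OF x] m1_def m2_def rsq_def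
  using S_pos[of x] wt_pos[of "x$1"] by (simp add: field_simps power2_eq_square)

lemma horizontal_\<phi>c: assumes x: "x$1 \<in> J" shows "horizontal m1 m2 \<phi>c x = c' (x$1)"
proof -
  have "horizontal m1 m2 \<phi>c x = horizontal m1 m2 S x / (2 * sqrt (S x)) + c' (x$1)"
    unfolding horizontal_def partial_\<phi>c[OF x] by (simp add: diff_divide_distrib)
  then show ?thesis using horizontal_S[OF x] by simp
qed

text \<open>The base part is at most |dl|^2 = 1 / (2 S) \<le> 1 / (2 t^2) by \<open>c_bound\<close>.
  The fibre part is u1^2 / (2 S^2), below 1 / 2.\<close>

lemma grad_norm_sq_\<phi>c:
  assumes x: "x$1 \<in> J"
  shows "grad_norm_sq Q m1 m2 \<phi>c x \<le> 1 / (2 * t\<^sup>2) + 1 / 2"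
proof -
  have sS: "sqrt (S x) * sqrt (S x) = S x" "sqrt (S x) > 0" using S_pos[of x] by auto
  have "Q x * (c' (x$1))\<^sup>2 = (\<bar>c' (x$1)\<bar> * wt (x$1))\<^sup>2 / (2 * S x)"
    by (simp add: Q_def power_mult_distrib)
  also have "\<dots> \<le> 1 / (2 * S x)"
    using c_bound[OF x] wt_pos[of "x$1"] S_pos[of x] by (intro divide_right_mono power_le_one) auto
  also have "\<dots> \<le> 1 / (2 * t\<^sup>2)" using S_ge[of x] t by (intro divide_left_mono) (auto simp: S_pos)
  finally have 1: "Q x * (c' (x$1))\<^sup>2 \<le> 1 / (2 * t\<^sup>2)" .
  have "((partial 2 \<phi>c x)\<^sup>2 + (partial 3 \<phi>c x)\<^sup>2) / Q x = ((wt (x$1))\<^sup>2 * rsq x) / (2 * (S x)\<^sup>2)"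
    unfolding partial_\<phi>c[OF x] partial_S[OF x] Q_def rsq_def
    using sS S_pos[of x] wt_pos[of "x$1"] by (simp add: power_divide power_mult_distrib field_simps)
  also have "\<dots> \<le> (S x)\<^sup>2 / (2 * (S x)\<^sup>2)"
  proof (rule divide_right_mono)
    show "(wt (x$1))\<^sup>2 * rsq x \<le> (S x)\<^sup>2" using S_sq[of x] by simp
  qed simp
  also have "\<dots> = 1 / 2" using S_pos[of x] by simp
  finally show ?thesis using 1 unfolding grad_norm_sq_def horizontal_\<phi>c[OF x] by linarith
qed

lemma uniformly_lipschitz_\<phi>: "uniformly_lipschitz M \<phi>"
  unfolding uniformly_lipschitz_def
proof (intro exI conjI ballI)
  let ?B = "sqrt (1 / (2 * t\<^sup>2) + 1 / 2)"
  have B: "?B > 0" by (simp add: add_nonneg_pos)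
  then show "0 \<le> ?B" by simp
  show "ennreal \<bar>\<phi> p - \<phi> q\<bar> \<le> ennreal ?B * riem_dist M p q" for p q
    by (rule riem_dist_Lipschitz[OF \<phi>c_Ck \<phi>_\<sigma> B]) (use grad_norm_sq_\<phi>c in auto)
qed

text \<open>The potential part of \<open>\<phi>\<close> is constant along the horizontal direction, so the horizontal
  part of the flux only involves \<open>c\<close>.\<close>

lemma divergence_flux_\<phi>c:
  assumes x: "x$1 \<in> J" shows "divergence (flux Q m1 m2 \<phi>c) x \<ge> 0"
proof -
  define a where "a = dwt (x$1) / wt (x$1)"
  \<comment> \<open>The coefficient Q^(3/2) of the horizontal derivative in
    \<open>flux\<close>.\<close>
  define E where "E y = Q y * sqrt (Q y)" for y
  define G where "G i y = (wt (y$1) / sqrt 2) * (y $ i * inverse (S y))" for i and y :: "real^3"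
  have xd: "x \<in> chart_dom J" using x by simp
  have diff: "Q differentiable (at x)" "m1 differentiable (at x)" "m2 differentiable (at x)" "S differentiable (at x)"
    using Q_Ck[of 1] m_Ck[of 1] S_Ck[of 1] x by auto
  have cd: "(\<lambda>y. c' (y$1)) differentiable (at x)" "partial i (\<lambda>y. c' (y$1)) x = (if i = 1 then c'' (x$1) else 0)" for i
    using partial_of_nth[OF c_deriv(2)[OF x]] by auto
  have wd: "(\<lambda>y. wt (y$1)) differentiable (at x)" "partial i (\<lambda>y. wt (y$1)) x = (if i = 1 then dwt (x$1) else 0)" for i
    using partial_of_nth[OF wt_deriv[OF x]] by auto
  have "Ck_on 1 (chart_dom J) (\<lambda>y. inverse (S y))"
    by (rule Ck_on_inverse[OF open_J3 S_Ck]) (use S_pos in \<open>simp add: less_imp_neq[symmetric]\<close>)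
  then have Sd1: "(\<lambda>y. inverse (S y)) differentiable (at x)" using x by simp
  have Sd2: "partial i (\<lambda>y. inverse (S y)) x = - partial i S x / (S x)\<^sup>2" for i
    using partial_chain[OF diff(4) DERIV_inverse[of "S x" UNIV], of i] S_pos[of x]
    by (simp add: power2_eq_square divide_inverse)
  note Sd = Sd1 Sd2
  have Qe: "Q = (\<lambda>y. (wt (y$1) * wt (y$1)) * (inverse (S y) * (1/2)))"
    by (simp add: fun_eq_iff Q_def power2_eq_square field_simps)
  have pc: "partial i (\<lambda>y. r) x = 0" "(\<lambda>y::real^3. r) differentiable (at x)" for i and r :: real
    using partial_eqI[OF has_derivative_const] by auto
  have pQ: "partial i Q x = (wt (x$1))\<^sup>2 * (- partial i S x / (S x)\<^sup>2 / 2) + (if i = 1 then 2 * wt (x$1) * dwt (x$1) else 0) / (2 * S x)" for i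
  proof -
    have u: "partial i (\<lambda>y. wt (y$1) * wt (y$1)) x = (if i = 1 then 2 * wt (x$1) * dwt (x$1) else 0)"
      unfolding partial_mult[OF wd(1) wd(1)] wd(2) by simp
    have v: "partial i (\<lambda>y. inverse (S y) * (1/2)) x = - partial i S x / (S x)\<^sup>2 / 2"
      unfolding partial_mult[OF Sd1 pc(2)] Sd2 pc(1) by simp
    show ?thesis
      unfolding Qe partial_mult[OF differentiable_mult[OF wd(1) wd(1)] differentiable_mult[OF Sd1 pc(2)]] u v
      by (simp add: power2_eq_square inverse_eq_divide)
  qed
  \<comment> \<open>Since \<open>S\<close> is horizontally constant, the horizontal logarithmic
    derivative of Q = wt^2 / (2 S) is twice that of wt, that is 2 a. For Q^(3/2) it becomes 3
    a.\<close>
  have "horizontal m1 m2 Q x = (wt (x$1))\<^sup>2 * (- horizontal m1 m2 S x / (S x)\<^sup>2 / 2) + wt (x$1) * dwt (x$1) / S x"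
    unfolding horizontal_def pQ using S_pos[of x] by (simp add: field_simps)
  also have "\<dots> = 2 * a * Q x"
    using wt_pos[of "x$1"] S_pos[of x] by (simp add: horizontal_S[OF x] a_def Q_def power2_eq_square)
  finally have hQ: "horizontal m1 m2 Q x = 2 * a * Q x" .
  have "((\<lambda>r. r * sqrt r) has_real_derivative (3/2) * sqrt (Q x)) (at (Q x))"
  proof -
    have "((\<lambda>r. r * sqrt r) has_real_derivative 1 * sqrt (Q x) + inverse (sqrt (Q x)) / 2 * Q x) (at (Q x))"
      by (rule DERIV_mult[OF DERIV_ident DERIV_real_sqrt[OF Q_pos]])
    moreover have "inverse (sqrt (Q x)) / 2 * Q x = sqrt (Q x) / 2"
      using Q_pos[of x] by (simp add: field_simps)
    ultimately show ?thesis by simp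
  qed
  note pE = partial_chain[OF diff(1) this]
  have "Ck_on 1 (chart_dom J) E"
    unfolding E_def[abs_def] by (intro Ck_on_mult Ck_on_sqrt open_J3 Q_Ck Q_pos)
  then have "E differentiable (at x)" using x by simp
  have E: "partial i E x = (3/2) * sqrt (Q x) * partial i Q x" "E differentiable (at x)" for i
    using pE \<open>E differentiable _\<close> unfolding E_def[abs_def] by auto
  have hE: "horizontal m1 m2 E x = 3 * a * E x"
  proof -
    have "horizontal m1 m2 E x = (3/2) * sqrt (Q x) * horizontal m1 m2 Q x"
      unfolding horizontal_def E by (simp add: algebra_simps)
    then show ?thesis unfolding hQ by (simp add: E_def)
  qed
  have Ec: "(\<lambda>y. E y * c' (y$1)) differentiable (at x)"
    "partial 1 (\<lambda>y. E y * c' (y$1)) x = E x * c'' (x$1) + partial 1 E x * c' (x$1)"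
    "partial 2 (\<lambda>y. E y * c' (y$1)) x = partial 2 E x * c' (x$1)"
    "partial 3 (\<lambda>y. E y * c' (y$1)) x = partial 3 E x * c' (x$1)"
    by (simp_all add: differentiable_mult partial_mult E(2) cd)
  \<comment> \<open>\<open>m1\<close> and \<open>m2\<close> are linear in the fibre coordinates,
    with coefficients depending on the parameter only; each contributes \<open>a\<close> to the
    fibre divergence.\<close>
  define al be where "al s = dwt s / wt s" and "be s = twist s / wt s" for s
  have ad: "(\<lambda>y. al (y$1)) differentiable (at x)" "(\<lambda>y. be (y$1)) differentiable (at x)"
    "partial 2 (\<lambda>y. al (y$1)) x = 0" "partial 3 (\<lambda>y. al (y$1)) x = 0"
    "partial 2 (\<lambda>y. be (y$1)) x = 0" "partial 3 (\<lambda>y. be (y$1)) x = 0"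
  proof -
    have ck: "Ck_on 1 J (\<lambda>s. al s)" "Ck_on 1 J (\<lambda>s. be s)"
      unfolding al_def be_def using wt_pos by (auto intro!: Ck_on_divide J(1) dwt_Ck wt_Ck twist_Ck simp del: Ck_on.simps simp: less_imp_neq[symmetric])
    obtain d1 where "((\<lambda>s. al s) has_real_derivative d1) (at (x$1))"
      using ck(1) x real_differentiable_def by fastforce
    from partial_of_nth[OF this] show "(\<lambda>y. al (y$1)) differentiable (at x)"
      "partial 2 (\<lambda>y. al (y$1)) x = 0" "partial 3 (\<lambda>y. al (y$1)) x = 0" by auto
    obtain d2 where "((\<lambda>s. be s) has_real_derivative d2) (at (x$1))"
      using ck(2) x real_differentiable_def by fastforce
    from partial_of_nth[OF this] show "(\<lambda>y. be (y$1)) differentiable (at x)"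
      "partial 2 (\<lambda>y. be (y$1)) x = 0" "partial 3 (\<lambda>y. be (y$1)) x = 0" by auto
  qed
  have me: "m1 = (\<lambda>y. al (y$1) * y$2 - be (y$1) * y$3)"
     "m2 = (\<lambda>y. be (y$1) * y$2 + al (y$1) * y$3)"
    by (simp_all add: fun_eq_iff m1_def m2_def al_def be_def diff_divide_distrib add_divide_distrib)
  have pm: "partial 2 m1 x = a" "partial 3 m2 x = a"
    unfolding me
    by (simp_all add: partial_diff partial_add partial_mult differentiable_mult ad nth_differentiable partial_nth) (simp_all add: a_def al_def)
  have Gd: "G i differentiable (at x)" for i
    unfolding G_def[abs_def] by (simp add: differentiable_mult Sd nth_differentiable wd divide_inverse pc)
  have pG: "partial i (G i) x = wt (x$1) / sqrt 2 * (inverse (S x) - x$i * (wt (x$1))\<^sup>2 * x$i / (S x)^3)"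
    if "i = 2 \<or> i = 3" for i
  proof -
    have "partial i S x = (wt (x$1))\<^sup>2 * x$i / S x" using that partial_S[OF x] by auto
    moreover have "i \<noteq> 1" using that by auto
    ultimately show ?thesis
      unfolding G_def[abs_def] divide_inverse[of "wt _"]
      using S_pos[of x]
      by (simp add: partial_mult differentiable_mult Sd nth_differentiable wd pc partial_nth)
        (simp add: field_simps power2_eq_square power3_eq_cube)
  qed
  have f1: "partial 1 (\<lambda>y. flux Q m1 m2 \<phi>c y $ 1) x = E x * c'' (x$1) + partial 1 E x * c' (x$1)"
  proof -
    have "partial 1 (\<lambda>y. flux Q m1 m2 \<phi>c y $ 1) x = partial 1 (\<lambda>y. E y * c' (y$1)) x"
      by (rule partial_cong_open[OF open_J3 xd]) (simp add: flux_component horizontal_\<phi>c E_def)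
    then show ?thesis by (simp add: Ec)
  qed
  \<comment> \<open>The root of \<open>S\<close> in the derivative of \<open>\<phi>c\<close> cancels
    against the one in sqrt Q, so \<open>G i\<close> is the derivative of \<open>S\<close> itself,
    divided by sqrt 2 wt.\<close>
  have gf: "partial i \<phi>c y / sqrt (Q y) = G i y" if "y$1 \<in> J" "i = 2 \<or> i = 3" for i y
  proof -
    have "partial i S y = (wt (y$1))\<^sup>2 * y$i / S y" using that partial_S[OF that(1)] by auto
    moreover have "i \<noteq> 1" using that(2) by auto
    moreover have "sqrt 2 * sqrt 2 = (2::real)" by simp
    ultimately show ?thesis unfolding partial_\<phi>c[OF that(1)] sqrt_Q G_def
      using wt_pos[of "y$1"] S_pos[of y] by (simp add: field_simps power2_eq_square)
  qed
  have f2: "partial 2 (\<lambda>y. flux Q m1 m2 \<phi>c y $ 2) x = partial 2 (G 2) x - (m1 x * (partial 2 E x * c' (x$1)) + a * (E x * c' (x$1)))"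
  proof -
    have "partial 2 (\<lambda>y. flux Q m1 m2 \<phi>c y $ 2) x = partial 2 (\<lambda>y. G 2 y - m1 y * (E y * c' (y$1))) x"
      by (rule partial_cong_open[OF open_J3 xd]) (simp add: flux_component horizontal_\<phi>c E_def gf)
    then show ?thesis by (simp add: partial_diff partial_mult Gd diff Ec differentiable_mult pm)
  qed
  have f3: "partial 3 (\<lambda>y. flux Q m1 m2 \<phi>c y $ 3) x = partial 3 (G 3) x - (m2 x * (partial 3 E x * c' (x$1)) + a * (E x * c' (x$1)))"
  proof -
    have "partial 3 (\<lambda>y. flux Q m1 m2 \<phi>c y $ 3) x = partial 3 (\<lambda>y. G 3 y - m2 y * (E y * c' (y$1))) x"
      by (rule partial_cong_open[OF open_J3 xd]) (simp add: flux_component horizontal_\<phi>c E_def gf)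
    then show ?thesis by (simp add: partial_diff partial_mult Gd diff Ec differentiable_mult pm)
  qed
  \<comment> \<open>Of the 3 a coming from \<open>E\<close>, the derivatives of \<open>m1\<close>
    and \<open>m2\<close> take away 2 a. What remains, E (c'' + a c'), is E / wt times the
    derivative of wt c'.\<close>
  have "divergence (flux Q m1 m2 \<phi>c) x =
     E x * c'' (x$1) + c' (x$1) * horizontal m1 m2 E x - 2 * a * E x * c' (x$1) + (partial 2 (G 2) x + partial 3 (G 3) x)"
    unfolding divergence_def sum_3 f1 f2 f3 horizontal_def by (simp add: algebra_simps)
  also have "\<dots> = E x * ((c'' (x$1) * wt (x$1) + c' (x$1) * dwt (x$1)) / wt (x$1)) + (partial 2 (G 2) x + partial 3 (G 3) x)"
    unfolding hE a_def using wt_pos[of "x$1"] by (simp add: field_simps)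
  also have "\<dots> \<ge> 0"
  proof (rule add_nonneg_nonneg)
    show "0 \<le> E x * ((c'' (x$1) * wt (x$1) + c' (x$1) * dwt (x$1)) / wt (x$1))"
      unfolding E_def using Q_pos[of x] c_convex[OF x] wt_pos[of "x$1"] by (intro mult_nonneg_nonneg divide_nonneg_pos) auto
    have "partial 2 (G 2) x + partial 3 (G 3) x = wt (x$1) / sqrt 2 * ((2 * (S x)\<^sup>2 - (wt (x$1))\<^sup>2 * rsq x) / (S x)^3)"
      using S_pos[of x] unfolding pG[OF disjI1[OF refl]] pG[OF disjI2[OF refl]] rsq_def
      by (simp add: field_simps power2_eq_square power3_eq_cube)
    \<comment> \<open>Up to a positive factor the fibre part is the flat Laplacian of
      \<open>S\<close>, positive because S^2 exceeds u1^2 by t^4.\<close>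
    also have "2 * (S x)\<^sup>2 - (wt (x$1))\<^sup>2 * rsq x = (S x)\<^sup>2 + t ^ 4" using S_sq[of x] by simp
    finally show "0 \<le> partial 2 (G 2) x + partial 3 (G 3) x"
      using S_pos[of x] wt_pos[of "x$1"] by simp
  qed
  finally show ?thesis .
qed

lemma laplace_coord_M:
  assumes x: "x$1 \<in> J" and F: "Ck_on 1 (chart_dom J) F" and f: "\<And>y. y$1 \<in> J \<Longrightarrow> (f \<circ> \<sigma>) y = F y"
  shows "laplace_coord (gmetric M \<sigma>) (f \<circ> \<sigma>) x = - divergence (flux Q m1 m2 F) x / sqrt (Q x)"
proof -
  have "(f \<circ> \<sigma>) differentiable (at y)" if "y \<in> chart_dom J" for y
    by (rule differentiable_cong_open[OF open_J3 that, of F]) (use f F that in auto)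
  then have "laplace_coord (gmetric M \<sigma>) (f \<circ> \<sigma>) x = - divergence (flux Q m1 m2 (f \<circ> \<sigma>)) x / sqrt (Q x)"
    using x by (intro laplace_coord_frame_metric[of "chart_dom J"] open_J3) (auto simp: gmetric_M Q_pos)
  moreover have "flux Q m1 m2 (f \<circ> \<sigma>) y = flux Q m1 m2 F y" if "y \<in> chart_dom J" for y
  proof -
    have "partial i (f \<circ> \<sigma>) y = partial i F y" for i
      by (rule partial_cong_open[OF open_J3 that]) (use f in auto)
    then show ?thesis by (simp add: flux_def horizontal_def)
  qed
  then have "divergence (flux Q m1 m2 (f \<circ> \<sigma>)) x = divergence (flux Q m1 m2 F) x"
    unfolding divergence_def using x by (intro sum.cong refl partial_cong_open[OF open_J3]) auto
  ultimately show ?thesis by simp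
qed

lemma subharmonic_\<phi>: "subharmonic_on M A \<phi>"
  unfolding subharmonic_on_def
proof (clarsimp simp only: atlas_M, intro conjI ballI impI)
  fix I assume I: "open I" "I \<subseteq> J"
  have "Ck_on 2 (chart_dom I) (\<phi> \<circ> \<sigma>)"
    using Cinf_\<phi> Ck_on_cong[OF open_chart_dom[OF I(1)], of \<phi>c "\<phi> \<circ> \<sigma>" 2] Ck_on_subset[OF \<phi>c_Ck[of 2], of "chart_dom I"] I(2) \<phi>_\<sigma>
    by (auto simp: subset_iff)
  then show "Ck_on 2 {x \<in> chart_dom I. \<sigma> x \<in> A} (\<phi> \<circ> \<sigma>)" by (rule Ck_on_subset) auto
  fix x assume "x \<in> chart_dom I"
  then have x: "x$1 \<in> J" using I(2) by auto
  show "laplace_coord (gmetric M \<sigma>) (\<phi> \<circ> \<sigma>) x \<le> 0"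
    using laplace_coord_M[OF x \<phi>c_Ck, of \<phi>] divergence_flux_\<phi>c[OF x] Q_pos[of x] by (simp add: \<phi>_\<sigma>)
qed

end

section \<open>The Riemannian volume\<close>

lemma nn_integral_translation:
  fixes g :: "'a::euclidean_space \<Rightarrow> ennreal"
  assumes "g \<in> borel_measurable borel"
  shows "(\<integral>\<^sup>+x. g (x + c) \<partial>lborel) = (\<integral>\<^sup>+x. g x \<partial>lborel)"
proof -
  have "(\<integral>\<^sup>+x. g x \<partial>lborel) = (\<integral>\<^sup>+x. g x \<partial>distr lborel borel ((+) c))"
    by (simp add: lborel_distr_plus)
  also have "\<dots> = (\<integral>\<^sup>+x. g (c + x) \<partial>lborel)"
    using assms by (intro nn_integral_distr) auto
  finally show ?thesis by (simp add: add.commute)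
qed

lemma translation_image_vimage: "(\<lambda>x. x + c) ` B = (\<lambda>x. x - c) -` (B :: 'a::ab_group_add set)"
proof (intro equalityI subsetI)
  fix z assume "z \<in> (\<lambda>x. x - c) -` B"
  then show "z \<in> (\<lambda>x. x + c) ` B" by (intro image_eqI[of _ _ "z - c"]) auto
qed auto

lemma floor_shift:
  fixes r L :: real assumes "L > 0"
  shows "0 \<le> r + of_int (- \<lfloor>r / L\<rfloor>) * L" "r + of_int (- \<lfloor>r / L\<rfloor>) * L < L"
  using mult_right_mono[OF of_int_floor_le[of "r / L"], of L] assms
    mult_strict_right_mono[OF real_of_int_floor_add_one_gt[of "r / L"] assms]
  by (simp_all add: algebra_simps)

context eh_curve begin

text \<open>A fundamental domain: every point of the manifold has exactly one preimage in
  \<open>D\<close>. The volume can therefore be defined as the image \<open>\<mu>\<close> of a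
  single measure on coordinate space.\<close>

definition D :: "(real^3) set" where "D = {x. x$1 \<in> J \<and> (L > 0 \<longrightarrow> 0 \<le> x$1 \<and> x$1 < L)}"
definition dens :: "real^3 \<Rightarrow> real" where "dens x = indicator (chart_dom J) x *\<^sub>R sqrt (Q x)"
definition V :: "(real^3) measure" where "V = density lborel (\<lambda>x. ennreal (dens x))"
definition BM :: "eh_point measure" where "BM = sigma (carr M) {W. openin (mtop M) W}"
definition \<mu> :: "eh_point measure" where "\<mu> = distr (restrict_space V D) BM \<sigma>"

lemma D_sub: "D \<subseteq> chart_dom J" by (auto simp: D_def)

lemma D_borel [measurable]: "D \<in> sets borel"
proof (cases "L = 0")
  case True
  then have "D = chart_dom J" unfolding D_def by simp
  then show ?thesis using open_J3 by simp
next
  case False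
  then have "D = {x. 0 \<le> x$1 \<and> x$1 < L}" using L unfolding D_def by auto
  moreover have "{x::real^3. 0 \<le> x$1 \<and> x$1 < L} \<in> sets borel" by measurable
  ultimately show ?thesis by simp
qed

lemma sqrt_Q_cont: "continuous_on (chart_dom J) (\<lambda>x. sqrt (Q x))"
  using Ck_on_imp_continuous_on[OF Q_Ck[of 0]] by (intro continuous_intros)

lemma dens_borel [measurable]: "dens \<in> borel_measurable borel"
  unfolding dens_def[abs_def]
  by (rule borel_measurable_continuous_on_indicator[OF _ sqrt_Q_cont]) (use open_J3 in simp)

lemma sets_V [simp]: "sets V = sets borel" by (simp add: V_def)
lemma space_V [simp]: "space V = UNIV" by (simp add: V_def)

lemma open_sets_BM: "openin (mtop M) W \<Longrightarrow> W \<in> sets BM"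
  unfolding BM_def by (subst sets_measure_of) (auto dest: openin_subset)

lemma space_BM: "space BM = carr M"
  unfolding BM_def by (rule space_measure_of) (auto dest: openin_subset)

lemma open_\<sigma>_preimage: "openin (mtop M) W \<Longrightarrow> open {x. x$1 \<in> J \<and> \<sigma> x \<in> W}"
  using openin_continuous_map_preimage[OF continuous_map_\<sigma>[OF order_refl]] open_J3
  by (simp add: openin_open_eq)

lemma space_restrict_V: "space (restrict_space V D) = D"
  by (simp add: space_restrict_space)

lemma \<sigma>_measurable_on:
  assumes "A \<subseteq> chart_dom J" "A \<in> sets borel"
  shows "\<sigma> \<in> measurable (restrict_space borel A) BM"
  unfolding BM_def
proof (rule measurable_measure_of)
  show "{W. openin (mtop M) W} \<subseteq> Pow (carr M)" by (auto dest: openin_subset)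
  show "\<sigma> \<in> space (restrict_space borel A) \<rightarrow> carr M" using assms(1) by (auto simp: space_restrict_space carr_M)
  fix W assume "W \<in> {W. openin (mtop M) W}"
  then have "open {x. x$1 \<in> J \<and> \<sigma> x \<in> W}" using open_\<sigma>_preimage by simp
  moreover have "\<sigma> -` W \<inter> space (restrict_space borel A) = {x. x$1 \<in> J \<and> \<sigma> x \<in> W} \<inter> A"
    using assms(1) by (auto simp: space_restrict_space)
  ultimately show "\<sigma> -` W \<inter> space (restrict_space borel A) \<in> sets (restrict_space borel A)"
    using assms(2) by (subst sets_restrict_space_iff) auto
qed

lemma \<sigma>_measurable: "\<sigma> \<in> measurable (restrict_space V D) BM"
proof -
  have "sets (restrict_space V D) = sets (restrict_space borel D)" by (simp add: sets_restrict_space)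
  then show ?thesis
    using \<sigma>_measurable_on[OF D_sub D_borel] measurable_cong_sets by blast
qed

text \<open>On the open image of the chart the inverse of \<open>\<sigma>\<close> is continuous,
  hence measurable, and the image of \<open>B\<close> is its preimage under that inverse.\<close>

lemma \<sigma>_image_sets:
  assumes I: "open I" "I \<subseteq> J" "inj_on \<Gamma> I" and B: "B \<in> sets borel" "B \<subseteq> chart_dom I"
  shows "\<sigma> ` B \<in> sets BM"
proof -
  let ?U = "chart_dom I" and ?g = "inv_into (chart_dom I) \<sigma>"
  have U: "open ?U" "?U \<subseteq> chart_dom J" using I open_chart_dom by auto
  have inv: "?g (\<sigma> x) = x" if "x \<in> ?U" for x using inv_into_f_f[OF inj_on_\<sigma>[OF I(2,3)] that] .
  have \<sigma>U: "\<sigma> ` ?U \<in> sets BM" using openin_\<sigma>_image[OF U] by (rule open_sets_BM)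
  then have \<sigma>U': "\<sigma> ` ?U \<inter> space BM \<in> sets BM" by (metis sets.Int_space_eq2)
  have pre: "?g -` X \<inter> \<sigma> ` ?U = \<sigma> ` (X \<inter> ?U)" for X using inv by auto
  have sp: "space (restrict_space BM (\<sigma> ` ?U)) = \<sigma> ` ?U"
    using sets.sets_into_space[OF \<sigma>U] by (auto simp: space_restrict_space)
  have "?g \<in> borel_measurable (restrict_space BM (\<sigma> ` ?U))"
  proof (rule borel_measurableI)
    fix X :: "(real^3) set" assume "open X"
    then have "openin (mtop M) (\<sigma> ` (X \<inter> ?U))" using U by (intro openin_\<sigma>_image) auto
    then show "?g -` X \<inter> space (restrict_space BM (\<sigma> ` ?U)) \<in> sets (restrict_space BM (\<sigma> ` ?U))"
      unfolding sp pre sets_restrict_space_iff[OF \<sigma>U'] by (auto intro: open_sets_BM)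
  qed
  from measurable_sets[OF this B(1)] have "\<sigma> ` (B \<inter> ?U) \<in> sets BM"
    unfolding sp pre sets_restrict_space_iff[OF \<sigma>U'] by simp
  with B(2) show ?thesis by (simp add: Int_absorb2)
qed

lemma emeasure_V_shift:
  assumes B: "B \<in> sets borel" "B \<subseteq> chart_dom J"
  shows "emeasure V ((\<lambda>x. x + (of_int k * L) *\<^sub>R axis 1 1) ` B) = emeasure V B"
proof -
  let ?c = "(of_int k * L) *\<^sub>R axis 1 1 :: real^3"
  have im: "(\<lambda>x. x + ?c) ` B = (\<lambda>x. x - ?c) -` B"
    by (rule translation_image_vimage)
  have "(\<lambda>x. x - ?c) -` B \<inter> space borel \<in> sets borel"
    by (rule measurable_sets[OF _ B(1)]) simp
  then have m: "(\<lambda>x. x + ?c) ` B \<in> sets borel" by (simp add: im)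
  have eq: "ennreal (dens (x + ?c)) * indicator ((\<lambda>x. x + ?c) ` B) (x + ?c) = ennreal (dens x) * indicator B x" for x
  proof (cases "x \<in> B")
    case True
    then have x: "x$1 \<in> J" using B(2) by auto
    then have "dens (x + ?c) = dens x"
      using shift_in_J[OF x, of k] by (simp add: dens_def frame_shift[OF x] shift_nth)
    then show ?thesis using True by simp
  next
    case False
    then have "x + ?c \<notin> (\<lambda>x. x + ?c) ` B" by auto
    with False show ?thesis by simp
  qed
  have "emeasure V ((\<lambda>x. x + ?c) ` B) = (\<integral>\<^sup>+x. ennreal (dens x) * indicator ((\<lambda>x. x + ?c) ` B) x \<partial>lborel)"
    unfolding V_def using m by (intro emeasure_density) auto
  also have "\<dots> = (\<integral>\<^sup>+x. ennreal (dens (x + ?c)) * indicator ((\<lambda>x. x + ?c) ` B) (x + ?c) \<partial>lborel)"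
    using m by (intro nn_integral_translation[symmetric]) auto
  also have "\<dots> = (\<integral>\<^sup>+x. ennreal (dens x) * indicator B x \<partial>lborel)" by (simp only: eq)
  also have "\<dots> = emeasure V B"
    unfolding V_def using B(1) by (intro emeasure_density[symmetric]) auto
  finally show ?thesis .
qed

text \<open>\<open>B\<close> need not lie in \<open>D\<close>. It is cut into countably many pieces,
  each moved into \<open>D\<close> by a fixed multiple of the period; the moved pieces are disjoint
  and have unchanged measure.\<close>

lemma emeasure_\<mu>_image:
  assumes I: "open I" "I \<subseteq> J" "inj_on \<Gamma> I" and B: "B \<in> sets borel" "B \<subseteq> chart_dom I"
  shows "emeasure \<mu> (\<sigma> ` B) = emeasure V B"
proof -
  have BJ: "B \<subseteq> chart_dom J" using B(2) I(2) by auto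
  have 1: "emeasure \<mu> (\<sigma> ` B) = emeasure V (\<sigma> -` \<sigma> ` B \<inter> D)"
    unfolding \<mu>_def emeasure_distr[OF \<sigma>_measurable \<sigma>_image_sets[OF I B]] space_restrict_V
    by (rule emeasure_restrict_space) auto
  show ?thesis
  proof (cases "L = 0")
    case True
    have "\<sigma> x = \<sigma> y \<longleftrightarrow> x = y" if "x$1 \<in> J" "y$1 \<in> J" for x y using \<sigma>_eq_iff[OF that] True by auto
    then have "\<sigma> -` \<sigma> ` B \<inter> D = B" using BJ True unfolding D_def by force
    with 1 show ?thesis by simp
  next
    case False
    then have Lp: "L > 0" and J: "J = UNIV" using L by auto
    let ?s = "\<lambda>n x. x + (of_int (int_decode n) * L) *\<^sub>R axis 1 1 :: real^3"
    \<comment> \<open>The part of \<open>B\<close> that \<open>int_decode n\<close> periods move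
      into \<open>D\<close>; the enumeration of the integers prepares countable additivity.\<close>
    define Bn where "Bn n = B \<inter> {x. 0 \<le> x$1 + of_int (int_decode n) * L \<and> x$1 + of_int (int_decode n) * L < L}" for n
    have Bm: "Bn n \<in> sets borel" for n
      unfolding Bn_def by (intro sets.Int B(1)) measurable
    have s1: "?s n x $ 1 = x$1 + of_int (int_decode n) * L" for n x by (simp add: shift_nth)
    have uniq: "m = n" if "0 \<le> r + of_int (int_decode n) * L" "r + of_int (int_decode n) * L < L"
      "0 \<le> r + of_int (int_decode m) * L" "r + of_int (int_decode m) * L < L" for m n r
    proof -
      have "\<bar>of_int (int_decode n - int_decode m) * L\<bar> < L" using that by (simp add: algebra_simps abs_less_iff)
      then have "\<bar>of_int (int_decode n - int_decode m)\<bar> < (1::real)" using Lp by (simp add: abs_mult)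
      then have "int_decode n = int_decode m" by linarith
      then show ?thesis by (metis int_decode_inverse)
    qed
    have "disjoint_family Bn"
      unfolding disjoint_family_on_def Bn_def using uniq by blast
    \<comment> \<open>Disjointness after the translations uses injectivity of
      \<open>\<sigma>\<close> on the chart: a common point would come from two points of
      \<open>B\<close> with the same image.\<close>
    have "disjoint_family (\<lambda>n. ?s n ` Bn n)"
      unfolding disjoint_family_on_def
    proof (intro ballI impI equals0I)
      fix m n :: nat and z assume mn: "m \<noteq> n" and "z \<in> ?s m ` Bn m \<inter> ?s n ` Bn n"
      then obtain x y where xy: "x \<in> Bn m" "y \<in> Bn n" "z = ?s m x" "z = ?s n y" by blast
      have "\<sigma> x = \<sigma> z" "\<sigma> y = \<sigma> z"
        using xy(3,4) \<sigma>_shift[of x "int_decode m"] \<sigma>_shift[of y "int_decode n"] J by auto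
      moreover have "x \<in> chart_dom I" "y \<in> chart_dom I" using xy B(2) by (auto simp: Bn_def)
      ultimately have "x = y" using inj_onD[OF inj_on_\<sigma>[OF I(2,3)], of x y] by simp
      then have "?s m x $ 1 = ?s n x $ 1" using xy(3,4) by metis
      then have "real_of_int (int_decode m) * L = of_int (int_decode n) * L" unfolding s1 by simp
      then have "int_decode m = int_decode n" using Lp by simp
      with mn show False by (metis int_decode_inverse)
    qed
    have ex: "\<exists>n. 0 \<le> r + of_int (int_decode n) * L \<and> r + of_int (int_decode n) * L < L" for r
    proof -
      have "int_decode (int_encode (- \<lfloor>r / L\<rfloor>)) = - \<lfloor>r / L\<rfloor>" by simp
      moreover have "0 \<le> r + of_int (- \<lfloor>r / L\<rfloor>) * L" "r + of_int (- \<lfloor>r / L\<rfloor>) * L < L"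
        using floor_shift[OF Lp, of r] by auto
      ultimately show ?thesis by metis
    qed
    have UB: "B = (\<Union>n. Bn n)" unfolding Bn_def using ex by blast
    have UC: "\<sigma> -` \<sigma> ` B \<inter> D = (\<Union>n. ?s n ` Bn n)"
    proof (intro equalityI subsetI)
      fix z assume z: "z \<in> \<sigma> -` \<sigma> ` B \<inter> D"
      then obtain x where x: "x \<in> B" "\<sigma> x = \<sigma> z" by auto
      then obtain k :: int where k: "z = x + (of_int k * L) *\<^sub>R axis 1 1" using \<sigma>_eq_iff[of x z] J by auto
      have "z = ?s (int_encode k) x" using k by simp
      moreover have "x \<in> Bn (int_encode k)" using x(1) z k Lp unfolding D_def Bn_def by (auto simp: shift_nth)
      ultimately show "z \<in> (\<Union>n. ?s n ` Bn n)" by blast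
    next
      fix z assume "z \<in> (\<Union>n. ?s n ` Bn n)"
      then obtain n x where x: "x \<in> Bn n" "z = ?s n x" by blast
      then have "\<sigma> z = \<sigma> x" using \<sigma>_shift[of x "int_decode n"] J by simp
      then show "z \<in> \<sigma> -` \<sigma> ` B \<inter> D" using x J unfolding D_def Bn_def by (auto simp: shift_nth)
    qed
    have eq: "emeasure V (?s n ` Bn n) = emeasure V (Bn n)" for n
      by (rule emeasure_V_shift[OF Bm]) (simp add: J)
    have Cm: "?s n ` Bn n \<in> sets borel" for n
    proof -
      have "?s n ` Bn n = (\<lambda>x. x - (of_int (int_decode n) * L) *\<^sub>R axis 1 1) -` Bn n"
        by (rule translation_image_vimage)
      moreover have "(\<lambda>x::real^3. x - (of_int (int_decode n) * L) *\<^sub>R axis 1 1) -` Bn n \<inter> space borel \<in> sets borel"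
        by (rule measurable_sets[OF _ Bm]) simp
      ultimately show ?thesis by simp
    qed
    have "emeasure V (\<sigma> -` \<sigma> ` B \<inter> D) = (\<Sum>n. emeasure V (?s n ` Bn n))"
      unfolding UC by (rule suminf_emeasure[symmetric]) (use Cm \<open>disjoint_family (\<lambda>n. ?s n ` Bn n)\<close> in auto)
    also have "\<dots> = (\<Sum>n. emeasure V (Bn n))" by (simp only: eq)
    also have "\<dots> = emeasure V (\<Union>n. Bn n)"
      by (rule suminf_emeasure) (use Bm \<open>disjoint_family Bn\<close> in auto)
    also have "\<dots> = emeasure V B" by (simp only: UB[symmetric])
    finally show ?thesis using 1 by simp
  qed
qed

text \<open>A closed curve is covered by the parameter intervals (0, L) and (- L/2, L/2), each
  shorter than a full turn by one point.\<close>

lemma two_charts: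
  obtains I0 I1 where "open I0" "I0 \<subseteq> J" "inj_on \<Gamma> I0" "open I1" "I1 \<subseteq> J" "inj_on \<Gamma> I1"
    "carr M \<subseteq> \<sigma> ` chart_dom I0 \<union> \<sigma> ` chart_dom I1"
proof (cases "L = 0")
  case True
  then have "inj_on \<Gamma> J" using period by (auto simp: inj_on_def)
  then show ?thesis using that[of J J] J(1) carr_M by auto
next
  case False
  then have Lp: "L > 0" and J: "J = UNIV" using L by auto
  have "carr M \<subseteq> \<sigma> ` chart_dom {0<..<0 + L} \<union> \<sigma> ` chart_dom {- L/2<..<- L/2 + L}"
  proof
    fix p assume "p \<in> carr M"
    then obtain x where x: "p = \<sigma> x" unfolding carr_M by auto
    let ?k = "- \<lfloor>x$1 / L\<rfloor>"
    let ?y = "x + (of_int ?k * L) *\<^sub>R axis 1 1"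
    have "0 \<le> x$1 + of_int ?k * L" "x$1 + of_int ?k * L < L"
      using floor_shift[OF Lp, of "x$1"] by auto
    then have "?y $ 1 \<in> {0<..<0+L} \<union> {- L/2<..<- L/2 + L}" unfolding shift_nth using Lp by auto
    moreover have "p = \<sigma> ?y" using x \<sigma>_shift[of x ?k] J by simp
    ultimately show "p \<in> \<sigma> ` chart_dom {0<..<0 + L} \<union> \<sigma> ` chart_dom {- L/2<..<- L/2 + L}"
      by (metis (mono_tags, lifting) Un_iff imageI mem_Collect_eq)
  qed
  then show ?thesis
    using that[of "{0<..<0 + L}" "{- L/2<..<- L/2 + L}"] inj_on_interval[OF Lp, of 0] inj_on_interval[OF Lp, of "- L/2"] J
    by auto
qed

lemma emeasure_V_chart:
  assumes "I \<subseteq> J" "B \<in> sets borel" "B \<subseteq> chart_dom I"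
  shows "(\<integral>\<^sup>+x\<in>B. ennreal (vol_density (gmetric M \<sigma>) x) \<partial>lborel) = emeasure V B"
proof -
  have "emeasure V B = (\<integral>\<^sup>+x. ennreal (dens x) * indicator B x \<partial>lborel)"
    unfolding V_def using assms(2) by (intro emeasure_density) auto
  also have "\<dots> = (\<integral>\<^sup>+x\<in>B. ennreal (vol_density (gmetric M \<sigma>) x) \<partial>lborel)"
  proof (intro nn_integral_cong)
    fix x
    show "ennreal (dens x) * indicator B x = ennreal (vol_density (gmetric M \<sigma>) x) * indicator B x"
    proof (cases "x \<in> B")
      case True
      then have "x$1 \<in> J" using assms by auto
      then show ?thesis by (simp add: dens_def vol_density_frame_metric[OF Q_pos gmetric_M])
    qed simp
  qed
  finally show ?thesis by simp
qed

lemma sets_\<mu>: "sets \<mu> = sets BM" by (simp add: \<mu>_def)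

text \<open>\<open>THE\<close> requires uniqueness. A measurable set is split into its part in one
  chart and the rest, which lies in a second chart; on both the prescribed formula determines the
  measure.\<close>

lemma riem_volume_M: "riem_volume M = \<mu>"
  unfolding riem_volume_def
proof (rule the_equality)
  show "sets \<mu> = sets (sigma (carr M) {W. openin (mtop M) W}) \<and>
     (\<forall>(U, \<tau>)\<in>atlas M. \<forall>B\<in>sets borel. B \<subseteq> U \<longrightarrow>
        emeasure \<mu> (\<tau> ` B) = (\<integral>\<^sup>+x\<in>B. ennreal (vol_density (gmetric M \<tau>) x) \<partial>lborel))"
  proof (intro conjI)
    show "sets \<mu> = sets (sigma (carr M) {W. openin (mtop M) W})" using sets_\<mu> by (simp add: BM_def)
    show "\<forall>(U, \<tau>)\<in>atlas M. \<forall>B\<in>sets borel. B \<subseteq> U \<longrightarrow>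
        emeasure \<mu> (\<tau> ` B) = (\<integral>\<^sup>+x\<in>B. ennreal (vol_density (gmetric M \<tau>) x) \<partial>lborel)"
    proof clarify
      fix U \<tau> B assume "(U, \<tau>) \<in> atlas M" and B: "B \<in> sets borel" "B \<subseteq> U"
      then obtain I where I: "U = chart_dom I" "\<tau> = \<sigma>" "open I" "I \<subseteq> J" "inj_on \<Gamma> I" by (auto simp: atlas_M)
      have B': "B \<subseteq> chart_dom I" using B(2) unfolding I(1) .
      show "emeasure \<mu> (\<tau> ` B) = (\<integral>\<^sup>+x\<in>B. ennreal (vol_density (gmetric M \<tau>) x) \<partial>lborel)"
        unfolding I(2) emeasure_\<mu>_image[OF I(3-5) B(1) B'] emeasure_V_chart[OF I(4) B(1) B'] ..
    qed
  qed
next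
  fix \<nu> :: "eh_point measure"
  assume \<nu>: "sets \<nu> = sets (sigma (carr M) {W. openin (mtop M) W}) \<and>
     (\<forall>(U, \<tau>)\<in>atlas M. \<forall>B\<in>sets borel. B \<subseteq> U \<longrightarrow>
        emeasure \<nu> (\<tau> ` B) = (\<integral>\<^sup>+x\<in>B. ennreal (vol_density (gmetric M \<tau>) x) \<partial>lborel))"
  have sets: "sets \<nu> = sets BM" using \<nu> by (simp add: BM_def)
  have agree: "emeasure \<nu> (\<sigma> ` B) = emeasure \<mu> (\<sigma> ` B)"
    if "open I" "I \<subseteq> J" "inj_on \<Gamma> I" "B \<in> sets borel" "B \<subseteq> chart_dom I" for I B
  proof -
    have "(chart_dom I, \<sigma>) \<in> atlas M" using that by (auto simp: atlas_M)
    then have "emeasure \<nu> (\<sigma> ` B) = (\<integral>\<^sup>+x\<in>B. ennreal (vol_density (gmetric M \<sigma>) x) \<partial>lborel)"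
      using bspec[OF conjunct2[OF \<nu>], of "(chart_dom I, \<sigma>)"] that(4,5) by simp
    then show ?thesis
      unfolding emeasure_\<mu>_image[OF that] emeasure_V_chart[OF that(2,4,5)] .
  qed
  have chart_set: "emeasure \<nu> A = emeasure \<mu> A"
    if I: "open I" "I \<subseteq> J" "inj_on \<Gamma> I" and A: "A \<in> sets BM" "A \<subseteq> \<sigma> ` chart_dom I" for I A
  proof -
    define B where "B = {x \<in> chart_dom I. \<sigma> x \<in> A}"
    have "\<sigma> \<in> measurable (restrict_space borel (chart_dom I)) BM"
      by (rule \<sigma>_measurable_on) (use I(2) open_chart_dom[OF I(1)] in auto)
    note meas = measurable_sets[OF this A(1)]
    have "\<sigma> -` A \<inter> space (restrict_space borel (chart_dom I)) = B"
      by (auto simp: B_def space_restrict_space)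
    with meas have "B \<in> sets borel"
      using open_chart_dom[OF I(1)] by (simp add: sets_restrict_space_iff)
    moreover have "A = \<sigma> ` B" using A(2) by (auto simp: B_def)
    moreover have "B \<subseteq> chart_dom I" by (auto simp: B_def)
    ultimately show ?thesis using agree[OF I, of B] by simp
  qed
  obtain I0 I1 where I: "open I0" "I0 \<subseteq> J" "inj_on \<Gamma> I0" "open I1" "I1 \<subseteq> J" "inj_on \<Gamma> I1"
    "carr M \<subseteq> \<sigma> ` chart_dom I0 \<union> \<sigma> ` chart_dom I1" by (rule two_charts)
  have U0: "\<sigma> ` chart_dom I0 \<in> sets BM"
    by (rule \<sigma>_image_sets[OF I(1-3)]) (use open_chart_dom[OF I(1)] in auto)
  show "\<nu> = \<mu>"
  proof (rule measure_eqI)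
    show "sets \<nu> = sets \<mu>" using sets sets_\<mu> by simp
    fix A assume "A \<in> sets \<nu>"
    then have A: "A \<in> sets BM" using sets by simp
    let ?A0 = "A \<inter> \<sigma> ` chart_dom I0" and ?A1 = "A - \<sigma> ` chart_dom I0"
    have m: "?A0 \<in> sets BM" "?A1 \<in> sets BM" using A U0 by auto
    have "A \<subseteq> carr M" using sets.sets_into_space[OF A] by (simp add: space_BM)
    then have "?A1 \<subseteq> \<sigma> ` chart_dom I1" using I(7) by blast
    then have "emeasure \<nu> ?A0 = emeasure \<mu> ?A0" "emeasure \<nu> ?A1 = emeasure \<mu> ?A1"
      by (intro chart_set[OF I(1-3) m(1)] chart_set[OF I(4-6) m(2)]; blast)+
    moreover have "emeasure N A = emeasure N ?A0 + emeasure N ?A1" if "sets N = sets BM" for N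
    proof -
      have "emeasure N ?A0 + emeasure N ?A1 = emeasure N (?A0 \<union> ?A1)"
        by (rule plus_emeasure) (use m that in auto)
      also have "?A0 \<union> ?A1 = A" by auto
      finally show ?thesis by simp
    qed
    ultimately show "emeasure \<nu> A = emeasure \<mu> A" using sets sets_\<mu> by simp
  qed
qed

lemma continuous_imp_borel_BM:
  assumes "continuous_map (mtop M) euclideanreal f" shows "f \<in> borel_measurable BM"
proof (rule borel_measurableI)
  fix T :: "real set" assume "open T"
  then have "openin (mtop M) {p \<in> carr M. f p \<in> T}"
    using assms by (simp add: openin_continuous_map_preimage)
  moreover have "f -` T \<inter> space BM = {p \<in> carr M. f p \<in> T}" by (auto simp: space_BM)
  ultimately show "f -` T \<inter> space BM \<in> sets BM" by (simp add: open_sets_BM)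
qed

lemma nn_integral_\<mu>:
  assumes g: "g \<in> borel_measurable BM"
  shows "(\<integral>\<^sup>+p. g p \<partial>riem_volume M) = (\<integral>\<^sup>+x. g (\<sigma> x) * indicator D x * ennreal (sqrt (Q x)) \<partial>lborel)"
proof -
  have g\<sigma>: "(\<lambda>x. g (\<sigma> x)) \<in> borel_measurable (restrict_space V D)"
    using measurable_compose[OF \<sigma>_measurable g] .
  then have m: "(\<lambda>x. g (\<sigma> x) * indicator D x) \<in> borel_measurable V"
    by (subst (asm) borel_measurable_restrict_space_iff_ennreal) auto
  have m': "(\<lambda>x. g (\<sigma> x) * indicator D x) \<in> borel_measurable borel"
    using m unfolding measurable_cong_sets[OF sets_V refl] .
  have "(\<integral>\<^sup>+p. g p \<partial>riem_volume M) = (\<integral>\<^sup>+x. g (\<sigma> x) \<partial>restrict_space V D)"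
    unfolding riem_volume_M \<mu>_def by (rule nn_integral_distr[OF \<sigma>_measurable]) (use g in simp)
  also have "\<dots> = (\<integral>\<^sup>+x. g (\<sigma> x) * indicator D x \<partial>V)"
    by (rule nn_integral_restrict_space) auto
  also have "\<dots> = (\<integral>\<^sup>+x. ennreal (dens x) * (g (\<sigma> x) * indicator D x) \<partial>lborel)"
    unfolding V_def by (rule nn_integral_density) (use m' in simp_all)
  also have "\<dots> = (\<integral>\<^sup>+x. g (\<sigma> x) * indicator D x * ennreal (sqrt (Q x)) \<partial>lborel)"
    using D_sub by (intro nn_integral_cong) (auto simp: indicator_def dens_def mult.commute)
  finally show ?thesis .
qed

end

section \<open>Test functions and Green's formula\<close>

text \<open>Only the origin needs care: there the difference quotient is bounded by
  |h|^(n+1).\<close>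

lemma DERIV_max_power:
  "((\<lambda>y::real. (max 0 y) ^ Suc (Suc n)) has_real_derivative real (Suc (Suc n)) * (max 0 y) ^ Suc n) (at y)"
proof -
  consider "y > 0" | "y < 0" | "y = 0" by linarith
  then show ?thesis
  proof cases
    case 1
    have "((\<lambda>y::real. y ^ Suc (Suc n)) has_real_derivative real (Suc (Suc n)) * y ^ Suc n) (at y)"
      by (rule DERIV_cong[OF DERIV_pow]) simp
    then have "((\<lambda>y::real. (max 0 y) ^ Suc (Suc n)) has_real_derivative real (Suc (Suc n)) * y ^ Suc n) (at y)"
      by (rule has_field_derivative_transform_within_open[of _ _ _ "{0<..}"]) (use 1 in \<open>auto simp: max_def\<close>)
    then show ?thesis using 1 by (simp add: max_def)
  next
    case 2
    have "((\<lambda>y::real. 0) has_real_derivative 0) (at y)" by simp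
    then have "((\<lambda>y::real. (max 0 y) ^ Suc (Suc n)) has_real_derivative 0) (at y)"
      by (rule has_field_derivative_transform_within_open[of _ _ _ "{..<0}"]) (use 2 in \<open>auto simp: max_def\<close>)
    then show ?thesis using 2 by (simp add: max_def)
  next
    case 3
    have "((\<lambda>h::real. (max 0 h) ^ Suc (Suc n) / h) \<longlongrightarrow> 0) (at 0)"
    proof (rule Lim_null_comparison)
      show "\<forall>\<^sub>F h in at 0. norm ((max 0 h) ^ Suc (Suc n) / h) \<le> \<bar>h :: real\<bar> ^ Suc n"
      proof (rule always_eventually, rule allI)
        show "norm ((max 0 h) ^ Suc (Suc n) / h) \<le> \<bar>h :: real\<bar> ^ Suc n" for h :: real
          by (cases "h > 0") (simp_all add: max_def del: power_Suc, simp add: power_Suc[of h "Suc n"])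
      qed
      have "((\<lambda>h::real. \<bar>h\<bar> ^ Suc n) \<longlongrightarrow> \<bar>0\<bar> ^ Suc n) (at 0)" by (intro tendsto_intros)
      then show "((\<lambda>h::real. \<bar>h\<bar> ^ Suc n) \<longlongrightarrow> 0) (at 0)" by simp
    qed
    then show ?thesis using 3 by (simp add: DERIV_def)
  qed
qed

text \<open>A C2 spline: \<open>bend\<close> equals \<open>- y\<close> for \<open>y \<le> - 1\<close> and \<open>0\<close> for \<open>y \<ge> 1\<close>, and its second
  derivative is the tent function on \<open>[- 1, 1]\<close>.\<close>

definition bend :: "real \<Rightarrow> real" where
  "bend y = ((max 0 (1 - y)) ^ 3 - 2 * (max 0 (- y)) ^ 3 + (max 0 (- 1 - y)) ^ 3) / 6"
definition bend' :: "real \<Rightarrow> real" where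
  "bend' y = - ((max 0 (1 - y))\<^sup>2 - 2 * (max 0 (- y))\<^sup>2 + (max 0 (- 1 - y))\<^sup>2) / 2"
definition bend'' :: "real \<Rightarrow> real" where
  "bend'' y = max 0 (1 - y) - 2 * max 0 (- y) + max 0 (- 1 - y)"

lemma DERIV_bend: "(bend has_real_derivative bend' y) (at y)"
proof -
  have d: "((\<lambda>y. (max 0 (a - y)) ^ 3) has_real_derivative - 3 * (max 0 (a - y))\<^sup>2) (at y)" for a :: real
  proof -
    have "((\<lambda>y. (max 0 (a - y)) ^ Suc (Suc 1)) has_real_derivative
        real (Suc (Suc 1)) * (max 0 (a - y)) ^ Suc 1 * (- 1)) (at y)"
      by (rule DERIV_chain2[where f = "\<lambda>z. (max 0 z) ^ Suc (Suc 1)" and g = "\<lambda>y. a - y", OF DERIV_max_power])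
        (auto intro!: derivative_eq_intros)
    then show ?thesis by (simp add: numeral_3_eq_3 numeral_2_eq_2)
  qed
  from DERIV_cdivide[OF DERIV_add[OF DERIV_diff[OF d[of 1] DERIV_cmult[OF d[of 0], of 2]] d[of "- 1"]], of 6]
  show ?thesis unfolding bend_def[abs_def] bend'_def diff_0
    by (rule DERIV_cong) (simp add: field_simps)
qed

lemma DERIV_bend': "(bend' has_real_derivative bend'' y) (at y)"
proof -
  have d: "((\<lambda>y. (max 0 (a - y))\<^sup>2) has_real_derivative - 2 * (max 0 (a - y))) (at y)" for a :: real
  proof -
    have "((\<lambda>y. (max 0 (a - y)) ^ Suc (Suc 0)) has_real_derivative
        real (Suc (Suc 0)) * (max 0 (a - y)) ^ Suc 0 * (- 1)) (at y)"
      by (rule DERIV_chain2[where f = "\<lambda>z. (max 0 z) ^ Suc (Suc 0)" and g = "\<lambda>y. a - y", OF DERIV_max_power])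
        (auto intro!: derivative_eq_intros)
    then show ?thesis by (simp add: numeral_2_eq_2)
  qed
  from DERIV_cdivide[OF DERIV_minus[OF DERIV_add[OF DERIV_diff[OF d[of 1] DERIV_cmult[OF d[of 0], of 2]] d[of "- 1"]]], of 2]
  show ?thesis unfolding bend'_def[abs_def] bend''_def diff_0
    by (rule DERIV_cong) (simp add: field_simps)
qed

lemma bend'': "0 \<le> bend'' y" "bend'' y \<le> 1" "\<bar>y\<bar> \<ge> 1 \<Longrightarrow> bend'' y = 0" "bend'' 0 = 1"
  by (auto simp: bend''_def max_def)

lemma bend_far: "y \<ge> 1 \<Longrightarrow> bend y = 0" "y \<ge> 1 \<Longrightarrow> bend' y = 0" "y \<le> - 1 \<Longrightarrow> bend' y = - 1"
  by (auto simp: bend_def bend'_def max_def power2_eq_square algebra_simps)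

lemma bend'_mono: "x \<le> y \<Longrightarrow> bend' x \<le> bend' y"
  by (rule DERIV_nonneg_imp_nondecreasing[where f = bend']) (use DERIV_bend' bend''(1) in auto)

lemma bend'_bounds: "- 1 \<le> bend' y" "bend' y \<le> 0"
  using bend'_mono[of "min y (- 1)" y] bend'_mono[of y "max y 1"]
  by (simp_all add: bend_far)

text \<open>The first bend occupies the interval from a + 1 to a + 1 + 2 T. The factor
  \<open>T\<close> gives it slope - 1 on its left, which cancels against the second bend left of a -
  1. So the graph is the constant T + 1 up to a - 1, has slope - 1 at a + 1 and is 0 from a + 1 + 2
  T on.\<close>

definition cutoff :: "real \<Rightarrow> real \<Rightarrow> real \<Rightarrow> real" where
  "cutoff a T r = T * bend ((r - (a + 1 + T)) / T) - bend (r - a)"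
definition cutoff' :: "real \<Rightarrow> real \<Rightarrow> real \<Rightarrow> real" where
  "cutoff' a T r = bend' ((r - (a + 1 + T)) / T) - bend' (r - a)"
definition cutoff'' :: "real \<Rightarrow> real \<Rightarrow> real \<Rightarrow> real" where
  "cutoff'' a T r = bend'' ((r - (a + 1 + T)) / T) / T - bend'' (r - a)"

lemma DERIV_cutoff:
  assumes "T > 0"
  shows "(cutoff a T has_real_derivative cutoff' a T r) (at r)" "(cutoff' a T has_real_derivative cutoff'' a T r) (at r)"
proof -
  have 1: "((\<lambda>r. (r - (a + 1 + T)) / T) has_real_derivative 1 / T) (at r)" "((\<lambda>r. r - a) has_real_derivative 1) (at r)"
    using assms by (auto intro!: derivative_eq_intros)
  show "(cutoff a T has_real_derivative cutoff' a T r) (at r)"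
    using DERIV_diff[OF DERIV_cmult[OF DERIV_chain2[OF DERIV_bend 1(1)], of T] DERIV_chain2[OF DERIV_bend 1(2)]] assms
    by (simp add: cutoff_def[abs_def] cutoff'_def)
  show "(cutoff' a T has_real_derivative cutoff'' a T r) (at r)"
    using DERIV_diff[OF DERIV_chain2[OF DERIV_bend' 1(1)] DERIV_chain2[OF DERIV_bend' 1(2)]]
    by (simp add: cutoff'_def[abs_def] cutoff''_def)
qed

lemma Ck_on_cutoff: "T > 0 \<Longrightarrow> Ck_on 2 UNIV (cutoff a T)"
proof -
  assume T: "T > 0"
  have "continuous_on UNIV (cutoff'' a T)"
    unfolding cutoff''_def[abs_def] bend''_def by (intro continuous_intros) (use T in auto)
  then have "Ck_on (Suc 0) UNIV (cutoff' a T)"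
    by (rule_tac Ck_on_SucI_real) (use DERIV_cutoff(2)[OF T] in \<open>auto simp: has_real_derivative_iff_has_vector_derivative\<close>)
  then have "Ck_on (Suc (Suc 0)) UNIV (cutoff a T)"
    by (rule_tac Ck_on_SucI_real[of UNIV _ "cutoff' a T"])
      (use DERIV_cutoff(1)[OF T] in \<open>auto simp: has_real_derivative_iff_has_vector_derivative simp del: Ck_on.simps\<close>)
  then show ?thesis by (simp only: numeral_2_eq_2)
qed

lemma cutoff_far: "T > 0 \<Longrightarrow> r \<ge> a + 1 + 2 * T \<Longrightarrow> cutoff a T r = 0"
  unfolding cutoff_def by (subst (1 2) bend_far(1)) (auto simp: field_simps)

text \<open>Up to a + 1 the first bend has slope - 1, the least value that the slope of the second
  can take; beyond a + 1 the second slope is 0.\<close>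

lemma cutoff'_nonpos:
  assumes "T > 0" shows "cutoff' a T r \<le> 0"
proof (cases "r \<le> a + 1")
  case True
  then have "(r - (a + 1 + T)) / T \<le> - 1" using assms by (simp add: field_simps)
  then show ?thesis using bend'_bounds(1)[of "r - a"] by (simp add: cutoff'_def bend_far)
next
  case False
  then show ?thesis using bend'_bounds(2) by (simp add: cutoff'_def bend_far)
qed

lemma cutoff_nonneg:
  assumes "T > 0" shows "cutoff a T r \<ge> 0"
proof -
  have "cutoff a T (max r (a + 1 + 2 * T)) \<le> cutoff a T r"
    by (rule DERIV_nonpos_imp_nonincreasing[where f = "cutoff a T"]) (simp, use DERIV_cutoff(1)[OF assms] cutoff'_nonpos[OF assms] in blast)
  then show ?thesis using cutoff_far[OF assms, of a "max r (a + 1 + 2 * T)"] by simp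
qed

lemma partial_periodic:
  assumes "\<And>x::real^3. F (x + a) = F x" "F differentiable (at (x + a))"
  shows "partial i F (x + a) = partial i F x"
proof -
  have "((\<lambda>y. y + a) has_derivative (\<lambda>v. v)) (at x)" by (auto intro!: derivative_eq_intros)
  from has_derivative_compose[OF this assms(2)[unfolded frechet_derivative_works]]
  have "(F has_derivative frechet_derivative F (at (x + a))) (at x)" by (simp add: assms(1))
  then show ?thesis using partial_eqI by (simp add: partial_def)
qed

lemma partial_zero_open:
  assumes "open O'" "x \<in> O'" "\<And>y. y \<in> O' \<Longrightarrow> F y = 0" shows "partial i F x = 0"
  using partial_cong_open[OF assms(1,2), of F "\<lambda>_. 0" i] assms(3) partial_eqI[OF has_derivative_const, of i 0 x] by simp

section \<open>Green's formula and the weak inequality for limits of subharmonic functions\<close>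

context eh_exhaustion begin

lemma \<phi>c_shift: "x$1 \<in> J \<Longrightarrow> \<phi>c (x + (of_int k * L) *\<^sub>R axis 1 1) = \<phi>c x"
  using c_period by (simp add: \<phi>c_def frame_shift shift_nth)

text \<open>The half-open \<open>D\<close> is not closed when L > 0, so the closed period [0, L] is
  used in its place. A compact set inside \<open>chart_dom J\<close> makes every continuous function
  cut off at a level of \<open>\<phi>c\<close> integrable.\<close>

lemma box_D:
  "\<exists>C. compact C \<and> C \<subseteq> chart_dom J \<and> (\<forall>x\<in>D. \<phi>c x \<le> \<tau> \<longrightarrow> x \<in> C)"
proof (cases "L = 0")
  case True
  obtain a b where ab: "{a..b} \<subseteq> J" "\<And>s. s \<in> J \<Longrightarrow> c s \<le> \<tau> \<Longrightarrow> s \<in> {a..b}"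
    using c_proper[of \<tau>] True by auto
  show ?thesis
  proof (intro exI[of _ "box3 a b (\<tau>\<^sup>2)"] conjI ballI impI)
    show "box3 a b (\<tau>\<^sup>2) \<subseteq> chart_dom J" using ab(1) by (auto simp: box3)
    fix x assume "x \<in> D" "\<phi>c x \<le> \<tau>"
    then show "x \<in> box3 a b (\<tau>\<^sup>2)" using sublevel_bound[of x \<tau>] ab(2)[of "x$1"] D_sub by (auto simp: box3)
  qed (rule compact_box3)
next
  case False
  then have J: "J = UNIV" "L > 0" using L by auto
  show ?thesis
  proof (intro exI[of _ "box3 0 L (\<tau>\<^sup>2)"] conjI ballI impI)
    fix x assume x: "x \<in> D" "\<phi>c x \<le> \<tau>"
    then show "x \<in> box3 0 L (\<tau>\<^sup>2)" using sublevel_bound[of x \<tau>] D_sub J unfolding D_def box3 by auto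
  qed (use compact_box3 J in auto)
qed

lemma integrable_D:
  fixes G :: "real^3 \<Rightarrow> real"
  assumes "continuous_on (chart_dom J) G" "\<And>x. x \<in> D \<Longrightarrow> \<phi>c x > \<tau> \<Longrightarrow> G x = 0"
  shows "integrable lborel (\<lambda>x. indicator D x * G x)"
proof -
  obtain C where C: "compact C" "C \<subseteq> chart_dom J" "\<And>x. x \<in> D \<Longrightarrow> \<phi>c x \<le> \<tau> \<Longrightarrow> x \<in> C"
    using box_D[of \<tau>] by blast
  show ?thesis
    by (rule integrable_indicator_bounded_support[OF D_borel C(1) continuous_on_subset[OF assms(1) C(2)]])
      (use C(3) assms(2) in force)
qed

abbreviation "flx \<equiv> flux Q m1 m2"

lemma continuous_div_flx:
  assumes "Ck_on 2 (chart_dom J) F" shows "continuous_on (chart_dom J) (divergence (flx F))"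
proof -
  have F: "Ck_on (Suc 1) (chart_dom J) F" using assms by (simp add: numeral_2_eq_2)
  have "Ck_on 1 (chart_dom J) (\<lambda>x. flx F x $ i)" for i
    by (rule Ck_on_flux[OF open_J3 Q_Ck Q_pos m_Ck F])
  then have "Ck_on 0 (chart_dom J) (partial i (\<lambda>x. flx F x $ i))" for i
    by (intro Ck_on_partial) simp
  then show ?thesis unfolding divergence_def[abs_def] by (intro continuous_on_sum) simp
qed

lemma flux_zero_open:
  assumes "open O'" "x \<in> O'" "\<And>y. y \<in> O' \<Longrightarrow> F y = 0" shows "flx F x = 0"
proof -
  have "partial i F x = 0" for i by (rule partial_zero_open[OF assms])
  then show ?thesis by (simp add: vec_eq_iff forall_3 flux_component horizontal_def)
qed

lemma open_superlevel: "open {x. x$1 \<in> J \<and> \<phi>c x > \<tau>}"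
proof -
  have "open (chart_dom J \<inter> \<phi>c -` {\<tau><..})"
    by (rule continuous_open_preimage[OF Ck_on_imp_continuous_on[OF \<phi>c_Ck[of 0]] open_J3]) simp
  moreover have "{x. x$1 \<in> J \<and> \<phi>c x > \<tau>} = chart_dom J \<inter> \<phi>c -` {\<tau><..}" by auto
  ultimately show ?thesis by simp
qed

lemma flux_zero_superlevel:
  assumes "\<And>y. y$1 \<in> J \<Longrightarrow> \<phi>c y > \<tau> \<Longrightarrow> F y = 0" "x$1 \<in> J" "\<phi>c x > \<tau>"
  shows "flx F x = 0" "divergence (flx F) x = 0"
proof -
  have x: "x \<in> {x. x$1 \<in> J \<and> \<phi>c x > \<tau>}" using assms(2,3) by simp
  have z: "flx F y = 0" if "y \<in> {x. x$1 \<in> J \<and> \<phi>c x > \<tau>}" for y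
    by (rule flux_zero_open[OF open_superlevel that]) (use assms(1) in auto)
  show "flx F x = 0" by (rule z[OF x])
  have "partial i (\<lambda>x. flx F x $ i) x = 0" for i
    by (rule partial_zero_open[OF open_superlevel x]) (simp add: z)
  then show "divergence (flx F) x = 0" by (simp add: divergence_def)
qed

text \<open>Green's formula on the fundamental domain \<open>D\<close>: there are no boundary terms, by compact
  support for \<open>L = 0\<close> and by periodicity for \<open>L > 0\<close>.\<close>

lemma integral_subharmonic_test_nonneg:
  assumes H: "Ck_on 2 (chart_dom J) H" "\<And>x. L > 0 \<Longrightarrow> H (x + L *\<^sub>R axis 1 1) = H x"
      "\<And>x. x$1 \<in> J \<Longrightarrow> divergence (flx H) x \<ge> 0"
    and F: "Ck_on 2 (chart_dom J) F" "\<And>x. L > 0 \<Longrightarrow> F (x + L *\<^sub>R axis 1 1) = F x"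
      "\<And>x. x$1 \<in> J \<Longrightarrow> F x \<ge> 0" "\<And>x. x$1 \<in> J \<Longrightarrow> \<phi>c x > \<tau> \<Longrightarrow> F x = 0"
  shows "(\<integral>x. indicator D x * (H x * divergence (flx F) x) \<partial>lborel) \<ge> 0"
proof -
  \<comment> \<open>The field of Green's identity. It vanishes where \<open>F\<close> vanishes on an
    open set, so it inherits the bounded fibre support of \<open>F\<close>.\<close>
  define X where "X x = H x *\<^sub>R flx F x - F x *\<^sub>R flx H x" for x
  have Suc: "Ck_on (Suc 1) (chart_dom J) H" "Ck_on (Suc 1) (chart_dom J) F"
    using H(1) F(1) by (simp_all add: numeral_2_eq_2)
  have 1: "Ck_on 1 (chart_dom J) H" "Ck_on 1 (chart_dom J) F" using Suc Ck_on_Suc_imp by blast+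
  have fl: "Ck_on 1 (chart_dom J) (\<lambda>x. flx H x $ i)" "Ck_on 1 (chart_dom J) (\<lambda>x. flx F x $ i)" for i
    by (rule Ck_on_flux[OF open_J3 Q_Ck Q_pos m_Ck], rule Suc)+
  have XCk: "Ck_on 1 (chart_dom J) (\<lambda>x. X x $ i)" for i
  proof -
    have "Ck_on 1 (chart_dom J) (\<lambda>x. H x * flx F x $ i - F x * flx H x $ i)"
      by (intro Ck_on_diff Ck_on_mult open_J3 1 fl)
    then show ?thesis by (simp add: X_def)
  qed
  let ?O = "{x. x$1 \<in> J \<and> \<phi>c x > \<tau>}"
  have flF0: "flx F x = 0" if "x \<in> ?O" for x
    by (rule flux_zero_superlevel(1)[OF F(4)]) (use that in auto)
  have X0: "X x = 0" if "x \<in> ?O" for x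
    using flF0[OF that] F(4) that by (simp add: X_def)
  have pX0: "partial i (\<lambda>x. X x $ i) x = 0" if "x \<in> ?O" for i x
    by (rule partial_zero_open[OF open_superlevel that]) (simp add: X0)
  have int0: "(\<integral>x. indicator D x * partial i (\<lambda>x. X x $ i) x \<partial>lborel) = 0" for i
  proof (cases "L = 0")
    case True
    then have D: "D = chart_dom J" unfolding D_def by simp
    obtain C where C: "compact C" "C \<subseteq> chart_dom J" "\<And>x. x \<in> D \<Longrightarrow> \<phi>c x \<le> \<tau> \<Longrightarrow> x \<in> C"
      using box_D[of \<tau>] by blast
    have "X x $ i = 0" if "x \<in> chart_dom J" "x \<notin> C" for x
      using X0[of x] C(3)[of x] that D by force
    then show ?thesis unfolding D by (rule integral_partial_compact_support[OF open_J3 C(1,2) XCk])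
  next
    case False
    then have Lp: "L > 0" and J: "J = UNIV" using L by auto
    have UN: "chart_dom J = UNIV" using J by simp
    have D: "D = {x. 0 \<le> x$1 \<and> x$1 < L}" unfolding D_def using J Lp by auto
    have per: "Q (x + L *\<^sub>R axis 1 1) = Q x" "m1 (x + L *\<^sub>R axis 1 1) = m1 x" "m2 (x + L *\<^sub>R axis 1 1) = m2 x" for x
      using frame_shift[of x 1] J by auto
    have pp: "partial j H (x + L *\<^sub>R axis 1 1) = partial j H x" "partial j F (x + L *\<^sub>R axis 1 1) = partial j F x" for j x
      using partial_periodic[where F = H and a = "L *\<^sub>R axis 1 1" and i = j and x = x]
        partial_periodic[where F = F and a = "L *\<^sub>R axis 1 1" and i = j and x = x] H(2)[OF Lp] F(2)[OF Lp] 1 UN by simp_all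
    have fp: "flx H (x + L *\<^sub>R axis 1 1) = flx H x" "flx F (x + L *\<^sub>R axis 1 1) = flx F x" for x
      by (simp_all only: flux_def horizontal_def per pp)
    have Xp: "X (x + L *\<^sub>R axis 1 1) $ i = X x $ i" for x
      by (simp only: X_def H(2)[OF Lp] F(2)[OF Lp] fp)
    have supp: "\<bar>x$2\<bar> \<le> \<tau>\<^sup>2 \<and> \<bar>x$3\<bar> \<le> \<tau>\<^sup>2" if "X x $ i \<noteq> 0" for x
      using X0[of x] sublevel_bound[of x \<tau>] that J by force
    show ?thesis unfolding D
      using integral_partial_periodic[where Z = "\<lambda>x. X x $ i" and R = "\<tau>\<^sup>2", OF Lp] Xp supp XCk UN by simp
  qed
  have cont: "continuous_on (chart_dom J) (partial i (\<lambda>x. X x $ i))" for i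
    using Ck_on_partial[of 0 "chart_dom J" "\<lambda>x. X x $ i" i] XCk by simp
  have DJ: "x \<in> D \<Longrightarrow> x$1 \<in> J" for x using D_sub by auto
  have intX: "integrable lborel (\<lambda>x. indicator D x * partial i (\<lambda>x. X x $ i) x)" for i
    by (rule integrable_D[OF cont, of \<tau>]) (use pX0 DJ in auto)
  have div: "divergence X x = H x * divergence (flx F) x - F x * divergence (flx H) x" if "x$1 \<in> J" for x
    unfolding X_def[abs_def]
    by (rule divergence_Green[OF open_J3 _ Q_Ck Q_pos m_Ck F(1) H(1)]) (use that in simp)
  have i1: "integrable lborel (\<lambda>x. indicator D x * (H x * divergence (flx F) x))"
  proof (rule integrable_D[of _ \<tau>])
    show "continuous_on (chart_dom J) (\<lambda>x. H x * divergence (flx F) x)"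
      by (intro continuous_on_mult continuous_div_flx[OF F(1)] Ck_on_imp_continuous_on[OF H(1)])
    fix x assume "x \<in> D" "\<phi>c x > \<tau>"
    then have "divergence (flx F) x = 0"
      using flux_zero_superlevel(2)[where F = F and \<tau> = \<tau> and x = x] F(4) DJ by blast
    then show "H x * divergence (flx F) x = 0" by simp
  qed
  have i2: "integrable lborel (\<lambda>x. indicator D x * (F x * divergence (flx H) x))"
    by (rule integrable_D[of _ \<tau>])
      (use F(4) DJ in \<open>auto intro!: continuous_on_mult continuous_div_flx[OF H(1)] Ck_on_imp_continuous_on[OF F(1)]\<close>)
  have "0 = (\<integral>x. (\<Sum>i\<in>UNIV. indicator D x * partial i (\<lambda>x. X x $ i) x) \<partial>lborel)"
    using intX int0 by (subst Bochner_Integration.integral_sum) auto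
  also have "\<dots> = (\<integral>x. indicator D x * (H x * divergence (flx F) x) - indicator D x * (F x * divergence (flx H) x) \<partial>lborel)"
  proof (rule Bochner_Integration.integral_cong[OF refl])
    fix x
    have "(\<Sum>i\<in>UNIV. indicator D x * partial i (\<lambda>x. X x $ i) x) = indicator D x * divergence X x"
      by (simp add: divergence_def sum_distrib_left)
    also have "\<dots> = indicator D x * (H x * divergence (flx F) x) - indicator D x * (F x * divergence (flx H) x)"
      using div DJ by (cases "x \<in> D") (auto simp: algebra_simps)
    finally show "(\<Sum>i\<in>UNIV. indicator D x * partial i (\<lambda>x. X x $ i) x) = indicator D x * (H x * divergence (flx F) x) - indicator D x * (F x * divergence (flx H) x)" .
  qed
  also have "\<dots> = (\<integral>x. indicator D x * (H x * divergence (flx F) x) \<partial>lborel) - (\<integral>x. indicator D x * (F x * divergence (flx H) x) \<partial>lborel)"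
    by (rule Bochner_Integration.integral_diff[OF i1 i2])
  finally have "(\<integral>x. indicator D x * (H x * divergence (flx F) x) \<partial>lborel) = (\<integral>x. indicator D x * (F x * divergence (flx H) x) \<partial>lborel)"
    by simp
  also have "\<dots> \<ge> 0" using F(3) H(3) DJ by (intro Bochner_Integration.integral_nonneg) (auto simp: indicator_def)
  finally show ?thesis .
qed

lemma continuous_on_comp_\<sigma>:
  assumes "continuous_map (mtop M) euclideanreal f" shows "continuous_on (chart_dom J) (f \<circ> \<sigma>)"
  using continuous_map_compose[OF continuous_map_\<sigma>[OF order_refl] assms] by simp

lemma \<sigma>_L: "L > 0 \<Longrightarrow> \<sigma> (x + L *\<^sub>R axis 1 1) = \<sigma> x"
  using \<sigma>_shift[of x 1] L(2) by simp

text \<open>An approximating subharmonic function is close to \<open>f\<close> only on a compact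
  set, but within \<open>D\<close> the divergence of the flux of \<open>F\<close> vanishes off such
  a set. The error is thus at most \<open>\<epsilon>\<close> times a constant independent of
  \<open>\<epsilon>\<close>.\<close>

lemma Sigma_test_nonneg:
  assumes f: "f \<in> Sigma_closure M"
    and F: "Ck_on 2 (chart_dom J) F" "\<And>x. L > 0 \<Longrightarrow> F (x + L *\<^sub>R axis 1 1) = F x"
      "\<And>x. x$1 \<in> J \<Longrightarrow> F x \<ge> 0" "\<And>x. x$1 \<in> J \<Longrightarrow> \<phi>c x > \<tau> \<Longrightarrow> F x = 0"
  shows "(\<integral>x. indicator D x * (f (\<sigma> x) * divergence (flx F) x) \<partial>lborel) \<ge> 0"
proof -
  let ?W = "divergence (flx F)"
  have DJ: "x \<in> D \<Longrightarrow> x$1 \<in> J" for x using D_sub by auto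
  obtain C where C: "compact C" "C \<subseteq> chart_dom J" "\<And>x. x \<in> D \<Longrightarrow> \<phi>c x \<le> \<tau> \<Longrightarrow> x \<in> C"
    using box_D[of \<tau>] by blast
  have W0: "?W x = 0" if "x \<in> D" "\<phi>c x > \<tau>" for x
    by (rule flux_zero_superlevel(2)[OF F(4)]) (use that DJ[OF that(1)] in auto)
  have Wc: "continuous_on (chart_dom J) ?W" by (rule continuous_div_flx[OF F(1)])
  have fc: "continuous_map (mtop M) euclideanreal f" using f by (simp add: Sigma_closure_def)
  have intfW: "integrable lborel (\<lambda>x. indicator D x * (f (\<sigma> x) * ?W x))"
    by (rule integrable_D[of _ \<tau>]) (use continuous_on_comp_\<sigma>[OF fc] Wc W0 in \<open>auto intro!: continuous_on_mult simp: comp_def\<close>)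
  have intW: "integrable lborel (\<lambda>x. indicator D x * \<bar>?W x\<bar>)"
    by (rule integrable_D[of _ \<tau>]) (use Wc W0 in \<open>auto intro!: continuous_intros\<close>)
  define A where "A = (\<integral>x. indicator D x * \<bar>?W x\<bar> \<partial>lborel)"
  have A0: "A \<ge> 0" unfolding A_def by (intro Bochner_Integration.integral_nonneg) auto
  have "- (\<epsilon> * A) \<le> (\<integral>x. indicator D x * (f (\<sigma> x) * ?W x) \<partial>lborel)" if \<epsilon>: "\<epsilon> > 0" for \<epsilon>
  proof -
    have "compactin (top_of_set (chart_dom J)) C" using C by (simp add: compactin_subtopology)
    then have "compactin (mtop M) (\<sigma> ` C)" by (rule image_compactin[OF _ continuous_map_\<sigma>[OF order_refl]])
    moreover have "\<forall>K \<epsilon>. compactin (mtop M) K \<and> 0 < \<epsilon> \<longrightarrow>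
        (\<exists>h. Cinf M h \<and> subharmonic_on M (carr M) h \<and> (\<forall>m\<in>K. \<bar>f m - h m\<bar> < \<epsilon>))"
      using f by (simp add: Sigma_closure_def)
    ultimately have "\<exists>h. Cinf M h \<and> subharmonic_on M (carr M) h \<and> (\<forall>m\<in>\<sigma> ` C. \<bar>f m - h m\<bar> < \<epsilon>)"
      using \<epsilon> by blast
    then obtain h where h: "Cinf M h" "subharmonic_on M (carr M) h" "\<And>m. m \<in> \<sigma> ` C \<Longrightarrow> \<bar>f m - h m\<bar> < \<epsilon>"
      by (elim exE conjE) (rule that, assumption, assumption, erule bspec, assumption)
    have hCk: "Ck_on k (chart_dom J) (h \<circ> \<sigma>)" for k
    proof (rule Ck_on_local)
      fix x assume "x \<in> chart_dom J"
      then have x: "x$1 \<in> J" by simp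
      obtain I where I: "open I" "I \<subseteq> J" "inj_on \<Gamma> I" "x$1 \<in> I" using ex_chart[OF x] .
      then have "(chart_dom I, \<sigma>) \<in> atlas M" by (auto simp: atlas_M)
      from bspec[OF h(1)[unfolded Cinf_def] this] have "Ck_on k (chart_dom I) (h \<circ> \<sigma>)" by (simp add: smooth_on_def)
      then show "\<exists>V. open V \<and> x \<in> V \<and> Ck_on k V (h \<circ> \<sigma>)"
        using open_chart_dom[OF I(1)] I(4) by blast
    qed
    have hdiv: "divergence (flx (h \<circ> \<sigma>)) x \<ge> 0" if x: "x$1 \<in> J" for x
    proof -
      obtain I where I: "open I" "I \<subseteq> J" "inj_on \<Gamma> I" "x$1 \<in> I" using ex_chart[OF x] .
      then have "(chart_dom I, \<sigma>) \<in> atlas M" by (auto simp: atlas_M)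
      from bspec[OF h(2)[unfolded subharmonic_on_def] this]
      have "laplace_coord (gmetric M \<sigma>) (h \<circ> \<sigma>) x \<le> 0" using I(4) x by (auto simp: carr_M)
      then show ?thesis
        unfolding laplace_coord_M[OF x hCk refl] using Q_pos[of x] by (simp add: zero_le_divide_iff)
    qed
    have nn: "(\<integral>x. indicator D x * ((h \<circ> \<sigma>) x * ?W x) \<partial>lborel) \<ge> 0"
      by (rule integral_subharmonic_test_nonneg[OF hCk _ hdiv F]) (simp add: \<sigma>_L)
    have inth: "integrable lborel (\<lambda>x. indicator D x * ((h \<circ> \<sigma>) x * ?W x))"
      by (rule integrable_D[of _ \<tau>]) (use Ck_on_imp_continuous_on[OF hCk] Wc W0 in \<open>auto intro!: continuous_on_mult\<close>)
    have "(\<integral>x. indicator D x * ((h \<circ> \<sigma>) x * ?W x) - \<epsilon> * (indicator D x * \<bar>?W x\<bar>) \<partial>lborel)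
        \<le> (\<integral>x. indicator D x * (f (\<sigma> x) * ?W x) \<partial>lborel)"
    proof (rule integral_mono)
      show "integrable lborel (\<lambda>x. indicator D x * ((h \<circ> \<sigma>) x * ?W x) - \<epsilon> * (indicator D x * \<bar>?W x\<bar>))"
        by (intro Bochner_Integration.integrable_diff inth integrable_mult_right intW)
      fix x
      show "indicator D x * ((h \<circ> \<sigma>) x * ?W x) - \<epsilon> * (indicator D x * \<bar>?W x\<bar>) \<le> indicator D x * (f (\<sigma> x) * ?W x)"
      proof (cases "x \<in> D \<and> \<phi>c x \<le> \<tau>")
        case True
        then have "\<bar>f (\<sigma> x) - h (\<sigma> x)\<bar> \<le> \<epsilon>" using h(3) C(3) by (simp add: less_imp_le)
        then have "\<bar>f (\<sigma> x) - h (\<sigma> x)\<bar> * \<bar>?W x\<bar> \<le> \<epsilon> * \<bar>?W x\<bar>" by (rule mult_right_mono) simp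
        moreover have "(h (\<sigma> x) - f (\<sigma> x)) * ?W x \<le> \<bar>f (\<sigma> x) - h (\<sigma> x)\<bar> * \<bar>?W x\<bar>"
          using abs_ge_self[of "(h (\<sigma> x) - f (\<sigma> x)) * ?W x"] by (simp add: abs_mult abs_minus_commute)
        ultimately show ?thesis using True by (simp add: algebra_simps)
      next
        case False
        then show ?thesis using W0[of x] by (cases "x \<in> D") auto
      qed
    qed (rule intfW)
    moreover have "(\<integral>x. indicator D x * ((h \<circ> \<sigma>) x * ?W x) - \<epsilon> * (indicator D x * \<bar>?W x\<bar>) \<partial>lborel)
       = (\<integral>x. indicator D x * ((h \<circ> \<sigma>) x * ?W x) \<partial>lborel) - \<epsilon> * A"
      unfolding A_def using inth intW by (subst Bochner_Integration.integral_diff) auto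
    ultimately show ?thesis using nn by linarith
  qed
  note ge = this
  have le: "- (\<integral>x. indicator D x * (f (\<sigma> x) * ?W x) \<partial>lborel) \<le> \<epsilon> * A" if "\<epsilon> > 0" for \<epsilon>
    using ge[OF that] by linarith
  show ?thesis
  proof (rule ccontr)
    assume "\<not> ?thesis"
    then have neg: "- (\<integral>x. indicator D x * (f (\<sigma> x) * ?W x) \<partial>lborel) > 0" (is "?i > 0") by simp
    \<comment> \<open>The choice of \<open>\<epsilon>\<close> makes the error at most half of
      \<open>?i\<close>; the summand 1 covers the case \<open>A = 0\<close>.\<close>
    have "?i \<le> ?i / (2 * (A + 1)) * A" using A0 by (intro le divide_pos_pos neg) simp
    also have "\<dots> = ?i / 2 * (A / (A + 1))" by simp
    also have "\<dots> \<le> ?i / 2 * 1" by (rule mult_left_mono) (use neg A0 in auto)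
    finally show False using neg by simp
  qed
qed

end

section \<open>Linear growth of the integrals\<close>

context eh_exhaustion begin

lemma flux_zero_imp:
  assumes "grad_norm_sq Q m1 m2 F x = 0" shows "flx F x = 0"
proof -
  have "Q x * (horizontal m1 m2 F x)\<^sup>2 \<ge> 0" "((partial 2 F x)\<^sup>2 + (partial 3 F x)\<^sup>2) / Q x \<ge> 0"
    using Q_pos[of x] by simp_all
  with assms have "Q x * (horizontal m1 m2 F x)\<^sup>2 = 0" "((partial 2 F x)\<^sup>2 + (partial 3 F x)\<^sup>2) / Q x = 0"
    unfolding grad_norm_sq_def by linarith+
  then have "horizontal m1 m2 F x = 0" "partial 2 F x = 0" "partial 3 F x = 0"
    using Q_pos[of x] by (simp_all add: sum_power2_eq_zero_iff)
  then show ?thesis by (simp add: vec_eq_iff forall_3 flux_component)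
qed

lemma grad_norm_sq_shift:
  assumes x: "x$1 \<in> J"
  shows "grad_norm_sq Q m1 m2 \<phi>c (x + (of_int k * L) *\<^sub>R axis 1 1) = grad_norm_sq Q m1 m2 \<phi>c x"
proof (cases "L = 0")
  case False
  then have J: "J = UNIV" using L by simp
  have "partial i \<phi>c (x + (of_int k * L) *\<^sub>R axis 1 1) = partial i \<phi>c x" for i
    by (rule partial_periodic) (use \<phi>c_shift \<phi>c_Ck[of 1] J in auto)
  then show ?thesis unfolding grad_norm_sq_def horizontal_def frame_shift[OF x] by simp
qed simp

text \<open>The point comes from an arbitrary chart. Since the gradient norm is periodic, it can be
  moved into \<open>D\<close>, over which the integrals are taken.\<close>

lemma nonzero_grad_imp:
  assumes "nonzero_grad_at M \<phi> m"
  obtains x where "x \<in> D" "\<sigma> x = m" "grad_norm_sq Q m1 m2 \<phi>c x > 0"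
proof -
  obtain I x where I: "open I" "I \<subseteq> J" "x$1 \<in> I" "\<sigma> x = m" "grad_coord (gmetric M \<sigma>) (\<phi> \<circ> \<sigma>) x \<noteq> 0"
    using assms unfolding nonzero_grad_at_def by (auto simp: atlas_M)
  have x: "x$1 \<in> J" using I by auto
  then have xJ: "x \<in> chart_dom J" by simp
  have eq: "(\<phi> \<circ> \<sigma>) y = \<phi>c y" if "y \<in> chart_dom J" for y using that by (simp add: \<phi>_\<sigma>)
  have "(\<phi> \<circ> \<sigma>) differentiable (at x)"
    by (rule differentiable_cong_open[OF open_J3 xJ, of \<phi>c]) (use eq \<phi>c_Ck[of 1] x in auto)
  then have "grad_coord (gmetric M \<sigma>) (\<phi> \<circ> \<sigma>) x = (1 / sqrt (Q x)) *\<^sub>R flx (\<phi> \<circ> \<sigma>) x"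
    by (rule grad_coord_frame_metric[where g = "gmetric M \<sigma>" and x = x and Q = Q and ?m1.0 = m1 and ?m2.0 = m2, OF Q_pos gmetric_M[OF x]])
  moreover have "partial i (\<phi> \<circ> \<sigma>) x = partial i \<phi>c x" for i
    by (rule partial_cong_open[OF open_J3 xJ eq])
  then have "flx (\<phi> \<circ> \<sigma>) x = flx \<phi>c x" by (simp add: flux_def horizontal_def)
  ultimately have "flx \<phi>c x \<noteq> 0" using I(5) by auto
  then have "grad_norm_sq Q m1 m2 \<phi>c x \<noteq> 0" using flux_zero_imp by blast
  moreover have "grad_norm_sq Q m1 m2 \<phi>c x \<ge> 0" by (rule grad_norm_sq_nonneg[OF Q_pos])
  ultimately have N: "grad_norm_sq Q m1 m2 \<phi>c x > 0" by simp
  have "\<exists>k::int. x + (of_int k * L) *\<^sub>R axis 1 1 \<in> D"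
  proof (cases "L = 0")
    case True
    then show ?thesis using x unfolding D_def by simp
  next
    case False
    then have "L > 0" "J = UNIV" using L by auto
    then show ?thesis using floor_shift[of L "x$1"] unfolding D_def mem_Collect_eq shift_nth by blast
  qed
  then obtain k :: int where k: "x + (of_int k * L) *\<^sub>R axis 1 1 \<in> D" ..
  show ?thesis
    by (rule that[OF k]) (use \<sigma>_shift[OF x] I(4) N grad_norm_sq_shift[OF x] in auto)
qed

text \<open>A point of \<open>D\<close> may lie on the face x1 = 0. A small step in the positive
  first direction leads to the interior of \<open>D\<close> without leaving
  \<open>U\<close>.\<close>

lemma open_meets_D:
  assumes "open U" "x \<in> U" "x \<in> D" obtains U' where "open U'" "U' \<noteq> {}" "U' \<subseteq> U \<inter> D"
proof (cases "L = 0")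
  case True
  then have "D = chart_dom J" unfolding D_def by simp
  then show ?thesis using that[of "U \<inter> D"] assms open_J3 by auto
next
  case False
  then have Lp: "L > 0" and J: "J = UNIV" using L by auto
  obtain e where e: "e > 0" "ball x e \<subseteq> U" using assms(1,2) open_contains_ball by blast
  \<comment> \<open>Shorter than the radius of the ball, and short enough to stop before the face x1
    = L.\<close>
  define r where "r = min (e / 2) ((L - x$1) / 2)"
  have xD: "0 \<le> x$1" "x$1 < L" using assms(3) Lp unfolding D_def by auto
  have r: "0 < r" "r < e" "x$1 + r < L" using e(1) xD unfolding r_def by (auto simp: min_def field_simps)
  let ?y = "x + r *\<^sub>R axis 1 1"
  have "?y \<in> ball x e" using r by (simp add: dist_norm)
  then have "?y \<in> U \<inter> chart_dom {0<..<L}" using e(2) r xD by (auto simp: shift_nth)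
  moreover have "U \<inter> chart_dom {0<..<L} \<subseteq> U \<inter> D" unfolding D_def using J by auto
  moreover have "open (U \<inter> chart_dom {0<..<L})" by (intro open_Int assms(1) open_chart_dom) simp
  ultimately show ?thesis using that[of "U \<inter> chart_dom {0<..<L}"] by blast
qed

text \<open>By continuity, positivity at one point spreads to a nonempty open subset of
  \<open>D\<close>, which is not a null set.\<close>

lemma integral_pos:
  assumes G: "continuous_on (chart_dom J) G" "\<And>x. x$1 \<in> J \<Longrightarrow> G x \<ge> 0" "integrable lborel (\<lambda>x. indicator D x * G x)"
    and x: "x \<in> D" "G x > (0::real)"
  shows "(\<integral>x. indicator D x * G x \<partial>lborel) > 0"
proof -
  have DJ: "y \<in> D \<Longrightarrow> y$1 \<in> J" for y using D_sub by auto
  have nn: "indicator D y * G y \<ge> 0" for y using G(2) DJ by (cases "y \<in> D") auto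
  have "open (chart_dom J \<inter> G -` {0<..})" by (rule continuous_open_preimage[OF G(1) open_J3]) simp
  then obtain U where U: "open U" "U \<noteq> {}" "U \<subseteq> (chart_dom J \<inter> G -` {0<..}) \<inter> D"
    by (rule open_meets_D[of _ x]) (use x DJ in auto)
  have "(\<integral>x. indicator D x * G x \<partial>lborel) \<noteq> 0"
  proof
    assume "(\<integral>x. indicator D x * G x \<partial>lborel) = 0"
    then have "AE x in lborel. indicator D x * G x = 0"
      using integral_nonneg_eq_0_iff_AE[OF G(3)] nn by simp
    then have "AE x in lborel. x \<in> U \<longrightarrow> x \<in> {}"
      by eventually_elim (use U(3) in \<open>auto simp: indicator_def\<close>)
    then have "AE x\<in>U in lebesgue. x \<in> {}" by (rule AE_completion)
    with U(1,2) show False using mem_closed_if_AE_lebesgue_open[of U "{}"] by blast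
  qed
  moreover have "(\<integral>x. indicator D x * G x \<partial>lborel) \<ge> 0" by (rule Bochner_Integration.integral_nonneg) (rule nn)
  ultimately show ?thesis by simp
qed

definition sublevel :: "real \<Rightarrow> (real^3) set" where "sublevel \<tau> = {x \<in> D. \<phi>c x \<le> \<tau>}"

lemma sublevel_borel [measurable]: "sublevel \<tau> \<in> sets borel"
proof -
  have "sublevel \<tau> = D - {x. x$1 \<in> J \<and> \<phi>c x > \<tau>}" using D_sub by (auto simp: sublevel_def)
  then show ?thesis using open_superlevel by simp
qed

lemma integrable_sublevel:
  assumes "continuous_on (chart_dom J) (G :: real^3 \<Rightarrow> real)"
  shows "integrable lborel (\<lambda>x. indicator (sublevel \<tau>) x * G x)"
proof -
  obtain C where C: "compact C" "C \<subseteq> chart_dom J" "\<And>x. x \<in> D \<Longrightarrow> \<phi>c x \<le> \<tau> \<Longrightarrow> x \<in> C"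
    using box_D[of \<tau>] by blast
  show ?thesis
    by (rule integrable_indicator_bounded_support[OF sublevel_borel C(1) continuous_on_subset[OF assms C(2)]])
      (use C(3) in \<open>auto simp: sublevel_def\<close>)
qed

text \<open>Within \<open>D\<close> the sublevel set is contained in a compact subset of
  \<open>chart_dom J\<close>. The integral is therefore finite and can be treated as a real
  number.\<close>

lemma nn_integral_sublevel:
  assumes f: "continuous_map (mtop M) euclideanreal f" "\<And>m. m \<in> carr M \<Longrightarrow> 0 \<le> f m"
  shows "(\<integral>\<^sup>+m\<in>{m \<in> carr M. \<phi> m \<le> \<tau>}. ennreal (f m) \<partial>riem_volume M)
    = ennreal (\<integral>x. indicator (sublevel \<tau>) x * (f (\<sigma> x) * sqrt (Q x)) \<partial>lborel)"
proof -
  have DJ: "x \<in> D \<Longrightarrow> x$1 \<in> J" for x using D_sub by auto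
  have f': "f \<in> borel_measurable BM" "\<phi> \<in> borel_measurable BM"
    using continuous_imp_borel_BM f(1) continuous_map_\<phi> by auto
  have "{m \<in> space BM. \<phi> m \<le> \<tau>} \<in> sets BM" by (rule borel_measurable_le[OF f'(2) borel_measurable_const])
  then have s: "{m \<in> carr M. \<phi> m \<le> \<tau>} \<in> sets BM" by (simp add: space_BM)
  have "(\<lambda>m. ennreal (f m) * indicator {m \<in> carr M. \<phi> m \<le> \<tau>} m) \<in> borel_measurable BM"
    using f'(1) s by (intro borel_measurable_times_ennreal borel_measurable_indicator measurable_compose[OF f'(1) measurable_ennreal])
  from nn_integral_\<mu>[OF this]
  have "(\<integral>\<^sup>+m\<in>{m \<in> carr M. \<phi> m \<le> \<tau>}. ennreal (f m) \<partial>riem_volume M) =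
    (\<integral>\<^sup>+x. ennreal (f (\<sigma> x)) * indicator {m \<in> carr M. \<phi> m \<le> \<tau>} (\<sigma> x) * indicator D x * ennreal (sqrt (Q x)) \<partial>lborel)" .
  also have "\<dots> = (\<integral>\<^sup>+x. ennreal (indicator (sublevel \<tau>) x * (f (\<sigma> x) * sqrt (Q x))) \<partial>lborel)"
  proof (rule nn_integral_cong)
    fix x
    show "ennreal (f (\<sigma> x)) * indicator {m \<in> carr M. \<phi> m \<le> \<tau>} (\<sigma> x) * indicator D x * ennreal (sqrt (Q x))
      = ennreal (indicator (sublevel \<tau>) x * (f (\<sigma> x) * sqrt (Q x)))"
    proof (cases "x \<in> D")
      case True
      then have x: "x$1 \<in> J" by (rule DJ)
      then have "\<sigma> x \<in> carr M" by (auto simp: carr_M)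
      then show ?thesis using True f(2)[of "\<sigma> x"] x
        by (auto simp: indicator_def sublevel_def \<phi>_\<sigma> ennreal_mult')
    qed (simp add: sublevel_def)
  qed
  also have "\<dots> = ennreal (\<integral>x. indicator (sublevel \<tau>) x * (f (\<sigma> x) * sqrt (Q x)) \<partial>lborel)"
  proof (rule nn_integral_eq_integral)
    show "integrable lborel (\<lambda>x. indicator (sublevel \<tau>) x * (f (\<sigma> x) * sqrt (Q x)))"
      using continuous_on_comp_\<sigma>[OF f(1)] sqrt_Q_cont
      by (intro integrable_sublevel continuous_on_mult) (auto simp: comp_def)
    have "0 \<le> indicator (sublevel \<tau>) x * (f (\<sigma> x) * sqrt (Q x))" for x
    proof (cases "x \<in> sublevel \<tau>")
      case True
      then have "\<sigma> x \<in> carr M" using DJ by (auto simp: carr_M sublevel_def)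
      then show ?thesis using f(2)[of "\<sigma> x"] Q_pos[of x] by (simp add: less_imp_le)
    qed simp
    then show "AE x in lborel. 0 \<le> indicator (sublevel \<tau>) x * (f (\<sigma> x) * sqrt (Q x))" by simp
  qed
  finally show ?thesis .
qed

text \<open>Testing with \<open>\<psi> = cutoff a T \<circ> \<phi>\<close> compares the part of the integral of
  \<open>f\<close> near the level \<open>a\<close>, which does not depend on \<open>T\<close>, with \<open>1 / T\<close> times the integral
  of \<open>f\<close> up to the level \<open>a + 1 + 2 T\<close>.\<close>

lemma linear_growth:
  assumes f: "f \<in> Sigma_closure M" and nn: "\<And>m. m \<in> carr M \<Longrightarrow> 0 \<le> f m"
    and m: "0 < f m" "nonzero_grad_at M \<phi> m"
  shows "\<exists>A \<tau>\<^sub>0. 0 < A \<and> (\<forall>\<tau>\<ge>\<tau>\<^sub>0. ennreal (A * (\<tau> - \<tau>\<^sub>0)) \<le>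
             (\<integral>\<^sup>+m\<in>{m \<in> carr M. \<phi> m \<le> \<tau>}. ennreal (f m) \<partial>riem_volume M))"
proof -
  have DJ: "x \<in> D \<Longrightarrow> x$1 \<in> J" for x using D_sub by auto
  have fc: "continuous_map (mtop M) euclideanreal f" using f by (simp add: Sigma_closure_def)
  obtain x0 where x0: "x0 \<in> D" "\<sigma> x0 = m" "grad_norm_sq Q m1 m2 \<phi>c x0 > 0" using nonzero_grad_imp[OF m(2)] .
  \<comment> \<open>The tent \<open>bend''\<close> is centred at the level of \<open>x0\<close> and
    has value 1 there, which makes \<open>c0\<close> positive.\<close>
  define a where "a = \<phi>c x0"
  define B where "B = 1 / (2 * t\<^sup>2) + 1 / 2"
  have B: "B > 0" by (simp add: B_def add_nonneg_pos)
  let ?N = "grad_norm_sq Q m1 m2 \<phi>c"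
  define g where "g x = f (\<sigma> x) * (sqrt (Q x) * ?N x)" for x
  have f\<sigma>: "continuous_on (chart_dom J) (\<lambda>x. f (\<sigma> x))" using continuous_on_comp_\<sigma>[OF fc] by (simp add: comp_def)
  have fnn: "f (\<sigma> x) \<ge> 0" if "x$1 \<in> J" for x using nn that by (auto simp: carr_M)
  have Nnn: "?N x \<ge> 0" for x by (rule grad_norm_sq_nonneg[OF Q_pos])
  have Nc: "continuous_on (chart_dom J) ?N"
  proof -
    have "Ck_on 0 (chart_dom J) ?N" unfolding grad_norm_sq_def[abs_def]
      using Q_pos by (intro Ck_intros open_J3 Q_Ck Ck_on_horizontal m_Ck \<phi>c_Ck Ck_on_partial)
        (simp add: less_imp_neq[symmetric])
    then show ?thesis by simp
  qed
  have gc: "continuous_on (chart_dom J) g" unfolding g_def by (intro continuous_on_mult f\<sigma> sqrt_Q_cont Nc)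
  have \<phi>cc: "continuous_on (chart_dom J) \<phi>c" by (rule Ck_on_imp_continuous_on[OF \<phi>c_Ck])
  have gnn: "g x \<ge> 0" if "x$1 \<in> J" for x unfolding g_def using fnn[OF that] Nnn Q_pos[of x] by simp
  have tc: "continuous_on (chart_dom J) (\<lambda>x. g x * bend'' (\<phi>c x - a))"
    unfolding bend''_def by (intro continuous_intros gc \<phi>cc)
  have t_int: "integrable lborel (\<lambda>x. indicator D x * (g x * bend'' (\<phi>c x - a)))"
    by (rule integrable_D[OF tc, of "a + 1"]) (simp add: bend'')
  define c0 where "c0 = (\<integral>x. indicator D x * (g x * bend'' (\<phi>c x - a)) \<partial>lborel)"
  have c0: "c0 > 0" unfolding c0_def
  proof (rule integral_pos[OF tc _ t_int x0(1)])
    show "g x * bend'' (\<phi>c x - a) \<ge> 0" if "x$1 \<in> J" for x using gnn[OF that] bend''(1) by simp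
    show "g x0 * bend'' (\<phi>c x0 - a) > 0" using x0 m(1) Q_pos[of x0] by (simp add: g_def a_def bend'')
  qed
  define I where "I \<tau> = (\<integral>x. indicator (sublevel \<tau>) x * (f (\<sigma> x) * sqrt (Q x)) \<partial>lborel)" for \<tau>
  have fQ: "continuous_on (chart_dom J) (\<lambda>x. f (\<sigma> x) * sqrt (Q x))" by (intro continuous_on_mult f\<sigma> sqrt_Q_cont)
  have main: "c0 \<le> B / T * I (a + 1 + 2 * T)" if T: "T > 0" for T
  proof -
    let ?F = "\<lambda>x. cutoff a T (\<phi>c x)" and ?\<tau> = "a + 1 + 2 * T"
    have F: "Ck_on 2 (chart_dom J) ?F"
      by (rule Ck_on_compose_real[OF open_J3 open_UNIV _ Ck_on_cutoff[OF T] \<phi>c_Ck]) simp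
    have W: "divergence (flx ?F) x = cutoff' a T (\<phi>c x) * divergence (flx \<phi>c) x + cutoff'' a T (\<phi>c x) * (sqrt (Q x) * ?N x)"
      if "x$1 \<in> J" for x
      by (rule divergence_flux_compose[OF open_J3 _ Q_Ck Q_pos m_Ck \<phi>c_Ck DERIV_cutoff(1)[OF T] DERIV_cutoff(2)[OF T]]) (use that in simp)
    have per: "?F (x + L *\<^sub>R axis 1 1) = ?F x" if "L > 0" for x
      using \<phi>c_shift[of x 1] L(2)[OF that] by simp
    have F0: "?F x = 0" if "\<phi>c x > ?\<tau>" for x using that by (intro cutoff_far[OF T]) simp
    have ge: "0 \<le> (\<integral>x. indicator D x * (f (\<sigma> x) * divergence (flx ?F) x) \<partial>lborel)"
      by (rule Sigma_test_nonneg[OF f F per _ F0]) (use cutoff_nonneg[OF T] in auto)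
    have W0: "divergence (flx ?F) x = 0" if "x \<in> D" "\<phi>c x > ?\<tau>" for x
      by (rule flux_zero_superlevel(2)[OF F0]) (use that DJ[OF that(1)] in auto)
    have i1: "integrable lborel (\<lambda>x. indicator D x * (f (\<sigma> x) * divergence (flx ?F) x))"
      by (rule integrable_D[OF continuous_on_mult[OF f\<sigma> continuous_div_flx[OF F]], of ?\<tau>]) (simp add: W0)
    have i2: "integrable lborel (\<lambda>x. indicator (sublevel ?\<tau>) x * (f (\<sigma> x) * sqrt (Q x)))"
      by (rule integrable_sublevel[OF fQ])
    \<comment> \<open>The term with \<open>cutoff'\<close> is discarded by its sign. Of the two
      parts of \<open>cutoff''\<close>, the wide one is at most 1 / T and vanishes above the top
      level, the narrow one yields the integrand of \<open>c0\<close>.\<close>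
    have pt: "indicator D x * (f (\<sigma> x) * divergence (flx ?F) x) \<le>
        B / T * (indicator (sublevel ?\<tau>) x * (f (\<sigma> x) * sqrt (Q x))) - indicator D x * (g x * bend'' (\<phi>c x - a))" for x
    proof (cases "x \<in> D")
      case True
      then have x: "x$1 \<in> J" by (rule DJ)
      let ?p = "bend'' ((\<phi>c x - (a + 1 + T)) / T)"
      have "cutoff' a T (\<phi>c x) * divergence (flx \<phi>c) x \<le> 0"
        using cutoff'_nonpos[OF T] divergence_flux_\<phi>c[OF x] by (rule mult_nonpos_nonneg)
      then have "f (\<sigma> x) * divergence (flx ?F) x \<le> f (\<sigma> x) * (cutoff'' a T (\<phi>c x) * (sqrt (Q x) * ?N x))"
        unfolding W[OF x] using fnn[OF x] by (intro mult_left_mono) auto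
      also have "\<dots> = ?p / T * g x - g x * bend'' (\<phi>c x - a)"
        by (simp add: cutoff''_def g_def algebra_simps)
      also have "?p / T * g x \<le> B / T * (indicator (sublevel ?\<tau>) x * (f (\<sigma> x) * sqrt (Q x)))"
      proof (cases "\<phi>c x \<le> ?\<tau>")
        case True
        then have xs: "x \<in> sublevel ?\<tau>" using \<open>x \<in> D\<close> by (simp add: sublevel_def)
        have "?p * ?N x \<le> 1 * B"
          using bend''(1,2) Nnn grad_norm_sq_\<phi>c[OF x] by (intro mult_mono) (auto simp: B_def)
        then have "?p * ?N x * (f (\<sigma> x) * sqrt (Q x)) / T \<le> B * (f (\<sigma> x) * sqrt (Q x)) / T"
          using fnn[OF x] Q_pos[of x] T by (intro divide_right_mono mult_right_mono) auto
        then show ?thesis using xs by (simp add: g_def mult_ac)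
      next
        case False
        then have "(\<phi>c x - (a + 1 + T)) / T \<ge> 1" using T by (simp add: field_simps)
        then have "?p = 0" using bend''(3)[OF order_trans[OF _ abs_ge_self]] by blast
        then show ?thesis using False by (simp add: sublevel_def)
      qed
      finally show ?thesis using True by simp
    qed (simp add: sublevel_def)
    have "0 \<le> (\<integral>x. indicator D x * (f (\<sigma> x) * divergence (flx ?F) x) \<partial>lborel)" by (rule ge)
    also have "\<dots> \<le> (\<integral>x. B / T * (indicator (sublevel ?\<tau>) x * (f (\<sigma> x) * sqrt (Q x))) - indicator D x * (g x * bend'' (\<phi>c x - a)) \<partial>lborel)"
      by (rule integral_mono[OF i1 Bochner_Integration.integrable_diff[OF integrable_mult_right[OF i2] t_int] pt])
    also have "\<dots> = B / T * I ?\<tau> - c0"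
      unfolding I_def c0_def
      by (subst Bochner_Integration.integral_diff[OF integrable_mult_right[OF i2] t_int]) simp
    finally show ?thesis by simp
  qed
  \<comment> \<open>With \<tau> = a + 1 + 2 T the estimate \<open>main\<close> reads
    \<open>I \<tau> \<ge> c0 * T / B\<close>, and T is half of \<tau> - (a + 1). This gives the
    constant, and a + 1 as the initial level.\<close>
  define A where "A = c0 / (2 * B)"
  have "0 < A" using c0 B by (simp add: A_def)
  moreover have "ennreal (A * (\<tau> - (a + 1))) \<le> (\<integral>\<^sup>+m\<in>{m \<in> carr M. \<phi> m \<le> \<tau>}. ennreal (f m) \<partial>riem_volume M)"
    if \<tau>: "\<tau> \<ge> a + 1" for \<tau>
  \<comment> \<open>For \<tau> = a + 1 the left-hand side is 0; otherwise \<open>T\<close> is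
    positive, as \<open>main\<close> requires.\<close>
  proof (cases "\<tau> = a + 1")
    case False
    define T where "T = (\<tau> - (a + 1)) / 2"
    have "2 * T = \<tau> - (a + 1)" by (simp add: T_def)
    then have T: "T > 0" "a + 1 + 2 * T = \<tau>" using \<tau> False by linarith+
    have "A * (\<tau> - (a + 1)) = c0 * T / B" using B by (simp add: A_def T_def field_simps)
    also have "\<dots> \<le> (B / T * I \<tau>) * T / B"
      using main[OF T(1)] T B by (intro divide_right_mono mult_right_mono) auto
    also have "\<dots> = I \<tau>" using T(1) B by simp
    finally have "ennreal (A * (\<tau> - (a + 1))) \<le> ennreal (I \<tau>)" by (rule ennreal_leI)
    also have "\<dots> = (\<integral>\<^sup>+m\<in>{m \<in> carr M. \<phi> m \<le> \<tau>}. ennreal (f m) \<partial>riem_volume M)"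
      unfolding I_def by (rule nn_integral_sublevel[OF fc nn, symmetric])
    finally show ?thesis .
  qed simp
  ultimately show ?thesis by blast
qed

lemma total_integral_infinite:
  assumes A: "0 < (A::real)" "\<And>\<tau>. \<tau> \<ge> \<tau>\<^sub>0 \<Longrightarrow> ennreal (A * (\<tau> - \<tau>\<^sub>0)) \<le>
             (\<integral>\<^sup>+m\<in>{m \<in> carr M. \<phi> m \<le> \<tau>}. ennreal (f m) \<partial>riem_volume M)"
  shows "(\<integral>\<^sup>+m\<in>carr M. ennreal (f m) \<partial>riem_volume M) = \<infinity>"
proof (rule ccontr)
  assume "\<not> ?thesis"
  then obtain r where r: "(\<integral>\<^sup>+m\<in>carr M. ennreal (f m) \<partial>riem_volume M) = ennreal r" "r \<ge> 0"
    by (cases "\<integral>\<^sup>+m\<in>carr M. ennreal (f m) \<partial>riem_volume M" rule: ennreal_cases) auto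
  \<comment> \<open>The level at which the linear lower bound reaches r + 1.\<close>
  define \<tau> where "\<tau> = \<tau>\<^sub>0 + (r + 1) / A"
  have "ennreal (A * (\<tau> - \<tau>\<^sub>0)) \<le> (\<integral>\<^sup>+m\<in>{m \<in> carr M. \<phi> m \<le> \<tau>}. ennreal (f m) \<partial>riem_volume M)"
    using A(1) r(2) by (intro A(2)) (simp add: \<tau>_def)
  also have "\<dots> \<le> (\<integral>\<^sup>+m\<in>carr M. ennreal (f m) \<partial>riem_volume M)"
    by (intro nn_integral_mono) (auto simp: indicator_def)
  also have "\<dots> = ennreal r" by (rule r)
  finally have "A * (\<tau> - \<tau>\<^sub>0) \<le> r" using r(2) by (simp add: ennreal_le_iff)
  moreover have "A * (\<tau> - \<tau>\<^sub>0) = r + 1" using A(1) by (simp add: \<tau>_def)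
  ultimately show False by simp
qed

text \<open>Since \<open>\<phi>\<close> is subharmonic everywhere, a single point can serve as
  \<open>K\<close>; a nonempty set is taken so that the supremum over it is a maximum.\<close>

lemma proper_subharmonic_exhaustion:
  "oriented_riemannian_manifold M \<and> connected_space (mtop M) \<and> \<not> compact_space (mtop M) \<and>
    (\<exists>\<phi> K.
       continuous_map (mtop M) euclideanreal \<phi> \<and> proper_map (mtop M) euclideanreal \<phi> \<and>
       compactin (mtop M) K \<and> K \<noteq> {} \<and>
       Cinf M \<phi> \<and>
       uniformly_lipschitz M \<phi> \<and>
       subharmonic_on M (carr M - K) \<phi> \<and>
       (\<forall>f\<in>Sigma_closure M.
          (\<forall>m\<in>carr M. 0 \<le> f m) \<and>
          {m \<in> carr M. 0 < f m \<and> Sup (\<phi> ` K) < \<phi> m \<and> nonzero_grad_at M \<phi> m} \<noteq> {} \<longrightarrow>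
          (\<exists>A \<tau>\<^sub>0. 0 < A \<and> (\<forall>\<tau>\<ge>\<tau>\<^sub>0.
             ennreal (A * (\<tau> - \<tau>\<^sub>0)) \<le>
               (\<integral>\<^sup>+m\<in>{m \<in> carr M. \<phi> m \<le> \<tau>}. ennreal (f m) \<partial>riem_volume M))) \<and>
          (\<integral>\<^sup>+m\<in>carr M. ennreal (f m) \<partial>riem_volume M) = \<infinity>))"
proof -
  obtain s where s: "s \<in> J" using J(3) by blast
  define p where "p = \<sigma> (vector [s, 0, 0])"
  have p: "p \<in> carr M" using s by (auto simp: p_def carr_M)
  have K: "compactin (mtop M) {p}" using p by (simp add: finite_imp_compactin)
  have gr: "(\<exists>A \<tau>\<^sub>0. 0 < A \<and> (\<forall>\<tau>\<ge>\<tau>\<^sub>0.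
             ennreal (A * (\<tau> - \<tau>\<^sub>0)) \<le>
               (\<integral>\<^sup>+m\<in>{m \<in> carr M. \<phi> m \<le> \<tau>}. ennreal (f m) \<partial>riem_volume M))) \<and>
          (\<integral>\<^sup>+m\<in>carr M. ennreal (f m) \<partial>riem_volume M) = \<infinity>"
    if f: "f \<in> Sigma_closure M" "\<forall>m\<in>carr M. 0 \<le> f m"
      and ne: "{m \<in> carr M. 0 < f m \<and> Sup (\<phi> ` {p}) < \<phi> m \<and> nonzero_grad_at M \<phi> m} \<noteq> {}" for f
  proof -
    obtain m where m: "0 < f m" "nonzero_grad_at M \<phi> m" using ne by blast
    have "0 \<le> f m" if "m \<in> carr M" for m using f(2) that by blast
    from linear_growth[OF f(1) this m]
    obtain A \<tau>\<^sub>0 where A: "0 < A" "\<And>\<tau>. \<tau> \<ge> \<tau>\<^sub>0 \<Longrightarrow> ennreal (A * (\<tau> - \<tau>\<^sub>0)) \<le>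
             (\<integral>\<^sup>+m\<in>{m \<in> carr M. \<phi> m \<le> \<tau>}. ennreal (f m) \<partial>riem_volume M)" by blast
    from total_integral_infinite[OF A] A show ?thesis by blast
  qed
  show ?thesis
  proof (intro conjI exI[of _ \<phi>] exI[of _ "{p}"])
    show "oriented_riemannian_manifold M" by (rule oriented_M)
    show "connected_space (mtop M)" by (rule connected_M)
    show "\<not> compact_space (mtop M)" by (rule not_compact_M)
    show "continuous_map (mtop M) euclideanreal \<phi>" by (rule continuous_map_\<phi>)
    show "proper_map (mtop M) euclideanreal \<phi>" by (rule proper_map_\<phi>)
    show "compactin (mtop M) {p}" by (rule K)
    show "{p} \<noteq> {}" by simp
    show "Cinf M \<phi>" by (rule Cinf_\<phi>)
    show "uniformly_lipschitz M \<phi>" by (rule uniformly_lipschitz_\<phi>)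
    show "subharmonic_on M (carr M - {p}) \<phi>" by (rule subharmonic_\<phi>)
  qed (intro ballI impI, elim conjE, rule gr)
qed

end

section \<open>Closed curves and complete open curves\<close>

text \<open>The point at issue is openness of \<Gamma> onto its image. If I' is the union of all
  translates of \<open>I\<close> by periods, the image of \<open>I\<close> is the complement, in the
  curve, of the image of the compact set [0, L] - I'.\<close>

lemma eh_curve_closed:
  assumes t: "t \<noteq> 0" and "unit_speed_curve \<Gamma> J" "J = UNIV" and Lp: "L > 0"
    and per: "\<And>s s'. \<Gamma> s = \<Gamma> s' \<longleftrightarrow> (\<exists>k::int. s' = s + of_int k * L)"
  shows "eh_curve t \<Gamma> J L"
proof
  have sm: "smooth_on UNIV \<Gamma>" "\<And>s. cmod (vector_derivative \<Gamma> (at s)) = 1"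
    using assms(2,3) by (auto simp: unit_speed_curve_def)
  have "Ck_on 0 UNIV \<Gamma>" using sm(1) unfolding smooth_on_def by blast
  then have cont: "continuous_on UNIV \<Gamma>" by simp
  show "t \<noteq> 0" "open J" "connected J" "J \<noteq> {}" "smooth_on J \<Gamma>" "L \<ge> 0" "L > 0 \<Longrightarrow> J = UNIV"
    "\<And>s. s \<in> J \<Longrightarrow> cmod (vector_derivative \<Gamma> (at s)) = 1"
    using t sm Lp assms(3) by auto
  show "\<Gamma> s = \<Gamma> s' \<longleftrightarrow> (\<exists>k::int. s' = s + of_int k * L)" for s s' by (rule per)
  fix I :: "real set" assume I: "open I"
  define I' where "I' = (\<Union>k::int. (\<lambda>s. s + of_int k * L) -` I)"
  have "open I'" unfolding I'_def using I by (intro open_UN ballI open_vimage continuous_intros)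
  then have "compact ({0..L} - I')" by (intro compact_diff) auto
  then have cl: "closed (\<Gamma> ` ({0..L} - I'))"
    by (intro compact_imp_closed compact_continuous_image continuous_on_subset[OF cont]) auto
  have "\<Gamma> ` I = \<Gamma> ` J - \<Gamma> ` ({0..L} - I')"
  proof (intro equalityI subsetI)
    fix w assume "w \<in> \<Gamma> ` I"
    then obtain s where s: "s \<in> I" "w = \<Gamma> s" by auto
    have "w \<notin> \<Gamma> ` ({0..L} - I')"
    proof
      assume "w \<in> \<Gamma> ` ({0..L} - I')"
      then obtain r where r: "r \<notin> I'" "\<Gamma> r = \<Gamma> s" using s by auto
      then obtain k :: int where "s = r + of_int k * L" using per by blast
      then have "r \<in> I'" using s(1) by (auto simp: I'_def)
      with r show False by simp
    qed
    then show "w \<in> \<Gamma> ` J - \<Gamma> ` ({0..L} - I')" using s assms(3) by auto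
  next
    fix w assume w: "w \<in> \<Gamma> ` J - \<Gamma> ` ({0..L} - I')"
    then obtain s where s: "w = \<Gamma> s" by auto
    define r where "r = s + of_int (- \<lfloor>s / L\<rfloor>) * L"
    have r: "r \<in> {0..L}" using floor_shift[OF Lp, of s] by (auto simp: r_def)
    have "\<Gamma> s = \<Gamma> r" unfolding per r_def by blast
    then have "r \<in> I'" using w s r by auto
    then obtain k :: int where k: "r + of_int k * L \<in> I" by (auto simp: I'_def)
    have "\<Gamma> r = \<Gamma> (r + of_int k * L)" unfolding per by blast
    then show "w \<in> \<Gamma> ` I" using k s \<open>\<Gamma> s = \<Gamma> r\<close> by auto
  qed
  then have "\<Gamma> ` I = \<Gamma> ` J \<inter> - \<Gamma> ` ({0..L} - I')" by blast
  with cl show "openin (top_of_set (\<Gamma> ` J)) (\<Gamma> ` I)"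
    by (simp add: openin_open_Int open_Compl)
qed

text \<open>With period 0 the condition on equal values expresses injectivity, and relative openness
  is that of a homeomorphism onto the image.\<close>

lemma eh_curve_open:
  assumes t: "t \<noteq> 0" and "open_curve \<Gamma> J"
  shows "eh_curve t \<Gamma> J 0"
proof
  have us: "unit_speed_curve \<Gamma> J" and "\<exists>\<Gamma>'. homeomorphism J (\<Gamma> ` J) \<Gamma> \<Gamma>'"
    using assms(2) unfolding open_curve_def by blast+
  from this(2) obtain \<Gamma>' where h: "homeomorphism J (\<Gamma> ` J) \<Gamma> \<Gamma>'" ..
  show "t \<noteq> 0" "open J" "connected J" "J \<noteq> {}" "smooth_on J \<Gamma>" "(0::real) \<le> 0" "(0::real) < 0 \<Longrightarrow> J = UNIV"
    "\<And>s. s \<in> J \<Longrightarrow> cmod (vector_derivative \<Gamma> (at s)) = 1"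
    using t us unfolding unit_speed_curve_def by simp_all
  have inv: "\<And>s. s \<in> J \<Longrightarrow> \<Gamma>' (\<Gamma> s) = s" by (rule homeomorphism_apply1[OF h])
  show "\<Gamma> s = \<Gamma> s' \<longleftrightarrow> (\<exists>k::int. s' = s + of_int k * 0)" if "s \<in> J" "s' \<in> J" for s s'
  proof -
    have "\<Gamma> s = \<Gamma> s' \<longleftrightarrow> s' = s" using inv[OF that(1)] inv[OF that(2)] by metis
    then show ?thesis by simp
  qed
  show "openin (top_of_set (\<Gamma> ` J)) (\<Gamma> ` I)" if "open I" "I \<subseteq> J" for I
    by (rule homeomorphism_imp_open_map[OF h open_subset[OF that(2,1)]])
qed

section \<open>Spherical arc length of a complete open curve\<close>

lemma antiderivative_open_interval:
  fixes f :: "real \<Rightarrow> real"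
  assumes "open J" "connected J" "continuous_on J f"
  shows "\<exists>l. \<forall>s\<in>J. (l has_real_derivative f s) (at s)"
proof (cases "J = {}")
  case False
  then obtain s0 where s0: "s0 \<in> J" by blast
  have cvx: "{x..y} \<subseteq> J" if "x \<in> J" "y \<in> J" for x y
    using assms(2) that connected_contains_Icc by blast
  have ex: "\<exists>a b. a < s \<and> s < b \<and> a \<in> J \<and> b \<in> J" if s: "s \<in> J" for s
  proof -
    obtain e where e: "e > 0" "ball s e \<subseteq> J" using assms(1) s open_contains_ball by blast
    have "s - e / 2 \<in> J" "s + e / 2 \<in> J" using e by (auto simp: dist_real_def subset_iff)
    then show ?thesis using e(1) by (intro exI[of _ "s - e/2"] exI[of _ "s + e/2"]) auto
  qed
  have "((\<lambda>u. LBINT y=s0..u. f y) has_real_derivative f s) (at s)" if s: "s \<in> J" for s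
  proof -
    obtain a b where ab: "a < s" "s < b" "a \<in> J" "b \<in> J" using ex[OF s] by blast
    \<comment> \<open>A compact interval inside \<open>J\<close> that contains the base point and
      has \<open>s\<close> in its interior, so that the one-sided restriction in the fundamental
      theorem disappears.\<close>
    let ?a = "min a s0" and ?b = "max b s0"
    have "?a \<in> J" "?b \<in> J" using ab s0 by (auto simp: min_def max_def)
    then have "continuous_on {?a..?b} f" using cvx assms(3) continuous_on_subset by blast
    then have "((\<lambda>u. LBINT y=s0..u. f y) has_vector_derivative f s) (at s within {?a..?b})"
      using ab by (intro interval_integral_FTC2) auto
    moreover have "at s within {?a..?b} = at s"
      using ab by (intro at_within_interior) (auto simp: interior_atLeastAtMost_real)
    ultimately show ?thesis by (simp add: has_real_derivative_iff_has_vector_derivative)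
  qed
  then show ?thesis by (intro exI ballI)
qed simp

context eh_curve begin

text \<open>Completeness forces the spherical arc length \<open>l\<close> of an open curve to be unbounded in both
  directions: if \<open>l\<close> omitted a limit value, then the points of the zero section whose parameters
  approach it would form a Cauchy sequence without limit.\<close>

lemma complete_imp_closed_length_range:
  assumes L0: "L = 0" and complete: "riem_complete M"
    and l: "\<And>s. s \<in> J \<Longrightarrow> (l has_real_derivative 1 / wt s) (at s)"
  shows "closed (l ` J)"
  unfolding closed_sequential_limits
proof (intro allI impI)
  fix u v assume "(\<forall>n. u n \<in> l ` J) \<and> u \<longlonglongrightarrow> v"
  then have u: "\<And>n. u n \<in> l ` J" and lim: "u \<longlonglongrightarrow> v" by auto
  have "\<exists>s. s \<in> J \<and> l s = u n" for n
  proof -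
    from u[of n] obtain s where "u n = l s" "s \<in> J" by (rule imageE)
    then show ?thesis by auto
  qed
  then have "\<forall>n. \<exists>s. s \<in> J \<and> l s = u n" by blast
  from choice[OF this] obtain s where s': "\<forall>n. s n \<in> J \<and> l (s n) = u n" by blast
  then have s: "\<And>n. s n \<in> J" "\<And>n. l (s n) = u n" by auto
  define x where "x n = \<sigma> (vector [s n, 0, 0])" for n
  have xM: "x n \<in> carr M" for n unfolding x_def carr_M using s(1) by auto
  define K where "K = sqrt 2 * \<bar>t\<bar>"
  have K: "K > 0" using t by (simp add: K_def)
  have dist: "riem_dist M (x m) (x n) \<le> ennreal (K * \<bar>u n - u m\<bar>)" for m n
    using riem_dist_zero_section[OF L0 s(1) s(1) l, of m n] by (simp add: x_def s(2) K_def)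
  have "\<exists>N. \<forall>m\<ge>N. \<forall>n\<ge>N. riem_dist M (x m) (x n) < \<epsilon>" if \<epsilon>: "\<epsilon> > 0" for \<epsilon> :: ennreal
  proof -
    \<comment> \<open>\<open>\<epsilon>\<close> may be infinite, so a finite positive bound below it
      is chosen.\<close>
    obtain d where d: "0 < d" "d < \<epsilon>" using dense[OF \<epsilon>] by blast
    then have "d \<noteq> top" by auto
    then obtain e where de: "d = ennreal e" "0 \<le> e" by (cases d rule: ennreal_cases) auto
    then have e: "0 < e" "ennreal e < \<epsilon>" using d by (auto simp: order_le_less)
    have "Cauchy u" using lim by (rule LIMSEQ_imp_Cauchy)
    then obtain N where N: "\<And>m n. m \<ge> N \<Longrightarrow> n \<ge> N \<Longrightarrow> dist (u m) (u n) < e / K"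
      using metric_CauchyD[of u "e / K"] e(1) K by auto
    have "riem_dist M (x m) (x n) < \<epsilon>" if "m \<ge> N" "n \<ge> N" for m n
    proof -
      have "K * \<bar>u n - u m\<bar> \<le> e"
        using N[OF that] K by (simp add: dist_real_def field_simps abs_minus_commute)
      then have "ennreal (K * \<bar>u n - u m\<bar>) \<le> ennreal e" by (rule ennreal_leI)
      with dist[of m n] e(2) show ?thesis by (meson le_less_trans)
    qed
    then show ?thesis by blast
  qed
  note cauchy = this
  have "(\<forall>n. x n \<in> carr M) \<and> (\<forall>\<epsilon>>0. \<exists>N. \<forall>m\<ge>N. \<forall>n\<ge>N. riem_dist M (x m) (x n) < \<epsilon>)"
    using xM cauchy by (intro conjI allI impI)
  from mp[OF spec[OF complete[unfolded riem_complete_def]] this]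
  obtain p where p: "p \<in> carr M" "(\<lambda>n. riem_dist M (x n) p) \<longlonglongrightarrow> 0" by (elim bexE)
  then obtain z where z: "z$1 \<in> J" "p = \<sigma> z" unfolding carr_M by auto
  \<comment> \<open>The arc length becomes a Lipschitz function on the manifold, with squared
    gradient 1 / (2 S) \<le> 1 / (2 t^2). Convergence of the points in \<open>riem_dist\<close> then
    forces convergence of the lengths \<open>u n\<close>.\<close>
  define F where "F y = l (y$1)" for y :: "real^3"
  define f where "f q = F (SOME y. y$1 \<in> J \<and> \<sigma> y = q)" for q
  have f: "f (\<sigma> y) = F y" if y: "y$1 \<in> J" for y
  proof -
    define y' where "y' = (SOME y'. y'$1 \<in> J \<and> \<sigma> y' = \<sigma> y)"
    have "y'$1 \<in> J \<and> \<sigma> y' = \<sigma> y" unfolding y'_def by (rule someI[of _ y]) (use y in simp)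
    then have "y' = y" using \<sigma>_eq_iff[OF y, of y'] L0 by auto
    then show ?thesis by (simp add: f_def y'_def)
  qed
  have lCk: "Ck_on 1 J l"
  proof -
    have "continuous_on J (\<lambda>s. 1 / wt s)"
      using wt_pos Ck_on_imp_continuous_on[OF wt_Ck[of 0]] by (intro continuous_intros) (auto simp: less_imp_neq[symmetric])
    then have "Ck_on (Suc 0) J l"
      by (rule_tac Ck_on_SucI_real[OF J(1), of l "\<lambda>s. 1 / wt s"]) (use l in \<open>auto simp: has_real_derivative_iff_has_vector_derivative\<close>)
    then show ?thesis by simp
  qed
  have FCk: "Ck_on 1 (chart_dom J) F" unfolding F_def[abs_def] by (rule Ck_on_of_vec_nth[OF J(1) lCk])
  have gn: "grad_norm_sq Q m1 m2 F y \<le> (1 / (sqrt 2 * \<bar>t\<bar>))\<^sup>2" if y: "y$1 \<in> J" for y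
  proof -
    have "partial i F y = (if i = 1 then 1 / wt (y$1) else 0)" for i
      unfolding F_def[abs_def] by (rule partial_of_nth(1)[OF l[OF y]])
    then have "grad_norm_sq Q m1 m2 F y = Q y * (1 / wt (y$1))\<^sup>2" by (simp add: grad_norm_sq_def horizontal_def)
    also have "\<dots> = 1 / (2 * S y)" using wt_pos[of "y$1"] by (simp add: Q_def power_divide)
    also have "\<dots> \<le> 1 / (2 * t\<^sup>2)" using S_ge[of y] t by (intro divide_left_mono) (auto simp: S_pos)
    finally show ?thesis by (simp add: power_mult_distrib power_divide)
  qed
  have Lip: "ennreal \<bar>f q - f q'\<bar> \<le> ennreal (1 / (sqrt 2 * \<bar>t\<bar>)) * riem_dist M q q'" for q q'
    by (rule riem_dist_Lipschitz[OF FCk f _ gn]) (use t in auto)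
  have fx: "f (x n) = u n" for n using f[of "vector [s n, 0, 0]"] s by (simp add: x_def F_def)
  have fp: "f p = l (z$1)" using f[OF z(1)] by (simp add: z(2) F_def)
  have "(\<lambda>n. ennreal (1 / (sqrt 2 * \<bar>t\<bar>)) * riem_dist M (x n) p) \<longlonglongrightarrow> ennreal (1 / (sqrt 2 * \<bar>t\<bar>)) * 0"
    by (rule ennreal_tendsto_cmult) (use p(2) in auto)
  then have "(\<lambda>n. ennreal (1 / (sqrt 2 * \<bar>t\<bar>)) * riem_dist M (x n) p) \<longlonglongrightarrow> 0" by simp
  moreover have "ennreal \<bar>u n - l (z$1)\<bar> \<le> ennreal (1 / (sqrt 2 * \<bar>t\<bar>)) * riem_dist M (x n) p" for n
    using Lip[of "x n" p] by (simp add: fx fp)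
  ultimately have "(\<lambda>n. ennreal \<bar>u n - l (z$1)\<bar>) \<longlonglongrightarrow> 0"
    by (rule_tac tendsto_sandwich[of "\<lambda>_. 0" _ sequentially "\<lambda>n. ennreal (1 / (sqrt 2 * \<bar>t\<bar>)) * riem_dist M (x n) p"]) auto
  then have "(\<lambda>n. ennreal \<bar>u n - l (z$1)\<bar>) \<longlonglongrightarrow> ennreal 0" by simp
  then have "(\<lambda>n. \<bar>u n - l (z$1)\<bar>) \<longlonglongrightarrow> 0" by (subst (asm) tendsto_ennreal_iff) auto
  then have "u \<longlonglongrightarrow> l (z$1)" by (simp add: LIM_zero_iff tendsto_rabs_zero_iff)
  then have "v = l (z$1)" using lim LIMSEQ_unique by blast
  then show "v \<in> l ` J" using z(1) by simp
qed

text \<open>\<open>l\<close> is strictly increasing, so its range is open by the intermediate value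
  theorem. Completeness makes the range closed, and a nonempty open and closed set is the whole
  line.\<close>

lemma complete_imp_length_onto:
  assumes L0: "L = 0" and complete: "riem_complete M"
    and l: "\<And>s. s \<in> J \<Longrightarrow> (l has_real_derivative 1 / wt s) (at s)"
  shows "l ` J = UNIV" "\<And>a b. a \<in> J \<Longrightarrow> b \<in> J \<Longrightarrow> a < b \<Longrightarrow> l a < l b"
proof -
  have cvx: "{x..y} \<subseteq> J" if "x \<in> J" "y \<in> J" for x y
    using J(2) that connected_contains_Icc by blast
  have lc: "continuous_on J l" using l DERIV_isCont by (intro continuous_at_imp_continuous_on) blast
  show mono: "l a < l b" if "a \<in> J" "b \<in> J" "a < b" for a b
  proof (rule DERIV_pos_imp_increasing[OF that(3)])
    fix x assume "a \<le> x" "x \<le> b"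
    then have "x \<in> J" using cvx[OF that(1,2)] by auto
    then show "\<exists>y. (l has_real_derivative y) (at x) \<and> 0 < y" using l wt_pos[of x] by (intro exI[of _ "1 / wt x"]) auto
  qed
  have "open (l ` J)"
  proof (subst open_subopen, intro ballI)
    fix y assume "y \<in> l ` J"
    then obtain s where s: "s \<in> J" "y = l s" by auto
    obtain e where e: "e > 0" "ball s e \<subseteq> J" using J(1) s(1) open_contains_ball by blast
    have ab: "s - e / 2 \<in> J" "s + e / 2 \<in> J" using e by (auto simp: dist_real_def subset_iff)
    have "{l (s - e/2)<..<l (s + e/2)} \<subseteq> l ` J"
    proof
      fix r assume "r \<in> {l (s - e/2)<..<l (s + e/2)}"
      then obtain c where "s - e/2 \<le> c" "c \<le> s + e/2" "l c = r"
        using IVT'[of l "s - e/2" r "s + e/2"] e(1) continuous_on_subset[OF lc cvx[OF ab]] by auto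
      then show "r \<in> l ` J" using cvx[OF ab] by auto
    qed
    moreover have "y \<in> {l (s - e/2)<..<l (s + e/2)}"
      using mono[OF ab(1) s(1)] mono[OF s(1) ab(2)] e(1) by (simp add: s(2))
    ultimately show "\<exists>T. open T \<and> y \<in> T \<and> T \<subseteq> l ` J" by (intro exI[of _ "{l (s - e/2)<..<l (s + e/2)}"]) auto
  qed
  moreover have "closed (l ` J)" by (rule complete_imp_closed_length_range[OF assms])
  ultimately have "l ` J = {} \<or> l ` J = UNIV" using clopen[of "l ` J"] by blast
  then show "l ` J = UNIV" using J(3) by simp
qed

end

section \<open>The base function for closed curves and for complete open curves\<close>

theorem proposition13:
  fixes t :: real and \<Gamma> :: "real \<Rightarrow> complex" and J :: "real set"
    and M :: "(eh_point, 3) riem_mfd"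
  defines "M \<equiv> eh_three_manifold t \<Gamma> J"
  assumes "t \<noteq> 0"
    and "closed_curve \<Gamma> J \<or> (open_curve \<Gamma> J \<and> riem_complete M)"
  shows "oriented_riemannian_manifold M \<and> connected_space (mtop M) \<and> \<not> compact_space (mtop M) \<and>
    (\<exists>\<phi> K.
       continuous_map (mtop M) euclideanreal \<phi> \<and> proper_map (mtop M) euclideanreal \<phi> \<and>
       compactin (mtop M) K \<and> K \<noteq> {} \<and>
       Cinf M \<phi> \<and>
       uniformly_lipschitz M \<phi> \<and>
       subharmonic_on M (carr M - K) \<phi> \<and>
       (\<forall>f\<in>Sigma_closure M.
          (\<forall>m\<in>carr M. 0 \<le> f m) \<and>
          {m \<in> carr M. 0 < f m \<and> Sup (\<phi> ` K) < \<phi> m \<and> nonzero_grad_at M \<phi> m} \<noteq> {} \<longrightarrow>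
          (\<exists>A \<tau>\<^sub>0. 0 < A \<and> (\<forall>\<tau>\<ge>\<tau>\<^sub>0.
             ennreal (A * (\<tau> - \<tau>\<^sub>0)) \<le>
               (\<integral>\<^sup>+m\<in>{m \<in> carr M. \<phi> m \<le> \<tau>}. ennreal (f m) \<partial>riem_volume M))) \<and>
          (\<integral>\<^sup>+m\<in>carr M. ennreal (f m) \<partial>riem_volume M) = \<infinity>))"
  using assms(3)
proof (elim disjE conjE)
  assume "closed_curve \<Gamma> J"
  then obtain L where "unit_speed_curve \<Gamma> J" "J = UNIV" "L > 0"
    and per: "\<forall>s s'. \<Gamma> s = \<Gamma> s' \<longleftrightarrow> (\<exists>k::int. s' = s + of_int k * L)"
    unfolding closed_curve_def by (elim conjE exE)
  note cl = this(1-3) per[rule_format]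
  interpret eh_curve t \<Gamma> J L by (rule eh_curve_closed[OF assms(2) cl])
  \<comment> \<open>For \<open>c = 0\<close> properness modulo the period only asks for one compact
    interval that meets every orbit of the translations, and [0, L] does.\<close>
  interpret eh_exhaustion t \<Gamma> J L "\<lambda>_. 0" "\<lambda>_. 0" "\<lambda>_. 0"
  proof unfold_locales
    show "\<exists>a b. {a..b} \<subseteq> J \<and> (\<forall>s\<in>J. 0 \<le> \<tau> \<longrightarrow> (\<exists>k::int. s + of_int k * L \<in> {a..b}))" for \<tau> :: real
    proof (intro exI conjI ballI impI)
      show "{0..L} \<subseteq> J" using cl(2) by simp
      show "s + of_int (- \<lfloor>s / L\<rfloor>) * L \<in> {0..L}" for s using floor_shift[OF cl(3), of s] by auto
    qed
  qed (auto simp: smooth_on_def)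
  show ?thesis unfolding M_def by (rule proper_subharmonic_exhaustion)
next
  assume oc: "open_curve \<Gamma> J" and complete: "riem_complete M"
  interpret eh_curve t \<Gamma> J 0 by (rule eh_curve_open[OF assms(2) oc])
  have "continuous_on J (\<lambda>s. 1 / wt s)"
  proof (intro continuous_intros Ck_on_imp_continuous_on[OF wt_Ck[of 0]] ballI)
    show "wt s \<noteq> 0" for s using wt_pos[of s] by simp
  qed
  from antiderivative_open_interval[OF J(1,2) this]
  obtain l where "\<forall>s\<in>J. (l has_real_derivative 1 / wt s) (at s)" ..
  then have l: "\<And>s. s \<in> J \<Longrightarrow> (l has_real_derivative 1 / wt s) (at s)" by (rule bspec)
  have onto: "l ` J = UNIV"
    by (rule complete_imp_length_onto(1)[OF refl complete[unfolded M_def]]) (rule l)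
  have mono: "l x < l y" if "x \<in> J" "y \<in> J" "x < y" for x y
    by (rule complete_imp_length_onto(2)[OF refl complete[unfolded M_def] _ that]) (rule l)
  have lCk: "Ck_on k J l" for k
  proof -
    have nz: "wt s \<noteq> 0" for s using wt_pos[of s] by simp
    have "Ck_on (Suc k) J l"
    proof (rule Ck_on_SucI_real[OF J(1), of l "\<lambda>s. 1 / wt s"])
      show "(l has_vector_derivative 1 / wt s) (at s)" if "s \<in> J" for s
        using l[OF that] by (simp add: has_real_derivative_iff_has_vector_derivative)
      show "Ck_on k J (\<lambda>s. 1 / wt s)" by (rule Ck_on_divide[OF J(1) Ck_on_const wt_Ck nz])
    qed
    then show ?thesis by (rule Ck_on_Suc_imp)
  qed
  have pos: "1 + (l s)\<^sup>2 > 0" for s by (simp add: add_pos_nonneg)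
  define c where "c s = sqrt (1 + (l s)\<^sup>2)" for s
  define c' where "c' s = l s / c s * (1 / wt s)" for s
  \<comment> \<open>As a function of l the second derivative of sqrt (1 + l^2) is 1 / c^3; the
    second summand comes from differentiating 1 / wt.\<close>
  define c'' where "c'' s = 1 / (c s) ^ 3 * (1 / wt s)\<^sup>2 - l s / c s * (dwt s / (wt s)\<^sup>2)" for s
  have cp: "c s > 0" "(c s)\<^sup>2 = 1 + (l s)\<^sup>2" for s
    unfolding c_def by (rule real_sqrt_gt_zero[OF pos], rule real_sqrt_pow2[OF less_imp_le[OF pos]])
  have dc: "(c has_real_derivative c' s) (at s)" if s: "s \<in> J" for s
  proof -
    have "((\<lambda>s. 1 + (l s)\<^sup>2) has_real_derivative 2 * l s * (1 / wt s)) (at s)"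
      using l[OF s] by (auto intro!: derivative_eq_intros)
    from DERIV_chain2[OF DERIV_real_sqrt[OF pos] this] show ?thesis
      unfolding c_def[abs_def] c'_def by (rule DERIV_cong) (simp add: field_simps c_def)
  qed
  have dc': "(c' has_real_derivative c'' s) (at s)" if s: "s \<in> J" for s
  proof -
    have 1: "((\<lambda>s. l s / c s) has_real_derivative (1 / wt s * c s - l s * c' s) / (c s * c s)) (at s)"
      using cp(1)[of s] by (intro DERIV_divide l[OF s] dc[OF s]) simp
    have 2: "((\<lambda>s. 1 / wt s) has_real_derivative - dwt s / (wt s)\<^sup>2) (at s)"
      using DERIV_divide[OF DERIV_const[of 1] wt_deriv[OF s]] wt_pos[of s] by (simp add: power2_eq_square)
    have "(1 / wt s * c s - l s * c' s) / (c s * c s) = ((c s)\<^sup>2 - (l s)\<^sup>2) / (c s) ^ 3 * (1 / wt s)"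
      using cp(1)[of s] wt_pos[of s] by (simp add: c'_def field_simps power2_eq_square power3_eq_cube)
    also have "\<dots> = 1 / (c s) ^ 3 * (1 / wt s)" by (simp add: cp(2))
    finally have 3: "(1 / wt s * c s - l s * c' s) / (c s * c s) = 1 / (c s) ^ 3 * (1 / wt s)" .
    have "((\<lambda>s. l s / c s * (1 / wt s)) has_real_derivative
        1 / (c s) ^ 3 * (1 / wt s) * (1 / wt s) + - dwt s / (wt s)\<^sup>2 * (l s / c s)) (at s)"
      by (rule DERIV_mult[OF 1[unfolded 3] 2])
    moreover have "1 / (c s) ^ 3 * (1 / wt s) * (1 / wt s) + - dwt s / (wt s)\<^sup>2 * (l s / c s) = c'' s"
      by (simp add: c''_def power2_eq_square mult_ac)
    moreover have "c' = (\<lambda>s. l s / c s * (1 / wt s))" by (rule ext) (rule c'_def)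
    ultimately show ?thesis by simp
  qed
  have cl: "\<bar>l s\<bar> \<le> c s" for s
    by (rule power2_le_imp_le) (use cp(1)[of s] in \<open>auto simp: cp(2)\<close>)
  have proper: "\<exists>a b. {a..b} \<subseteq> J \<and> (\<forall>s\<in>J. c s \<le> \<tau> \<longrightarrow> (\<exists>k::int. s + of_int k * 0 \<in> {a..b}))" for \<tau>
  proof -
    \<comment> \<open>As \<open>l\<close> is onto, it attains both values; |l| \<le> c and
      monotonicity then confine the sublevel set to the parameters between them.\<close>
    have im: "- \<tau> \<in> l ` J" "\<tau> \<in> l ` J" unfolding onto by simp_all
    from im(1) obtain a where a: "- \<tau> = l a" "a \<in> J" by (rule imageE)
    from im(2) obtain b where b: "\<tau> = l b" "b \<in> J" by (rule imageE)
    have ab: "a \<in> J" "l a = - \<tau>" "b \<in> J" "l b = \<tau>" using a b by simp_all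
    show ?thesis
    proof (rule exI[of _ a], rule exI[of _ b], intro conjI ballI impI)
      show "{a..b} \<subseteq> J" by (rule connected_contains_Icc[OF J(2) ab(1,3)])
      fix s assume s: "s \<in> J" "c s \<le> \<tau>"
      have "- \<tau> \<le> l s" "l s \<le> \<tau>" using cl[of s] s(2) by auto
      then have "\<not> s < a" "\<not> b < s"
        using mono[OF s(1) ab(1)] mono[OF ab(3) s(1)] ab(2,4) by auto
      then show "\<exists>k::int. s + of_int k * 0 \<in> {a..b}" by simp
    qed
  qed
  have smooth: "smooth_on J c" unfolding smooth_on_def c_def[abs_def]
    by (rule allI, rule Ck_on_sqrt[OF J(1) Ck_on_add[OF J(1) Ck_on_const Ck_on_power[OF J(1) lCk]] pos])
  have bound: "\<bar>c' s\<bar> * wt s \<le> 1" for s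
    using cl[of s] cp(1)[of s] wt_pos[of s] by (simp add: c'_def abs_mult)
  have convex: "0 \<le> c'' s * wt s + c' s * dwt s" for s
  proof -
    \<comment> \<open>The terms with \<open>dwt\<close> cancel, leaving the second derivative in l
      divided by \<open>wt\<close>.\<close>
    have "c'' s * wt s + c' s * dwt s = 1 / (c s) ^ 3 * (1 / wt s)"
      using wt_pos[of s] unfolding c''_def c'_def by (simp add: field_simps power2_eq_square)
    then show ?thesis using wt_pos[of s] cp(1)[of s] by simp
  qed
  have nonneg: "0 \<le> c s" for s using cp(1)[of s] by simp
  interpret eh_exhaustion t \<Gamma> J 0 c c' c''
    by unfold_locales (rule smooth, erule dc, erule dc', rule bound, rule convex, rule nonneg, simp, rule proper)
  show ?thesis unfolding M_def by (rule proper_subharmonic_exhaustion)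
qed

end
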